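(* Let $\mathbf{K}$ be an algebraically closed field of characteristic zero, let $f(Y)\in\mathbf{K}[[X_1,\dots,X_d]][Y]$ be a quasi-ordinary Weierstrass polynomial and let $D_f(\underline X,V)$ be the $Y$-discriminant of the polynomial $f(Y)-V$, where $V$ is a new variable. Then $\Delta(D_f)=\Delta_{T(f)}$.
   Context: Write $\underline X=(X_1,\dots,X_d)$ and $\underline X^{\alpha}=X_1^{\alpha_1}\cdots X_d^{\alpha_d}$ for $\alpha\in\mathbf{Q}_{\ge 0}^d$. A polynomial $f(Y)=Y^n+a_1(\underline X)Y^{n-1}+\cdots+a_n(\underline X)\in\mathbf{K}[[\underline X]][Y]$ ($n\ge 1$) is a Weierstrass polynomial if $a_i(0)=0$ for all $i$. It is quasi-ordinary if its $Y$-discriminant equals $X_1^{\alpha_1}\cdots X_d^{\alpha_d}u(\underline X)$ with $\alpha_i\in\mathbf{N}$ (where $0\in\mathbf{N}$) and $u(0)\ne 0$. Newton polytope: for a power series $h=\sum_{\underline i}a_{\underline i}\underline Z^{\underline i}$ in $s$ variables, $\Delta(h)\subset\mathbf{R}^s$ is the convex hull of $\bigcup_{a_{\underline i}\neq 0}(\underline i+\mathbf{R}_{\ge 0}^s)$; for $D_f$, $s=d+1$ and the last coordinate is the exponent of $V$. Contacts: by the Abhyankar-Jung theorem there is a positive integer $k$ such that all roots $\mathrm{Zer} f=\{Y_1,\dots,Y_n\}$ of $f$ lie in $\mathbf{K}[[X_1^{1/k},\dots,X_d^{1/k}]]$, and for $i\ne j$ one has $Y_i-Y_j=\underline X^{\lambda_{ij}}u_{ij}$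 with $\lambda_{ij}\in\frac1k\mathbf{N}^d$, $u_{ij}\in\mathbf{K}[[X_1^{1/k},\dots,X_d^{1/k}]]$, $u_{ij}(0)\neq 0$. The contact is $O(Y_i,Y_j):=\lambda_{ij}$, and $O(Y_i,Y_i)=+\infty$. $\mathbf{Q}^d$ is partially ordered componentwise, and $\alpha<+\infty$ for all $\alpha\in\mathbf{Q}^d$. For every nonempty $A\subset\mathrm{Zer} f$ the set of contacts between elements of $A$ has a smallest element. Tree model $T(f)$: it is the collection of subsets of $\mathrm{Zer} f$, called bars, obtained recursively as follows. $\mathrm{Zer} f$ is a bar (the bar of lowest height). The height $h(B)$ of a bar $B$ is the minimal contact between elements of $B$ (it is $+\infty$ iff $B$ is a singleton). If $h(B)$ is finite, the equivalence classes of $B$ under the relation $O(Y_i,Y_j)>h(B)$ are again bars, called the postbars of $B$; one writes $B\perp B'$ if $B'$ is a postbar of $B$. Bars of infinite height have no postbars. Let $t(B)$ be the number of postbars of $B$ (including those of infinite height). To each bar $B$ one associates $q(B)$: if $B$ is the bar of lowest height, $q(B)=\#B\cdot h(B)$; if $B\perp B'$, $q(B')=q(B)+\#B'\,(h(B')-h(B))$; if $h(B)$ is infinite then $q(B)$ is infinite. For $q\in\mathbf{Q}_{\ge0}^d$ and a positive integer $k$, the elementary Newton polytope $E(q,k)\subset\mathbf{R}_{\ge0}^{d+1}$ is the convex hull of $\{(q_1,\dots,q_d,0),(0,\dots,0,k)\}+\mathbf{R}_{\ge0}^{d+1}$. For a tree model $T$, $\Delta_T=\sum_{B}E\big((t(B)-1)q(B),\,t(B)-1\big)$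 (Minkowski sum), where $B$ runs over the bars of $T$ of finite height; an empty sum is $\mathbf{R}_{\ge0}^{d+1}$. *)

theory Defs
  imports
    "HOL-Analysis.Analysis"
    "HOL-Library.Extended"
    "Subresultants.Resultant_Prelim"
begin

no_notation Matrix.vec_index (infixl \<open>$\<close> 100)

section \<open>Power series with fractional exponents\<close>

text \<open>
  The type \<open>('a, 'v) pps\<close> is the union over all \<open>k \<ge> 1\<close> of the rings of formal power series in
  the \<open>k\<close>-th roots of the variables, with coefficients in \<open>'a\<close> and one variable for each element
  of the finite type \<open>'v\<close>. The ordinary power series ring is the subring of the series
  supported on \<open>grid 1\<close>, see \<open>integral_pps\<close> below.
\<close>

definition grid :: "nat \<Rightarrow> (rat ^ 'v) set" where
  "grid k = {e. \<forall>i. \<exists>m::nat. e $ i = of_nat m / of_nat k}"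

typedef (overloaded) ('a, 'v) pps =
  "{c :: rat ^ 'v::finite \<Rightarrow> 'a::zero. \<exists>k>0. \<forall>e. c e \<noteq> 0 \<longrightarrow> e \<in> grid k}"
  morphisms pps_coeff Abs_pps
  by (rule exI[of _ "\<lambda>_. 0"]) auto

setup_lifting type_definition_pps

lemma pps_eqI: "(\<And>e. pps_coeff f e = pps_coeff g e) \<Longrightarrow> f = g"
  by (simp add: pps_coeff_inject[symmetric] fun_eq_iff)

lemma grid_zero: "0 \<in> grid k"
  unfolding grid_def by (auto intro!: exI[of _ 0])

lemma grid_add:
  assumes "a \<in> grid k" "b \<in> grid k"
  shows "a + b \<in> grid k"
  unfolding grid_def
proof (intro CollectI allI)
  fix i
  obtain m n :: nat where "a $ i = of_nat m / of_nat k" "b $ i = of_nat n / of_nat k"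
    using assms unfolding grid_def by blast
  then have "(a + b) $ i = of_nat (m + n) / of_nat k"
    by (simp add: add_divide_distrib)
  then show "\<exists>m::nat. (a + b) $ i = of_nat m / of_nat k" by blast
qed

lemma grid_mult_right:
  assumes "a \<in> grid k" "l > 0"
  shows "a \<in> grid (k * l)"
  unfolding grid_def
proof (intro CollectI allI)
  fix i
  obtain m :: nat where "a $ i = of_nat m / of_nat k"
    using assms unfolding grid_def by blast
  then have "a $ i = of_nat (m * l) / of_nat (k * l)"
    using assms(2) by simp
  then show "\<exists>m::nat. a $ i = of_nat m / of_nat (k * l)" by blast
qed

lemma grid_mult_left: "a \<in> grid l \<Longrightarrow> k > 0 \<Longrightarrow> a \<in> grid (k * l)"
  using grid_mult_right[of a l k] by (simp add: mult.commute)

lemma grid_nonneg: "a \<in> grid k \<Longrightarrow> 0 \<le> a $ i"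
  unfolding grid_def by (auto simp: zero_le_divide_iff dest!: spec[of _ i])

definition supported :: "nat \<Rightarrow> ('a::zero, 'v::finite) pps \<Rightarrow> bool" where
  "supported k f \<longleftrightarrow> (\<forall>e. pps_coeff f e \<noteq> 0 \<longrightarrow> e \<in> grid k)"

lemma supported_ex: "\<exists>k>0. supported k f"
  using pps_coeff[of f] unfolding supported_def by simp

lemma supported_ex2: "\<exists>k>0. supported k f \<and> supported k g"
proof -
  obtain k l where "k > 0" "supported k f" "l > 0" "supported l g"
    using supported_ex[of f] supported_ex[of g] by auto
  then have "k * l > 0" "supported (k * l) f" "supported (k * l) g"
    unfolding supported_def by (auto intro: grid_mult_right grid_mult_left)
  then show ?thesis by blast
qed

lemma supported_ex3: "\<exists>k>0. supported k f \<and> supported k g \<and> supported k h"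
proof -
  obtain k l where "k > 0" "supported k f" "supported k g" "l > 0" "supported l h"
    using supported_ex2[of f g] supported_ex[of h] by auto
  then have "k * l > 0" "supported (k * l) f" "supported (k * l) g" "supported (k * l) h"
    unfolding supported_def by (auto intro: grid_mult_right grid_mult_left)
  then show ?thesis by blast
qed

definition decomp :: "nat \<Rightarrow> rat ^ 'v \<Rightarrow> (rat ^ 'v) set" where
  "decomp k e = {a. a \<in> grid k \<and> e - a \<in> grid k}"

lemma finite_decomp:
  fixes e :: "rat ^ 'v::finite"
  assumes "k > 0"
  shows "finite (decomp k e)"
proof -
  define S :: "'v \<Rightarrow> rat set" where
    "S i = (\<lambda>m::nat. of_nat m / of_nat k) ` {m. of_nat m \<le> e $ i * of_nat k}" for i
  have fin: "finite {m::nat. of_nat m \<le> (x::rat)}" for x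
  proof (rule finite_subset)
    show "{m::nat. of_nat m \<le> x} \<subseteq> {..nat \<lfloor>x\<rfloor>}"
    proof
      fix m assume "m \<in> {m::nat. of_nat m \<le> x}"
      then have "int m \<le> \<lfloor>x\<rfloor>" by (simp add: le_floor_iff)
      then show "m \<in> {..nat \<lfloor>x\<rfloor>}" by simp
    qed
  qed simp
  have "decomp k e \<subseteq> vec_lambda ` PiE UNIV S"
  proof
    fix a assume a: "a \<in> decomp k e"
    have "a $ i \<in> S i" for i
    proof -
      obtain m :: nat where m: "a $ i = of_nat m / of_nat k"
        using a unfolding decomp_def grid_def by blast
      have "0 \<le> (e - a) $ i" using a grid_nonneg unfolding decomp_def by blast
      then have "of_nat m \<le> e $ i * of_nat k"
        using m assms by (simp add: field_simps)
      then show ?thesis unfolding S_def m by blast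
    qed
    then have "vec_nth a \<in> PiE UNIV S" by auto
    then show "a \<in> vec_lambda ` PiE UNIV S"
      by (metis image_eqI vec_nth_inverse)
  qed
  moreover have "finite (PiE UNIV S)"
    by (rule finite_PiE) (auto simp: S_def fin)
  ultimately show ?thesis using finite_subset by blast
qed

instantiation pps :: (zero, finite) zero
begin
lift_definition zero_pps :: "('a, 'b) pps" is "\<lambda>_. 0" by auto
instance ..
end

instantiation pps :: (zero_neq_one, finite) one
begin
lift_definition one_pps :: "('a, 'b) pps" is "\<lambda>e. if e = 0 then 1 else 0"
  by (auto intro: exI[of _ 1] grid_zero)
instance ..
end

instantiation pps :: (ab_group_add, finite) ab_group_add
begin

lift_definition uminus_pps :: "('a, 'b) pps \<Rightarrow> ('a, 'b) pps" is "\<lambda>f e. - f e" by auto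

lift_definition plus_pps :: "('a, 'b) pps \<Rightarrow> ('a, 'b) pps \<Rightarrow> ('a, 'b) pps"
  is "\<lambda>f g e. f e + g e"
proof -
  fix f g :: "rat ^ 'b \<Rightarrow> 'a"
  assume "\<exists>k>0. \<forall>e. f e \<noteq> 0 \<longrightarrow> e \<in> grid k" "\<exists>k>0. \<forall>e. g e \<noteq> 0 \<longrightarrow> e \<in> grid k"
  then obtain k l where "k > 0" "\<forall>e. f e \<noteq> 0 \<longrightarrow> e \<in> grid k"
    "l > 0" "\<forall>e. g e \<noteq> 0 \<longrightarrow> e \<in> grid l" by blast
  then have "k * l > 0 \<and> (\<forall>e. f e + g e \<noteq> 0 \<longrightarrow> e \<in> grid (k * l))"
    by (metis add.right_neutral grid_mult_left grid_mult_right nat_0_less_mult_iff)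
  then show "\<exists>k>0. \<forall>e. f e + g e \<noteq> 0 \<longrightarrow> e \<in> grid k" by blast
qed

definition minus_pps :: "('a, 'b) pps \<Rightarrow> ('a, 'b) pps \<Rightarrow> ('a, 'b) pps" where
  "minus_pps f g = f + - g"

instance
proof
  fix f g h :: "('a, 'b) pps"
  show "f + g + h = f + (g + h)" by (rule pps_eqI) (simp add: plus_pps.rep_eq add.assoc)
  show "f + g = g + f" by (rule pps_eqI) (simp add: plus_pps.rep_eq add.commute)
  show "0 + f = f" by (rule pps_eqI) (simp add: plus_pps.rep_eq zero_pps.rep_eq)
  show "- f + f = 0"
    by (rule pps_eqI) (simp add: plus_pps.rep_eq zero_pps.rep_eq uminus_pps.rep_eq)
  show "f - g = f + - g" by (rule minus_pps_def)
qed

end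

lemma pps_coeff_simps [simp]:
  "pps_coeff 0 e = 0"
  "pps_coeff 1 e = (if e = 0 then 1 else 0)"
  "pps_coeff (- f) e = - pps_coeff f e"
  "pps_coeff (f + g) e = pps_coeff f e + pps_coeff g e"
  "pps_coeff (f - g) e = pps_coeff f e - pps_coeff g e"
  by (simp_all add: zero_pps.rep_eq one_pps.rep_eq plus_pps.rep_eq uminus_pps.rep_eq minus_pps_def
      del: add_uminus_conv_diff)

instantiation pps :: (comm_ring_1, finite) times
begin
lift_definition times_pps :: "('a, 'b) pps \<Rightarrow> ('a, 'b) pps \<Rightarrow> ('a, 'b) pps"
  is "\<lambda>f g e. \<Sum>a | f a \<noteq> 0 \<and> g (e - a) \<noteq> 0. f a * g (e - a)"
proof -
  fix f g :: "rat ^ 'b \<Rightarrow> 'a"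
  assume "\<exists>k>0. \<forall>e. f e \<noteq> 0 \<longrightarrow> e \<in> grid k" "\<exists>k>0. \<forall>e. g e \<noteq> 0 \<longrightarrow> e \<in> grid k"
  then obtain k l where kl: "k > 0" "\<forall>e. f e \<noteq> 0 \<longrightarrow> e \<in> grid k"
    "l > 0" "\<forall>e. g e \<noteq> 0 \<longrightarrow> e \<in> grid l" by blast
  have "e \<in> grid (k * l)"
    if nz: "(\<Sum>a | f a \<noteq> 0 \<and> g (e - a) \<noteq> 0. f a * g (e - a)) \<noteq> 0" for e
  proof -
    obtain a where "f a \<noteq> 0" "g (e - a) \<noteq> 0"
      using sum.not_neutral_contains_not_neutral[OF nz] by auto
    then have "a \<in> grid (k * l)" "e - a \<in> grid (k * l)"
      using kl grid_mult_left grid_mult_right by blast+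
    then have "a + (e - a) \<in> grid (k * l)" by (rule grid_add)
    then show ?thesis by simp
  qed
  with kl show "\<exists>k>0. \<forall>e. (\<Sum>a | f a \<noteq> 0 \<and> g (e - a) \<noteq> 0. f a * g (e - a)) \<noteq> 0 \<longrightarrow> e \<in> grid k"
    by (intro exI[of _ "k * l"]) auto
qed
instance ..
end

lemma pps_coeff_mult:
  assumes "k > 0" "supported k f" "supported k g"
  shows "pps_coeff (f * g) e = (\<Sum>a\<in>decomp k e. pps_coeff f a * pps_coeff g (e - a))"
  unfolding times_pps.rep_eq
  by (rule sum.mono_neutral_left[OF finite_decomp[OF assms(1)]])
     (use assms in \<open>auto simp: supported_def decomp_def\<close>)

lemma supported_mult:
  assumes "k > 0" "supported k f" "supported k g"
  shows "supported k (f * g)"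
  unfolding supported_def
proof (intro allI impI)
  fix e assume "pps_coeff (f * g) e \<noteq> 0"
  then have "(\<Sum>a\<in>decomp k e. pps_coeff f a * pps_coeff g (e - a)) \<noteq> 0"
    using pps_coeff_mult[OF assms] by simp
  then obtain a where "a \<in> decomp k e" by (metis sum.not_neutral_contains_not_neutral)
  then have "a + (e - a) \<in> grid k" unfolding decomp_def by (intro grid_add) auto
  then show "e \<in> grid k" by simp
qed

lemma supported_add: "supported k f \<Longrightarrow> supported k g \<Longrightarrow> supported k (f + g)"
  for f g :: "('a::ab_group_add, 'v::finite) pps"
  unfolding supported_def by (auto simp: plus_pps.rep_eq) (metis add.right_neutral)

instance pps :: (comm_ring_1, finite) comm_ring_1
proof
  fix f g h :: "('a, 'b) pps"
  obtain k where k: "k > 0" "supported k f" "supported k g" "supported k h"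
    using supported_ex3 by blast
  note mult = pps_coeff_mult[OF k(1)]
  show "f * g * h = f * (g * h)"
  proof (rule pps_eqI)
    fix e
    have "pps_coeff (f * g * h) e =
        (\<Sum>a\<in>decomp k e. (\<Sum>b\<in>decomp k a. pps_coeff f b * pps_coeff g (a - b)) * pps_coeff h (e - a))"
      by (simp add: mult k supported_mult)
    also have "\<dots> = (\<Sum>(a, b)\<in>Sigma (decomp k e) (decomp k).
        pps_coeff f b * pps_coeff g (a - b) * pps_coeff h (e - a))"
      by (simp add: sum_distrib_right sum.Sigma finite_decomp k)
    also have "\<dots> = (\<Sum>(b, c)\<in>Sigma (decomp k e) (\<lambda>b. decomp k (e - b)).
        pps_coeff f b * (pps_coeff g c * pps_coeff h (e - b - c)))"
    proof (rule sum.reindex_bij_witness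
        [where i = "\<lambda>(b, c). (b + c, b)" and j = "\<lambda>(a, b). (b, a - b)"], goal_cases)
      case (2 x)
      obtain a b where x: "x = (a, b)" by (cases x)
      have "(e - a) + (a - b) \<in> grid k"
        using 2 unfolding x decomp_def by (intro grid_add) auto
      then show ?case using 2 unfolding x decomp_def by auto
    next
      case (4 x)
      obtain b c where x: "x = (b, c)" by (cases x)
      have "b + c \<in> grid k"
        using 4 unfolding x decomp_def by (intro grid_add) auto
      then show ?case using 4 unfolding x decomp_def by (auto simp: algebra_simps)
    qed (auto simp: algebra_simps)
    also have "\<dots> = (\<Sum>b\<in>decomp k e. pps_coeff f b *
        (\<Sum>c\<in>decomp k (e - b). pps_coeff g c * pps_coeff h (e - b - c)))"
      by (simp add: sum_distrib_left sum.Sigma finite_decomp k)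
    also have "\<dots> = pps_coeff (f * (g * h)) e"
      by (simp add: mult k supported_mult)
    finally show "pps_coeff (f * g * h) e = pps_coeff (f * (g * h)) e" .
  qed
  show "f * g = g * f"
  proof (rule pps_eqI)
    fix e
    have "(\<Sum>a\<in>decomp k e. pps_coeff f a * pps_coeff g (e - a)) =
        (\<Sum>a\<in>decomp k e. pps_coeff g a * pps_coeff f (e - a))"
      by (rule sum.reindex_bij_witness[where i = "\<lambda>a. e - a" and j = "\<lambda>a. e - a"])
         (auto simp: decomp_def mult.commute)
    then show "pps_coeff (f * g) e = pps_coeff (g * f) e" by (simp add: mult k)
  qed
  show "1 * f = f"
  proof (rule pps_eqI)
    fix e
    have "pps_coeff (1 * f) e =
        (\<Sum>a | (if a = 0 then 1 else 0) \<noteq> (0::'a) \<and> pps_coeff f (e - a) \<noteq> 0.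
          (if a = 0 then 1 else 0) * pps_coeff f (e - a))"
      by (simp add: times_pps.rep_eq)
    also have "\<dots> = (\<Sum>a\<in>{0}. (if a = 0 then 1 else 0) * pps_coeff f (e - a))"
      by (rule sum.mono_neutral_left) auto
    finally show "pps_coeff (1 * f) e = pps_coeff f e" by simp
  qed
  show "(f + g) * h = f * h + g * h"
    by (rule pps_eqI)
       (simp add: mult k supported_add distrib_right sum.distrib)
  show "(0::('a, 'b) pps) \<noteq> 1"
  proof
    assume "(0::('a, 'b) pps) = 1"
    then have "pps_coeff (0::('a, 'b) pps) 0 = pps_coeff (1::('a, 'b) pps) 0" by (rule arg_cong)
    then show False by simp
  qed
qed

text \<open>Lexicographic order along a list of variables, used to show that there are no zero
  divisors.\<close>

fun lexle :: "'v list \<Rightarrow> rat ^ 'v \<Rightarrow> rat ^ 'v \<Rightarrow> bool" where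
  "lexle [] a b = True"
| "lexle (v # vs) a b = (a $ v < b $ v \<or> (a $ v = b $ v \<and> lexle vs a b))"

lemma lexle_min:
  assumes "S \<noteq> {}" "S \<subseteq> grid k" "k > 0"
  shows "\<exists>a\<in>S. \<forall>b\<in>S. lexle vs a b"
  using assms
proof (induction vs arbitrary: S)
  case Nil
  then show ?case by auto
next
  case (Cons v vs)
  have *: "\<exists>m::nat. a $ v = of_nat m / of_nat k" if "a \<in> S" for a
    using Cons.prems(2) that unfolding grid_def by blast
  define P where "P m \<longleftrightarrow> (\<exists>a\<in>S. a $ v = of_nat m / of_nat k)" for m :: nat
  have "\<exists>m. P m" using * Cons.prems(1) unfolding P_def by blast
  then have PL: "P (LEAST m. P m)" by (rule LeastI_ex)
  define x where "x = of_nat (LEAST m. P m) / (of_nat k :: rat)"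
  have le: "x \<le> a $ v" if "a \<in> S" for a
  proof -
    obtain m :: nat where m: "a $ v = of_nat m / of_nat k" using * \<open>a \<in> S\<close> by blast
    then have "P m" using that unfolding P_def by blast
    then have "(LEAST m. P m) \<le> m" by (rule Least_le)
    then show ?thesis unfolding x_def m by (simp add: divide_right_mono)
  qed
  have "\<exists>a\<in>{a \<in> S. a $ v = x}. \<forall>b\<in>{a \<in> S. a $ v = x}. lexle vs a b"
  proof (rule Cons.IH)
    show "{a \<in> S. a $ v = x} \<noteq> {}" using PL unfolding P_def x_def by blast
  qed (use Cons.prems in auto)
  then obtain a where a: "a \<in> S" "a $ v = x" "\<forall>b\<in>S. b $ v = x \<longrightarrow> lexle vs a b" by blast
  have "\<forall>b\<in>S. lexle (v # vs) a b" using a le by fastforce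
  then show ?case using a(1) by blast
qed

lemma lexle_add_eq:
  assumes "lexle vs a a'" "lexle vs b b'" "a + b = a' + b'" "v \<in> set vs"
  shows "a $ v = a' $ v"
  using assms
proof (induction vs)
  case (Cons w ws)
  have "a $ w + b $ w = a' $ w + b' $ w"
    using Cons.prems(3) by (metis vector_add_component)
  then have "a $ w = a' $ w" "b $ w = b' $ w" using Cons.prems(1,2) by auto
  then show ?case using Cons by auto
qed simp

instance pps :: (idom, finite) idom
proof
  fix f g :: "('a, 'b) pps"
  assume "f \<noteq> 0" "g \<noteq> 0"
  obtain k where k: "k > 0" "supported k f" "supported k g" using supported_ex2 by blast
  obtain vs :: "'b list" where vs: "set vs = UNIV"
    using finite_list[OF finite_class.finite_UNIV] by blast
  have ne: "{e. pps_coeff f e \<noteq> 0} \<noteq> {}" "{e. pps_coeff g e \<noteq> 0} \<noteq> {}"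
    using \<open>f \<noteq> 0\<close> \<open>g \<noteq> 0\<close> by (auto intro: pps_eqI)
  obtain a where a: "pps_coeff f a \<noteq> 0" "\<And>e. pps_coeff f e \<noteq> 0 \<Longrightarrow> lexle vs a e"
    using lexle_min[OF ne(1), of k vs] k unfolding supported_def by blast
  obtain b where b: "pps_coeff g b \<noteq> 0" "\<And>e. pps_coeff g e \<noteq> 0 \<Longrightarrow> lexle vs b e"
    using lexle_min[OF ne(2), of k vs] k unfolding supported_def by blast
  have "{x. pps_coeff f x \<noteq> 0 \<and> pps_coeff g (a + b - x) \<noteq> 0} = {a}"
  proof (intro equalityI subsetI)
    fix x assume "x \<in> {x. pps_coeff f x \<noteq> 0 \<and> pps_coeff g (a + b - x) \<noteq> 0}"
    then have "lexle vs a x" "lexle vs b (a + b - x)" using a b by auto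
    then have "a $ v = x $ v" for v
      using lexle_add_eq[of vs a x b "a + b - x" v] vs by simp
    then show "x \<in> {a}" by (simp add: Finite_Cartesian_Product.vec_eq_iff)
  qed (use a b in auto)
  then have "pps_coeff (f * g) (a + b) = pps_coeff f a * pps_coeff g b"
    unfolding times_pps.rep_eq by simp
  then show "f * g \<noteq> 0" using a b by auto
qed

text \<open>The monomial with exponent vector \<open>e\<close>; the value is \<open>0\<close> if \<open>e\<close> has a negative
  component.\<close>

lift_definition X_pow :: "rat ^ 'v \<Rightarrow> ('a::zero_neq_one, 'v::finite) pps"
  is "\<lambda>e e'. if 0 \<le> e \<and> e' = e then 1 else 0"
proof -
  fix e :: "rat ^ 'v"
  have "\<exists>k>0. e \<in> grid k" if "0 \<le> e"
  proof -
    define d where "d i = nat (snd (quotient_of (e $ i)))" for i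
    define k where "k = (\<Prod>i\<in>UNIV. d i)"
    have d: "d i > 0" for i unfolding d_def by (simp add: quotient_of_denom_pos')
    have "\<exists>m::nat. e $ i = of_nat m / of_nat k" for i
    proof -
      define p where "p = fst (quotient_of (e $ i))"
      have "snd (quotient_of (e $ i)) > 0" by (rule quotient_of_denom_pos')
      then have e: "e $ i = of_int p / of_nat (d i)"
        unfolding p_def d_def using quotient_of_div[of "e $ i"] by simp
      have "0 \<le> e $ i" using that by (simp add: Finite_Cartesian_Product.less_eq_vec_def)
      then have "p \<ge> 0" using e d[of i] by (simp add: zero_le_divide_iff)
      have "k = d i * (\<Prod>j\<in>UNIV - {i}. d j)"
        unfolding k_def by (subst prod.remove[of _ i]) auto
      moreover have "(\<Prod>j\<in>UNIV - {i}. d j) > 0" using d by (simp add: prod_pos)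
      ultimately have "e $ i = of_nat (nat p * (\<Prod>j\<in>UNIV - {i}. d j)) / of_nat k"
        using e \<open>p \<ge> 0\<close> by (simp del: of_nat_prod)
      then show ?thesis by blast
    qed
    moreover have "k > 0" unfolding k_def using d by (simp add: prod_pos)
    ultimately show ?thesis unfolding grid_def by blast
  qed
  then show "\<exists>k>0. \<forall>e'. (if 0 \<le> e \<and> e' = e then 1 else (0::'a)) \<noteq> 0 \<longrightarrow> e' \<in> grid k"
    by (cases "0 \<le> e") auto
qed

definition integral_pps :: "('a::zero, 'v::finite) pps \<Rightarrow> bool" where
  "integral_pps f \<longleftrightarrow> (\<forall>e. pps_coeff f e \<noteq> 0 \<longrightarrow> (\<forall>i. e $ i \<in> \<nat>))"

abbreviation const_coeff :: "('a::zero, 'v::finite) pps \<Rightarrow> 'a" where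
  "const_coeff f \<equiv> pps_coeff f 0"

section \<open>Quasi-ordinary Weierstrass polynomials\<close>

text \<open>The usual normalisation for monic polynomials; only applied to these.\<close>

definition discriminant :: "'a::idom poly \<Rightarrow> 'a" where
  "discriminant p = (- 1) ^ (degree p * (degree p - 1) div 2) * resultant p (pderiv p)"

definition weierstrass_poly :: "('a::idom, 'd::finite) pps poly \<Rightarrow> bool" where
  "weierstrass_poly f \<longleftrightarrow>
     degree f \<ge> 1 \<and> lead_coeff f = 1 \<and> (\<forall>i. integral_pps (coeff f i)) \<and>
     (\<forall>i<degree f. const_coeff (coeff f i) = 0)"

definition quasi_ordinary :: "('a::idom, 'd::finite) pps poly \<Rightarrow> bool" where
  "quasi_ordinary f \<longleftrightarrow>
     (\<exists>(\<alpha> :: nat ^ 'd) u. integral_pps u \<and> const_coeff u \<noteq> 0 \<and>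
        discriminant f = X_pow (\<chi> i. of_nat (\<alpha> $ i)) * u)"

text \<open>
  The variables of \<open>('a, 'd option) pps\<close> are those of \<open>('a, 'd) pps\<close>, tagged with \<open>Some\<close>,
  and one new variable \<open>V\<close> with index \<open>None\<close>. It is the ``last'' coordinate throughout.
\<close>

lift_definition embed_pps :: "('a::zero, 'd::finite) pps \<Rightarrow> ('a, 'd option) pps"
  is "\<lambda>f e. if e $ None = 0 then f (\<chi> i. e $ Some i) else 0"
proof -
  fix f :: "rat ^ 'd \<Rightarrow> 'a"
  assume "\<exists>k>0. \<forall>e. f e \<noteq> 0 \<longrightarrow> e \<in> grid k"
  then obtain k where k: "k > 0" "\<forall>e. f e \<noteq> 0 \<longrightarrow> e \<in> grid k" by blast
  have "e \<in> grid k" if "e $ None = 0" "f (\<chi> i. e $ Some i) \<noteq> 0" for e :: "rat ^ 'd option"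
  proof -
    have "(\<chi> i. e $ Some i) \<in> grid k" using k that by blast
    then have "\<exists>m::nat. e $ Some i = of_nat m / of_nat k" for i
      unfolding grid_def by auto
    moreover have "\<exists>m::nat. e $ None = of_nat m / of_nat k"
      using that by (intro exI[of _ 0]) simp
    ultimately have "\<exists>m::nat. e $ i = of_nat m / of_nat k" for i
      by (cases i) auto
    then show ?thesis unfolding grid_def by blast
  qed
  then show "\<exists>k>0. \<forall>e. (if e $ None = 0 then f (\<chi> i. e $ Some i) else 0) \<noteq> 0 \<longrightarrow> e \<in> grid k"
    using k(1) by auto
qed

definition V_var :: "('a::zero_neq_one, 'd::finite option) pps" where
  "V_var = X_pow (axis None 1)"

definition D_series :: "('a::idom, 'd::finite) pps poly \<Rightarrow> ('a, 'd option) pps" where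
  "D_series f = discriminant (map_poly embed_pps f - [:V_var:])"

section \<open>Newton polytopes\<close>

definition orthant :: "(real ^ 's) set" where
  "orthant = {x. 0 \<le> x}"

definition newton_polytope :: "('a::zero, 's::finite) pps \<Rightarrow> (real ^ 's) set" where
  "newton_polytope h =
     convex hull (\<Union>e\<in>{e. pps_coeff h e \<noteq> 0}. (\<chi> i. of_rat (e $ i)) +o orthant)"

definition append_coord :: "rat ^ 'd \<Rightarrow> real \<Rightarrow> real ^ ('d::finite option)" where
  "append_coord q r = (\<chi> i. case i of None \<Rightarrow> r | Some j \<Rightarrow> of_rat (q $ j))"

definition elementary_polytope :: "rat ^ 'd \<Rightarrow> nat \<Rightarrow> (real ^ ('d::finite option)) set" where
  "elementary_polytope q k = convex hull ({append_coord q 0, append_coord 0 (of_nat k)} + orthant)"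

section \<open>Contacts and the tree model\<close>

definition Zer :: "('a::idom, 'd::finite) pps poly \<Rightarrow> ('a, 'd) pps set" where
  "Zer f = {y. poly f y = 0}"

definition has_contact :: "('a::idom, 'd::finite) pps \<Rightarrow> ('a, 'd) pps \<Rightarrow> rat ^ 'd \<Rightarrow> bool" where
  "has_contact y z l \<longleftrightarrow> 0 \<le> l \<and> (\<exists>u. const_coeff u \<noteq> 0 \<and> y - z = X_pow l * u)"

definition contact :: "('a::idom, 'd::finite) pps \<Rightarrow> ('a, 'd) pps \<Rightarrow> (rat ^ 'd) extended" where
  "contact y z = (if y = z then Pinf else Fin (THE l. has_contact y z l))"

text \<open>\<open>Fin\<close> and \<open>Pinf\<close> are the finite values and \<open>+\<infinity>\<close> of the type \<open>extended\<close>.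
  \<open>Least\<close> is the smallest (not just a minimal) element for the componentwise order.\<close>

definition height :: "('a::idom, 'd::finite) pps set \<Rightarrow> (rat ^ 'd) extended" where
  "height B = (LEAST c. \<exists>y\<in>B. \<exists>z\<in>B. c = contact y z)"

definition postbars :: "('a::idom, 'd::finite) pps set \<Rightarrow> ('a, 'd) pps set set" where
  "postbars B =
     (if height B = Pinf then {} else B // {(y, z). y \<in> B \<and> z \<in> B \<and> contact y z > height B})"

inductive_set tree_model :: "('a::idom, 'd::finite) pps poly \<Rightarrow> ('a, 'd) pps set set"
  for f where
  root: "Zer f \<in> tree_model f"
| post: "B \<in> tree_model f \<Longrightarrow> B' \<in> postbars B \<Longrightarrow> B' \<in> tree_model f"

definition t_num :: "('a::idom, 'd::finite) pps set \<Rightarrow> nat" where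
  "t_num B = card (postbars B)"

inductive q_rel :: "('a::idom, 'd::finite) pps set set \<Rightarrow> ('a, 'd) pps set \<Rightarrow> (rat ^ 'd) extended \<Rightarrow> bool"
  for T where
  lowest: "B \<in> T \<Longrightarrow> (\<forall>B'\<in>T. height B \<le> height B') \<Longrightarrow> height B = Fin h \<Longrightarrow>
     q_rel T B (Fin (of_nat (card B) *s h))"
| post: "q_rel T B (Fin q) \<Longrightarrow> height B = Fin h \<Longrightarrow> B' \<in> T \<Longrightarrow> B' \<in> postbars B \<Longrightarrow>
     height B' = Fin h' \<Longrightarrow> q_rel T B' (Fin (q + of_nat (card B') *s (h' - h)))"
| infinite: "B \<in> T \<Longrightarrow> height B = Pinf \<Longrightarrow> q_rel T B Pinf"

definition q_val :: "('a::idom, 'd::finite) pps set set \<Rightarrow> ('a, 'd) pps set \<Rightarrow> (rat ^ 'd) extended" where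
  "q_val T B = (THE q. q_rel T B q)"

text \<open>The case distinction is needed because the empty sum of sets is \<open>{0}\<close> in the library.
  In the sum, \<open>q_val T B\<close> is finite for each \<open>B\<close>.\<close>

definition tree_polytope ::
  "('a::idom, 'd::finite) pps set set \<Rightarrow> (real ^ ('d option)) set" where
  "tree_polytope T =
     (let F = {B \<in> T. height B \<noteq> Pinf} in
      if F = {} then orthant
      else \<Sum>B\<in>F. case q_val T B of
          Fin q \<Rightarrow> elementary_polytope (of_nat (t_num B - 1) *s q) (t_num B - 1))"

end

theory Submission
  imports Defs
begin

text \<open>
  The proof compares support functions. Both polytopes are of the form ``convex hull plus
  orthant'', so they are determined by the minima on them of linear forms \<open>W\<close> with positive
  coefficients, and by density it suffices to consider generic \<open>W\<close>, whose coefficients are linearly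
  independent over the rationals (\<open>mem_polyhedronI\<close>). For such \<open>W\<close>, substituting \<open>T\<close> with
  exponent \<open>W $ i\<close> for the \<open>i\<close>-th variable embeds the fractional power series into the ring \<open>'a rps\<close>
  of series in \<open>T\<close> with real exponents (\<open>emb\<close>), and the minimum of \<open>W\<close> on the Newton polytope of a series is
  the order of its image. Over \<open>'a rps\<close> every monic polynomial splits (\<open>monic_rps_poly_splits\<close>), which
  makes the critical points of \<open>f\<close> available: although the derivative of a quasi-ordinary polynomial
  need not be quasi-ordinary, it has roots after each substitution.

  Let \<open>\<zeta>\<close> run over the critical points of \<open>f\<close>, let \<open>n\<close> be the degree of \<open>f\<close>, and write \<open>w\<close> for the weights
  of the \<open>X\<^sub>i\<close> and \<open>v\<close> for the weight of \<open>V\<close>. Up to sign, \<open>D\<^sub>f\<close> becomes \<open>n\<^sup>n \<Prod>(f(\<zeta>) - T\<^sup>v)\<close>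
  (\<open>resultant_prod_linear\<close>). A ball that contains \<open>m \<ge> 1\<close> roots contains exactly \<open>m - 1\<close> critical
  points (\<open>critical_points_in_ball\<close>). Bars are the intersections of the set of roots with balls, and
  therefore \<open>(#B - 1) - \<Sum>(#B' - 1) = t(B) - 1\<close> critical points lie in the ball of a bar \<open>B\<close> but not in
  the balls of its postbars \<open>B'\<close> (\<open>card_shell\<close>). At these points \<open>f\<close> has order \<open>w \<bullet> q(B)\<close>, and every critical point
  occurs for exactly one \<open>B\<close>. So the order of \<open>D\<^sub>f\<close> is \<open>\<Sum>(t(B) - 1) min(w \<bullet> q(B), v)\<close>
  (\<open>sum_over_critical_values\<close>), which is the minimum of \<open>W\<close> on the polytope of the tree. Since \<open>W\<close> is generic,
  the vertex of this polytope where the minimum is attained is even an exponent of \<open>D\<^sub>f\<close>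
  (\<open>D_series_leading_exponent\<close>), and both polytopes are generated by these vertices.

  That the roots of \<open>f\<close> are fractional power series is the Abhyankar-Jung theorem. The proof given
  here (\<open>abhyankar_jung\<close>) works with the same substitutions. The roots in \<open>'a rps\<close> are acted on by the
  derivations that multiply \<open>T\<^sup>x\<close> by \<open>\<phi>(x)\<close>, for additive functions \<open>\<phi>\<close>; polynomials in these
  derivations can make any exponent of the roots the leading one. The power sums of the roots so
  transformed are series in the original variables divided by powers of the discriminant, and as
  they have nonnegative order for all weights at once, the discriminant being a monomial times a unit
  forces their exponents, and hence those of the roots, to be nonnegative.
\<close>

lemmas cart_le_iff = Finite_Cartesian_Product.less_eq_vec_def
  and cart_eq_iff = Finite_Cartesian_Product.vec_eq_iff

text \<open>
  From here on \<open>\<bullet>\<close> is the inner product of vectors of type \<open>real ^ 's\<close>, not the one of \<open>Matrix.vec\<close>.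
\<close>

no_notation Matrix.scalar_prod (infix \<open>\<bullet>\<close> 70)

section \<open>Power series with real exponents\<close>

text \<open>
  Power series in one variable \<open>T\<close> with nonnegative real exponents, finitely many of them below each
  bound. If \<open>'a\<close> is a field, they form the valuation ring of a field of Levi-Civita type. Real
  exponents are needed because an injective monomial substitution in several variables has to send the
  variables to powers of \<open>T\<close> with rationally independent exponents.
\<close>

typedef (overloaded) 'a rps =
  "{c :: real \<Rightarrow> 'a::zero. (\<forall>x<0. c x = 0) \<and> (\<forall>b. finite {x. c x \<noteq> 0 \<and> x \<le> b})}"
  morphisms rcoeff Abs_rps
  by (rule exI[of _ "\<lambda>_. 0"]) auto

setup_lifting type_definition_rps

lemma rps_eqI: "(\<And>x. rcoeff f x = rcoeff g x) \<Longrightarrow> f = g"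
  by (simp add: rcoeff_inject[symmetric] fun_eq_iff)

lemma rcoeff_neg: "x < 0 \<Longrightarrow> rcoeff f x = 0"
  using rcoeff[of f] by simp

lemma rcoeff_nonneg: "rcoeff f x \<noteq> 0 \<Longrightarrow> 0 \<le> x"
  using rcoeff_neg[of x f] by force

lemma finite_rcoeff_le: "finite {x. rcoeff f x \<noteq> 0 \<and> x \<le> b}"
  using rcoeff[of f] by simp

instantiation rps :: (zero) zero
begin
lift_definition zero_rps :: "'a rps" is "\<lambda>_. 0" by auto
instance ..
end

lift_definition rmonom :: "'a::zero \<Rightarrow> real \<Rightarrow> 'a rps" is "\<lambda>a r x. if x = r \<and> r \<ge> 0 then a else 0"
  by (auto intro: finite_subset[of _ "{_}"])

instantiation rps :: (zero_neq_one) one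
begin
definition one_rps :: "'a rps" where "one_rps = rmonom 1 0"
instance ..
end

instantiation rps :: (ab_group_add) ab_group_add
begin

lift_definition uminus_rps :: "'a rps \<Rightarrow> 'a rps" is "\<lambda>f x. - f x" by auto

lift_definition plus_rps :: "'a rps \<Rightarrow> 'a rps \<Rightarrow> 'a rps" is "\<lambda>f g x. f x + g x"
proof (intro conjI allI impI)
  fix f g :: "real \<Rightarrow> 'a" and b
  assume "(\<forall>x<0. f x = 0) \<and> (\<forall>b. finite {x. f x \<noteq> 0 \<and> x \<le> b})"
    and "(\<forall>x<0. g x = 0) \<and> (\<forall>b. finite {x. g x \<noteq> 0 \<and> x \<le> b})"
  then have "finite ({x. f x \<noteq> 0 \<and> x \<le> b} \<union> {x. g x \<noteq> 0 \<and> x \<le> b})" by simp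
  then show "finite {x. f x + g x \<noteq> 0 \<and> x \<le> b}" by (rule rev_finite_subset) auto
qed auto

definition minus_rps :: "'a rps \<Rightarrow> 'a rps \<Rightarrow> 'a rps" where "minus_rps f g = f + - g"

instance
proof
  fix f g h :: "'a rps"
  show "f + g + h = f + (g + h)" by (rule rps_eqI) (simp add: plus_rps.rep_eq add.assoc)
  show "f + g = g + f" by (rule rps_eqI) (simp add: plus_rps.rep_eq add.commute)
  show "0 + f = f" by (rule rps_eqI) (simp add: plus_rps.rep_eq zero_rps.rep_eq)
  show "- f + f = 0"
    by (rule rps_eqI) (simp add: plus_rps.rep_eq zero_rps.rep_eq uminus_rps.rep_eq)
  show "f - g = f + - g" by (rule minus_rps_def)
qed

end

lemma rcoeff_simps [simp]:
  "rcoeff 0 x = 0"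
  "rcoeff 1 x = (if x = 0 then 1 else 0)"
  "rcoeff (rmonom a r) x = (if x = r \<and> r \<ge> 0 then a else 0)"
  "rcoeff (- f) x = - rcoeff f x"
  "rcoeff (f + g) x = rcoeff f x + rcoeff g x"
  "rcoeff (f - g) x = rcoeff f x - rcoeff g x"
  by (simp_all add: zero_rps.rep_eq one_rps_def rmonom.rep_eq plus_rps.rep_eq uminus_rps.rep_eq
      minus_rps_def del: add_uminus_conv_diff)

lemma rcoeff_sum: "rcoeff (\<Sum>i\<in>I. f i) x = (\<Sum>i\<in>I. rcoeff (f i) x)"
  by (induction I rule: infinite_finite_induct) auto

instantiation rps :: (comm_ring_1) times
begin
lift_definition times_rps :: "'a rps \<Rightarrow> 'a rps \<Rightarrow> 'a rps"
  is "\<lambda>f g x. \<Sum>a | f a \<noteq> 0 \<and> g (x - a) \<noteq> 0. f a * g (x - a)"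
proof (intro conjI allI impI)
  fix f g :: "real \<Rightarrow> 'a"
  assume f: "(\<forall>x<0. f x = 0) \<and> (\<forall>b. finite {x. f x \<noteq> 0 \<and> x \<le> b})"
    and g: "(\<forall>x<0. g x = 0) \<and> (\<forall>b. finite {x. g x \<noteq> 0 \<and> x \<le> b})"
  have supp: "\<exists>a b. f a \<noteq> 0 \<and> g b \<noteq> 0 \<and> x = a + b \<and> a \<ge> 0 \<and> b \<ge> 0"
    if nz: "(\<Sum>a | f a \<noteq> 0 \<and> g (x - a) \<noteq> 0. f a * g (x - a)) \<noteq> 0" for x
  proof -
    obtain a where "f a \<noteq> 0" "g (x - a) \<noteq> 0"
      using sum.not_neutral_contains_not_neutral[OF nz] by auto
    then show ?thesis using f g
      by (intro exI[of _ a] exI[of _ "x - a"]) (auto simp: not_less[symmetric])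
  qed
  show "(\<Sum>a | f a \<noteq> 0 \<and> g (x - a) \<noteq> 0. f a * g (x - a)) = 0" if "x < 0" for x
    using supp[of x] that by force
  fix b
  have "finite ((\<lambda>(x, y). x + y) ` ({x. f x \<noteq> 0 \<and> x \<le> b} \<times> {x. g x \<noteq> 0 \<and> x \<le> b}))"
    using f g by simp
  then show "finite {x. (\<Sum>a | f a \<noteq> 0 \<and> g (x - a) \<noteq> 0. f a * g (x - a)) \<noteq> 0 \<and> x \<le> b}"
  proof (rule rev_finite_subset, intro subsetI)
    fix x assume x: "x \<in> {x. (\<Sum>a | f a \<noteq> 0 \<and> g (x - a) \<noteq> 0. f a * g (x - a)) \<noteq> 0 \<and> x \<le> b}"
    then obtain c d where cd: "f c \<noteq> 0" "g d \<noteq> 0" "x = c + d" "c \<ge> 0" "d \<ge> 0" using supp[of x] by blast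
    then have "(c, d) \<in> {x. f x \<noteq> 0 \<and> x \<le> b} \<times> {x. g x \<noteq> 0 \<and> x \<le> b}" using x by auto
    then show "x \<in> (\<lambda>(x, y). x + y) ` ({x. f x \<noteq> 0 \<and> x \<le> b} \<times> {x. g x \<noteq> 0 \<and> x \<le> b})"
      unfolding cd(3) by (rule rev_image_eqI) simp
  qed
qed
instance ..
end

lemma rcoeff_mult:
  assumes "finite A" "\<And>a. rcoeff f a \<noteq> 0 \<Longrightarrow> rcoeff g (x - a) \<noteq> 0 \<Longrightarrow> a \<in> A"
  shows "rcoeff (f * g) x = (\<Sum>a\<in>A. rcoeff f a * rcoeff g (x - a))"
  unfolding times_rps.rep_eq
  by (rule sum.mono_neutral_left[OF assms(1)]) (use assms in auto)

lemma rcoeff_mult_nonzero: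
  assumes "rcoeff (f * g) x \<noteq> 0"
  shows "\<exists>a. rcoeff f a \<noteq> 0 \<and> rcoeff g (x - a) \<noteq> 0"
proof -
  have "(\<Sum>a | rcoeff f a \<noteq> 0 \<and> rcoeff g (x - a) \<noteq> 0. rcoeff f a * rcoeff g (x - a)) \<noteq> 0"
    using assms by (simp add: times_rps.rep_eq)
  then show ?thesis by (rule sum.not_neutral_contains_not_neutral) blast
qed

instance rps :: (comm_ring_1) comm_ring_1
proof
  fix f g h :: "'a rps"
  have fin: "finite {a. rcoeff f a \<noteq> 0 \<and> a \<le> x}" for f :: "'a rps" and x
    by (rule finite_rcoeff_le)
  have le: "a \<le> x" if "rcoeff g (x - a) \<noteq> 0" for g :: "'a rps" and x a
    using rcoeff_nonneg[OF that] by simp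
  show "f * g * h = f * (g * h)"
  proof (rule rps_eqI)
    fix x
    define F where "F = {a. rcoeff f a \<noteq> 0 \<and> a \<le> x}"
    define U where "U = (\<lambda>(a, b). a + b) ` (F \<times> {a. rcoeff g a \<noteq> 0 \<and> a \<le> x})"
    have finF: "finite F" and finU: "finite U" unfolding F_def U_def using fin by auto
    have "rcoeff (f * g * h) x = (\<Sum>u\<in>U. rcoeff (f * g) u * rcoeff h (x - u))"
    proof (rule rcoeff_mult[OF finU])
      fix u assume u: "rcoeff (f * g) u \<noteq> 0" "rcoeff h (x - u) \<noteq> 0"
      obtain a where a: "rcoeff f a \<noteq> 0" "rcoeff g (u - a) \<noteq> 0"
        using rcoeff_mult_nonzero[OF u(1)] by blast
      have "a \<le> x" "u - a \<le> x" using le[OF a(2)] le[OF u(2)] rcoeff_nonneg[OF a(1)] by auto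
      then show "u \<in> U" unfolding U_def F_def using a by (force intro: image_eqI[of _ _ "(a, u - a)"])
    qed
    also have "\<dots> = (\<Sum>u\<in>U. (\<Sum>a\<in>F. rcoeff f a * rcoeff g (u - a)) * rcoeff h (x - u))"
    proof (rule sum.cong[OF refl])
      fix u assume "u \<in> U"
      show "rcoeff (f * g) u * rcoeff h (x - u) =
          (\<Sum>a\<in>F. rcoeff f a * rcoeff g (u - a)) * rcoeff h (x - u)"
      proof (cases "rcoeff h (x - u) = 0")
        case False
        then have "rcoeff (f * g) u = (\<Sum>a\<in>F. rcoeff f a * rcoeff g (u - a))"
          unfolding F_def by (intro rcoeff_mult fin) (use le[of g u] le[of h x u] False in force)
        then show ?thesis by simp
      qed simp
    qed
    also have "\<dots> = (\<Sum>a\<in>F. rcoeff f a * (\<Sum>u\<in>U. rcoeff g (u - a) * rcoeff h (x - u)))"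
      unfolding sum_distrib_right sum_distrib_left by (subst sum.swap) (simp add: mult.assoc)
    also have "\<dots> = (\<Sum>a\<in>F. rcoeff f a * rcoeff (g * h) (x - a))"
    proof (rule sum.cong[OF refl])
      fix a assume a: "a \<in> F"
      have "rcoeff (g * h) (x - a) = (\<Sum>b\<in>(\<lambda>u. u - a) ` U. rcoeff g b * rcoeff h (x - a - b))"
      proof (rule rcoeff_mult)
        fix b assume b: "rcoeff g b \<noteq> 0" "rcoeff h (x - a - b) \<noteq> 0"
        have "b \<le> x" using le[OF b(2)] a rcoeff_nonneg[of f a] unfolding F_def by auto
        then have "a + b \<in> U" unfolding U_def using a b by (force intro: image_eqI[of _ _ "(a, b)"])
        then show "b \<in> (\<lambda>u. u - a) ` U" by force
      qed (use finU in simp)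
      also have "\<dots> = (\<Sum>u\<in>U. rcoeff g (u - a) * rcoeff h (x - u))"
        by (subst sum.reindex) (auto simp: inj_on_def)
      finally show "rcoeff f a * (\<Sum>u\<in>U. rcoeff g (u - a) * rcoeff h (x - u)) =
          rcoeff f a * rcoeff (g * h) (x - a)" by simp
    qed
    also have "\<dots> = rcoeff (f * (g * h)) x"
      by (rule rcoeff_mult[symmetric, OF finF]) (use le in \<open>force simp: F_def\<close>)
    finally show "rcoeff (f * g * h) x = rcoeff (f * (g * h)) x" .
  qed
  show "f * g = g * f"
  proof (rule rps_eqI)
    fix x
    show "rcoeff (f * g) x = rcoeff (g * f) x"
      unfolding times_rps.rep_eq
      by (rule sum.reindex_bij_witness[where i = "\<lambda>a. x - a" and j = "\<lambda>a. x - a"])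
         (auto simp: mult.commute)
  qed
  show "1 * f = f"
  proof (rule rps_eqI)
    fix x
    have "rcoeff (1 * f) x = (\<Sum>a\<in>{0}. rcoeff 1 a * rcoeff f (x - a))"
      by (rule rcoeff_mult) (auto split: if_splits)
    then show "rcoeff (1 * f) x = rcoeff f x" by simp
  qed
  show "(f + g) * h = f * h + g * h"
  proof (rule rps_eqI)
    fix x
    define A where "A = {a. rcoeff f a \<noteq> 0 \<and> a \<le> x} \<union> {a. rcoeff g a \<noteq> 0 \<and> a \<le> x}"
    have A: "finite A" unfolding A_def using fin by simp
    have "rcoeff ((f + g) * h) x = (\<Sum>a\<in>A. rcoeff (f + g) a * rcoeff h (x - a))"
      by (rule rcoeff_mult[OF A]) (use le in \<open>force simp: A_def\<close>)
    moreover have "rcoeff (f * h) x = (\<Sum>a\<in>A. rcoeff f a * rcoeff h (x - a))"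
      by (rule rcoeff_mult[OF A]) (use le in \<open>force simp: A_def\<close>)
    moreover have "rcoeff (g * h) x = (\<Sum>a\<in>A. rcoeff g a * rcoeff h (x - a))"
      by (rule rcoeff_mult[OF A]) (use le in \<open>force simp: A_def\<close>)
    ultimately show "rcoeff ((f + g) * h) x = rcoeff (f * h + g * h) x"
      by (simp add: distrib_right sum.distrib)
  qed
  show "(0::'a rps) \<noteq> 1"
  proof
    assume "(0::'a rps) = 1"
    then have "rcoeff (0::'a rps) 0 = rcoeff (1::'a rps) 0" by (rule arg_cong)
    then show False by simp
  qed
qed

text \<open>
  The order, i.e. the least exponent. It exists although the reals are not well-ordered, since
  only finitely many exponents lie below a chosen one. The value at \<open>0\<close> is meaningless.
\<close>

definition rord :: "'a::zero rps \<Rightarrow> real" where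
  "rord f = Min {x. rcoeff f x \<noteq> 0 \<and> x \<le> (SOME b. rcoeff f b \<noteq> 0)}"

lemma rord_props:
  assumes "f \<noteq> 0"
  shows "rcoeff f (rord f) \<noteq> 0" "x < rord f \<Longrightarrow> rcoeff f x = 0"
proof -
  define b where "b = (SOME b. rcoeff f b \<noteq> 0)"
  have b: "rcoeff f b \<noteq> 0"
    unfolding b_def by (rule someI_ex, rule ccontr) (use assms in \<open>auto intro: rps_eqI\<close>)
  define S where "S = {x. rcoeff f x \<noteq> 0 \<and> x \<le> b}"
  have S: "finite S" "b \<in> S" unfolding S_def using finite_rcoeff_le b by auto
  have r: "rord f = Min S" unfolding rord_def S_def b_def ..
  have "Min S \<in> S" using S by (intro Min_in) auto
  then show "rcoeff f (rord f) \<noteq> 0" unfolding r S_def by simp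
  show "rcoeff f x = 0" if "x < rord f"
  proof (rule ccontr)
    assume "rcoeff f x \<noteq> 0"
    moreover have "x \<le> b" using that S unfolding r by (meson Min_le less_le_trans less_imp_le)
    ultimately have "x \<in> S" unfolding S_def by simp
    then show False using that S unfolding r by (meson Min_le not_less)
  qed
qed

lemma rord_eqI:
  assumes "rcoeff f r \<noteq> 0" "\<And>x. x < r \<Longrightarrow> rcoeff f x = 0"
  shows "rord f = r"
proof -
  have "f \<noteq> 0" using assms by auto
  then show ?thesis using rord_props[of f] assms by (metis linorder_neqE_linordered_idom)
qed

lemma rord_le: "rcoeff f x \<noteq> 0 \<Longrightarrow> rord f \<le> x"
  using rord_props(2)[of f x] by (cases "f = 0") force+

lemma rord_nonneg: "f \<noteq> 0 \<Longrightarrow> 0 \<le> rord f"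
  using rord_props(1) rcoeff_nonneg by blast

lemma rcoeff_mult_lead:
  assumes "\<And>x. x < a \<Longrightarrow> rcoeff f x = 0" "\<And>x. x < b \<Longrightarrow> rcoeff g x = 0"
  shows "rcoeff (f * g) (a + b) = rcoeff f a * rcoeff g b"
    and "x < a + b \<Longrightarrow> rcoeff (f * g) x = 0"
proof -
  have "rcoeff (f * g) (a + b) = (\<Sum>c\<in>{a}. rcoeff f c * rcoeff g (a + b - c))"
  proof (rule rcoeff_mult)
    fix c assume c: "rcoeff f c \<noteq> 0" "rcoeff g (a + b - c) \<noteq> 0"
    have "\<not> c < a" "\<not> a + b - c < b" using c assms by blast+
    then show "c \<in> {a}" by auto
  qed auto
  then show "rcoeff (f * g) (a + b) = rcoeff f a * rcoeff g b" by simp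
  show "rcoeff (f * g) x = 0" if "x < a + b"
  proof (rule ccontr)
    assume "rcoeff (f * g) x \<noteq> 0"
    then obtain c where "rcoeff f c \<noteq> 0" "rcoeff g (x - c) \<noteq> 0" using rcoeff_mult_nonzero by blast
    then have "\<not> c < a" "\<not> x - c < b" using assms by blast+
    then show False using that by auto
  qed
qed

instance rps :: (idom) idom
proof
  fix f g :: "'a rps"
  assume "f \<noteq> 0" "g \<noteq> 0"
  then have "rcoeff (f * g) (rord f + rord g) \<noteq> 0"
    using rcoeff_mult_lead(1)[of "rord f" f "rord g" g] rord_props by fastforce
  then show "f * g \<noteq> 0" by auto
qed

lemma rord_mult:
  fixes f g :: "'a::idom rps"
  assumes "f \<noteq> 0" "g \<noteq> 0"
  shows "rord (f * g) = rord f + rord g"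
  by (rule rord_eqI)
     (use rcoeff_mult_lead[of "rord f" f "rord g" g] rord_props assms in \<open>fastforce+\<close>)

lemma rord_prod:
  fixes f :: "'i \<Rightarrow> 'a::idom rps"
  assumes "finite I" "\<And>i. i \<in> I \<Longrightarrow> f i \<noteq> 0"
  shows "rord (\<Prod>i\<in>I. f i) = (\<Sum>i\<in>I. rord (f i))"
  using assms
proof (induction I rule: finite_induct)
  case empty
  then show ?case by (simp add: rord_eqI)
next
  case (insert i I)
  then show ?case by (simp add: rord_mult)
qed

lemma rord_uminus [simp]: "rord (- f) = rord f" for f :: "'a::ab_group_add rps"
  by (simp add: rord_def)

lemma rord_minus_commute: "rord (f - g) = rord (g - f)" for f :: "'a::ab_group_add rps"
  using rord_uminus[of "f - g"] by simp

abbreviation tpow :: "real \<Rightarrow> 'a::zero_neq_one rps" where "tpow r \<equiv> rmonom 1 r"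

lemma rmonom_eq_0_iff [simp]: "rmonom a r = 0 \<longleftrightarrow> a = 0 \<or> r < 0"
proof
  assume "rmonom a r = 0"
  then have "rcoeff (rmonom a r) r = 0" by simp
  then show "a = 0 \<or> r < 0" by (auto split: if_splits)
qed (auto intro!: rps_eqI)

lemma rord_rmonom [simp]: "a \<noteq> 0 \<Longrightarrow> r \<ge> 0 \<Longrightarrow> rord (rmonom a r) = r"
  by (intro rord_eqI) auto

lemma rmonom_0_0 [simp]: "tpow 0 = 1" by (simp add: one_rps_def)

lemma rcoeff_rmonom_mult: "r \<ge> 0 \<Longrightarrow> rcoeff (rmonom a r * f) x = a * rcoeff f (x - r)"
proof -
  assume "r \<ge> 0"
  have "rcoeff (rmonom a r * f) x = (\<Sum>c\<in>{r}. rcoeff (rmonom a r) c * rcoeff f (x - c))"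
    by (rule rcoeff_mult) (auto split: if_splits)
  then show ?thesis using \<open>r \<ge> 0\<close> by simp
qed

lemma rmonom_mult: "r \<ge> 0 \<Longrightarrow> s \<ge> 0 \<Longrightarrow> rmonom a r * rmonom b s = rmonom (a * b) (r + s)"
  for a :: "'a::comm_ring_1"
  by (rule rps_eqI) (auto simp: rcoeff_rmonom_mult)

lemma tpow_power: "r \<ge> 0 \<Longrightarrow> tpow r ^ n = (tpow (real n * r) :: 'a::comm_ring_1 rps)"
  by (induction n) (auto simp: rmonom_mult algebra_simps)

text \<open>
  Division by \<open>T\<^sup>r\<close>; terms with exponents below \<open>r\<close> are cut off.
\<close>

lift_definition rshift :: "real \<Rightarrow> 'a::zero rps \<Rightarrow> 'a rps"
  is "\<lambda>r f x. if x \<ge> 0 then f (x + r) else 0"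
proof (intro conjI allI impI)
  fix r :: real and f :: "real \<Rightarrow> 'a" and b
  assume f: "(\<forall>x<0. f x = 0) \<and> (\<forall>b. finite {x. f x \<noteq> 0 \<and> x \<le> b})"
  then have "finite ((\<lambda>x. x - r) ` {x. f x \<noteq> 0 \<and> x \<le> b + r})" by simp
  then show "finite {x. (if x \<ge> 0 then f (x + r) else 0) \<noteq> 0 \<and> x \<le> b}"
    by (rule rev_finite_subset) (force split: if_splits)
qed auto

text \<open>
  Divisibility by \<open>T\<^sup>r\<close> expresses that the order is at least \<open>r\<close>, without an exception for the
  series \<open>0\<close>, and it is preserved by sums and products for general reasons.
\<close>

lemma tpow_dvd_iff:
  fixes f :: "'a::comm_ring_1 rps"
  assumes "r \<ge> 0"
  shows "tpow r dvd f \<longleftrightarrow> (\<forall>x<r. rcoeff f x = 0)"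
proof
  assume "tpow r dvd f"
  then show "\<forall>x<r. rcoeff f x = 0"
    using assms by (auto simp: dvd_def rcoeff_rmonom_mult rcoeff_neg)
next
  assume *: "\<forall>x<r. rcoeff f x = 0"
  have "f = tpow r * rshift r f"
    by (rule rps_eqI) (use * assms in \<open>auto simp: rcoeff_rmonom_mult rshift.rep_eq\<close>)
  then show "tpow r dvd f" by (rule dvdI)
qed

lemma tpow_dvd_iff_rord:
  fixes f :: "'a::comm_ring_1 rps"
  assumes "r \<ge> 0" "f \<noteq> 0"
  shows "tpow r dvd f \<longleftrightarrow> r \<le> rord f"
  using assms rord_props[of f] by (auto simp: tpow_dvd_iff not_less[symmetric])

lemma tpow_dvd_tpow: "0 \<le> r \<Longrightarrow> r \<le> s \<Longrightarrow> (tpow r :: 'a::comm_ring_1 rps) dvd tpow s"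
  by (auto simp: tpow_dvd_iff)

lemma rord_add_less:
  fixes f g :: "'a::comm_ring_1 rps"
  assumes "f \<noteq> 0" "g \<noteq> 0" "rord f < rord g"
  shows "rord (f + g) = rord f"
  by (rule rord_eqI) (use assms rord_props[of f] rord_props[of g] in auto)

lemma rcoeff_0_mult: "rcoeff (f * g) 0 = rcoeff f 0 * rcoeff g 0" for f :: "'a::comm_ring_1 rps"
  using rcoeff_mult_lead(1)[of 0 f 0 g] by (simp add: rcoeff_neg)

interpretation res: comm_ring_hom "\<lambda>f :: 'a::comm_ring_1 rps. rcoeff f 0"
  by unfold_locales (auto simp: rcoeff_0_mult)

interpretation rconst: inj_comm_ring_hom "\<lambda>a :: 'a::comm_ring_1. rmonom a 0"
  by unfold_locales (auto simp: rmonom_mult intro!: rps_eqI)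

section \<open>Newton-Puiseux theorem\<close>

abbreviation lift_poly :: "'a::comm_ring_1 poly \<Rightarrow> 'a rps poly" where
  "lift_poly \<equiv> map_poly (\<lambda>a. rmonom a 0)"

abbreviation red_poly :: "'a::comm_ring_1 rps poly \<Rightarrow> 'a poly" where
  "red_poly \<equiv> map_poly (\<lambda>f. rcoeff f 0)"

interpretation lift_poly: map_poly_inj_comm_ring_hom "\<lambda>a :: 'a::comm_ring_1. rmonom a 0" ..
interpretation red_poly: map_poly_comm_ring_hom "\<lambda>f :: 'a::comm_ring_1 rps. rcoeff f 0" ..

lemma red_lift_poly [simp]: "red_poly (lift_poly p) = p"
  by (simp add: poly_eq_iff coeff_map_poly)

text \<open>
  The set \<open>S\<close> records that division by a monic polynomial creates no new denominators in the
  exponents: later it consists of the series with exponents in a fixed grid.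
\<close>

lemma monic_division:
  fixes f :: "'a::idom poly"
  assumes f: "lead_coeff f = 1" "degree f \<ge> 1" and fS: "\<And>i. coeff f i \<in> S" and HS: "\<And>i. coeff H i \<in> S"
    and S: "0 \<in> S" "\<And>a b. a \<in> S \<Longrightarrow> b \<in> S \<Longrightarrow> a - b \<in> S" "\<And>a b. a \<in> S \<Longrightarrow> b \<in> S \<Longrightarrow> a * b \<in> S"
  shows "\<exists>Q R. H = Q * f + R \<and> degree R < degree f \<and> (\<forall>i. coeff R i \<in> S)"
  using HS
proof (induction "degree H" arbitrary: H rule: less_induct)
  case less
  show ?case
  proof (cases "degree H < degree f")
    case True
    then show ?thesis using less.prems by (intro exI[of _ 0] exI[of _ H]) auto
  next
    case False
    define m where "m = monom (lead_coeff H) (degree H - degree f)"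
    define H' where "H' = H - m * f"
    have cm: "coeff (m * f) i = (if i < degree H - degree f then 0
        else lead_coeff H * coeff f (i - (degree H - degree f)))" for i
      unfolding m_def by (simp add: coeff_monom_mult)
    have H': "degree H' < degree H"
    proof -
      have "coeff H' i = 0" if "i \<ge> degree H" for i
      proof (cases "i = degree H")
        case True
        then show ?thesis using False f by (simp add: H'_def cm)
      next
        case i: False
        then have "coeff H i = 0" "coeff f (i - (degree H - degree f)) = 0"
          using that False by (auto intro!: coeff_eq_0)
        then show ?thesis by (simp add: H'_def cm)
      qed
      then show ?thesis using False f(2) by (intro degree_lessI) auto
    qed
    have "coeff H' i \<in> S" for i
      unfolding H'_def by (auto simp: cm intro!: S less.prems fS)
    from less.hyps[OF H' this] obtain Q R where
      QR: "H' = Q * f + R" "degree R < degree f" "\<forall>i. coeff R i \<in> S" by blast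
    have "H = (Q + m) * f + R" using QR(1) unfolding H'_def by (simp add: algebra_simps)
    then show ?thesis using QR by blast
  qed
qed

lemma degree_monic_mult:
  fixes B f :: "'a::idom poly"
  assumes "lead_coeff f = 1" "B \<noteq> 0"
  shows "degree (B * f) = degree B + degree f"
  using assms by (intro degree_mult_eq) auto

text \<open>
  One correction step of Hensel's lemma, for an error \<open>E\<close> divisible by \<open>T\<^sup>r\<close>. After division by
  \<open>T\<^sup>r\<close>, the identity \<open>u p + v q = 1\<close> writes \<open>E\<close> as a combination of \<open>p\<close> and \<open>q\<close>, and reducing the
  cofactor of \<open>q\<close> modulo the monic polynomial \<open>p\<close> bounds both degrees.
\<close>

lemma hensel_linear_step:
  fixes p q u v :: "'a::field poly" and E :: "'a rps poly"
  assumes p: "lead_coeff p = 1" "degree p \<ge> 1" and q: "degree q \<ge> 1"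
    and uv: "u * p + v * q = 1" and E: "degree E < degree p + degree q"
    and r: "r \<ge> 0" "[:tpow r:] dvd E"
  shows "\<exists>A B. degree A < degree p \<and> degree B < degree q \<and> [:tpow r:] dvd A \<and> [:tpow r:] dvd B \<and>
    E = A * lift_poly q + B * lift_poly p"
proof -
  obtain E' where E': "E = [:tpow r:] * E'" using r(2) by (elim dvdE)
  have t: "(tpow r :: 'a rps) \<noteq> 0" using r by simp
  have degE': "degree E' < degree p + degree q" using E t unfolding E' by simp
  have lp: "lead_coeff (lift_poly p) = 1" "degree (lift_poly p) = degree p" "degree (lift_poly q) = degree q"
    using p by (simp_all add: coeff_map_poly)
  obtain S A where SA: "E' * lift_poly v = S * lift_poly p + A" "degree A < degree p"
    using monic_division[of "lift_poly p" UNIV "E' * lift_poly v"] lp p by auto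
  define B where "B = E' * lift_poly u + S * lift_poly q"
  have "lift_poly u * lift_poly p + lift_poly v * lift_poly q = 1"
    using uv by (metis lift_poly.hom_add lift_poly.hom_mult lift_poly.hom_one)
  then have "E' = E' * (lift_poly u * lift_poly p + lift_poly v * lift_poly q)" by simp
  also have "\<dots> = E' * lift_poly u * lift_poly p + (E' * lift_poly v) * lift_poly q"
    by (simp add: algebra_simps)
  also have "\<dots> = A * lift_poly q + B * lift_poly p"
    unfolding SA B_def by (simp add: algebra_simps)
  finally have eq: "E' = A * lift_poly q + B * lift_poly p" .
  have degB: "degree B < degree q"
  proof (cases "B = 0")
    case False
    have "degree B + degree p = degree (B * lift_poly p)"
      using degree_monic_mult[OF lp(1) False] lp by simp
    also have "B * lift_poly p = E' - A * lift_poly q" using eq by simp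
    also have "degree \<dots> < degree p + degree q"
    proof (rule degree_diff_less[OF degE'])
      show "degree (A * lift_poly q) < degree p + degree q"
        using degree_mult_le[of A "lift_poly q"] SA(2) lp by simp
    qed
    finally show ?thesis by simp
  qed (use q in simp)
  have "E = ([:tpow r:] * A) * lift_poly q + ([:tpow r:] * B) * lift_poly p"
    using eq E' by (simp add: algebra_simps smult_add_right)
  moreover have "degree ([:tpow r:] * A) < degree p" "degree ([:tpow r:] * B) < degree q"
    using SA degB by (auto intro: le_less_trans[OF degree_smult_le])
  ultimately show ?thesis by (metis dvd_triv_left)
qed

text \<open>
  The coefficient at \<open>z\<close> is the same in all \<open>x k\<close> with \<open>z < (k + 1) e\<close>; these stable values
  form the limit, whose support below a bound is that of a single \<open>x k\<close>.
\<close>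

lemma rps_cauchy_limit:
  fixes x :: "nat \<Rightarrow> 'a::comm_ring_1 rps"
  assumes e: "e > 0" and x: "\<And>k. tpow (real (Suc k) * e) dvd x (Suc k) - x k"
  shows "\<exists>y. \<forall>k. tpow (real (Suc k) * e) dvd y - x k"
proof -
  have step: "rcoeff (x (Suc k)) z = rcoeff (x k) z" if "z < real (Suc k) * e" for k z
    using x[of k] that e by (auto simp: tpow_dvd_iff)
  have const: "rcoeff (x (k + m)) z = rcoeff (x k) z" if "z < real (Suc k) * e" for k m z
  proof (induction m)
    case (Suc m)
    have "real (Suc k) * e \<le> real (Suc (k + m)) * e" using e by simp
    then have "z < real (Suc (k + m)) * e" using that by linarith
    then show ?case using step[of z "k + m"] Suc by simp
  qed simp
  \<comment> \<open>From index \<open>N z\<close> on, the coefficient at \<open>z\<close> does not change any more.\<close>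
  define N where "N z = nat \<lceil>z / e\<rceil>" for z
  have N: "z < real (Suc (N z)) * e" for z
  proof -
    have "z / e \<le> real (N z)" unfolding N_def by linarith
    then have "z \<le> real (N z) * e" using e by (simp add: field_simps)
    then show ?thesis using e by (simp add: algebra_simps)
  qed
  define c where "c z = rcoeff (x (N z)) z" for z
  have c: "c z = rcoeff (x k) z" if "z < real (Suc k) * e" for z k
  proof (cases "k \<le> N z")
    case True
    then show ?thesis using const[OF that, of "N z - k"] unfolding c_def by simp
  next
    case False
    then show ?thesis using const[OF N[of z], of "k - N z"] unfolding c_def by simp
  qed
  define y where "y = Abs_rps c"
  have y: "rcoeff y = c" unfolding y_def
  proof (rule Abs_rps_inverse, intro CollectI conjI allI impI)
    show "c z = 0" if "z < 0" for z unfolding c_def using rcoeff_neg[OF that] .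
    show "finite {z. c z \<noteq> 0 \<and> z \<le> b}" for b
    proof (rule rev_finite_subset[OF finite_rcoeff_le[of "x (N b)" b]])
      show "{z. c z \<noteq> 0 \<and> z \<le> b} \<subseteq> {z. rcoeff (x (N b)) z \<noteq> 0 \<and> z \<le> b}"
        using c[of _ "N b"] N[of b] by force
    qed
  qed
  have "tpow (real (Suc k) * e) dvd y - x k" for k
    using e c[of _ k] by (auto simp: tpow_dvd_iff y)
  then show ?thesis by blast
qed

lemma rps_eq_0I:
  fixes y :: "'a::comm_ring_1 rps"
  assumes e: "e > 0" and y: "\<And>k. tpow (real (Suc k) * e) dvd y"
  shows "y = 0"
proof (rule rps_eqI)
  fix z
  obtain k :: nat where "z / e < real k" using reals_Archimedean2 by blast
  then have "z < real k * e" using e by (simp add: field_simps)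
  then have "z < real (Suc k) * e" using e by (simp add: algebra_simps)
  then show "rcoeff y z = rcoeff 0 z" using y[of k] e by (simp add: tpow_dvd_iff)
qed

lemma poly_cauchy_limit:
  fixes P :: "nat \<Rightarrow> 'a::idom rps poly"
  assumes e: "e > 0" and P: "\<And>k. [:tpow (real (Suc k) * e):] dvd P (Suc k) - P k"
    and deg: "\<And>k. degree (P k) \<le> d"
  shows "\<exists>L. (\<forall>k. [:tpow (real (Suc k) * e):] dvd L - P k) \<and> degree L \<le> d"
proof -
  have "\<exists>y. \<forall>k. tpow (real (Suc k) * e) dvd y - coeff (P k) i" for i
  proof (rule rps_cauchy_limit[OF e])
    fix k
    have "tpow (real (Suc k) * e) dvd coeff (P (Suc k) - P k) i"
      using P[of k] unfolding const_poly_dvd_iff by (rule spec)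
    then show "tpow (real (Suc k) * e) dvd coeff (P (Suc k)) i - coeff (P k) i"
      unfolding coeff_diff .
  qed
  then obtain y where y: "\<And>i k. tpow (real (Suc k) * e) dvd y i - coeff (P k) i" by metis
  define L where "L = (\<Sum>i\<le>d. monom (y i) i)"
  have L: "coeff L i = (if i \<le> d then y i else 0)" for i
    unfolding L_def by (simp add: coeff_sum)
  have "degree L \<le> d" by (rule degree_le) (simp add: L)
  moreover have "tpow (real (Suc k) * e) dvd coeff (L - P k) i" for k i
    using y[of k i] deg[of k] by (cases "i \<le> d") (auto simp: L coeff_eq_0)
  ultimately show ?thesis by (auto simp: const_poly_dvd_iff)
qed

lemma poly_rps_eq_0I:
  fixes G :: "'a::idom rps poly"
  assumes "e > 0" "\<And>k. [:tpow (real (Suc k) * e):] dvd G"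
  shows "G = 0"
proof (rule poly_eqI)
  fix i
  have "coeff G i = 0"
  proof (rule rps_eq_0I[OF assms(1)])
    show "tpow (real (Suc k) * e) dvd coeff G i" for k
      using assms(2)[of k] unfolding const_poly_dvd_iff by (rule spec)
  qed
  then show "coeff G i = coeff 0 i" by simp
qed

lemma common_tpow_divisor:
  fixes S :: "'a::comm_ring_1 rps set"
  assumes "finite S" "\<And>c. c \<in> S \<Longrightarrow> rcoeff c 0 = 0"
  shows "\<exists>e>0. \<forall>c\<in>S. tpow e dvd c"
  using assms
proof (induction S rule: finite_induct)
  case empty
  then show ?case by (auto intro: exI[of _ 1])
next
  case (insert c S)
  then obtain e where e: "e > 0" "\<forall>c\<in>S. tpow e dvd c" by auto
  show ?case
  proof (cases "c = 0")
    case True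
    then show ?thesis using e by auto
  next
    case False
    have "rord c \<noteq> 0" using rord_props(1)[OF False] insert.prems by force
    then have "rord c > 0" using rord_nonneg[OF False] by simp
    moreover have "tpow (rord c) dvd c" using rord_props[OF False] rord_nonneg[OF False]
      by (simp add: tpow_dvd_iff)
    moreover have "tpow (min e (rord c)) dvd x" if "tpow e dvd x \<or> tpow (rord c) dvd x" for x :: "'a rps"
      using that e \<open>rord c > 0\<close> by (auto simp: tpow_dvd_iff)
    ultimately show ?thesis using e
      by (intro exI[of _ "min e (rord c)"]) auto
  qed
qed

text \<open>
  Hensel's lemma for a factorization of the reduction into coprime monic factors. The exponents
  are not discrete, but the corrections gain a fixed amount in each step: if \<open>T\<^sup>e\<close> divides
  \<open>g - p q\<close> and the current factors are congruent to \<open>p\<close> and \<open>q\<close> modulo \<open>T\<^sup>e\<close>, then the terms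
  that are neglected in a correction of an error of order \<open>(k + 1) e\<close> have order at least
  \<open>(k + 2) e\<close>.
\<close>

theorem hensel_factorization:
  fixes g :: "'a::field rps poly" and p q u v :: "'a poly"
  assumes g: "lead_coeff g = 1" "red_poly g = p * q"
    and p: "lead_coeff p = 1" "degree p \<ge> 1" and q: "lead_coeff q = 1" "degree q \<ge> 1"
    and uv: "u * p + v * q = 1"
  shows "\<exists>P Q. g = P * Q \<and> lead_coeff P = 1 \<and> lead_coeff Q = 1 \<and>
    degree P = degree p \<and> degree Q = degree q"
proof -
  have pq0: "p \<noteq> 0" "q \<noteq> 0" using p q by auto
  have degg: "degree g = degree p + degree q"
  proof -
    have "degree (red_poly g) = degree g" by (rule degree_map_poly) (use g in auto)
    then show ?thesis using g(2) pq0 by (simp add: degree_mult_eq)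
  qed
  define p' where "p' = lift_poly p"
  define q' where "q' = lift_poly q"
  have p': "degree p' = degree p" "lead_coeff p' = 1" and q': "degree q' = degree q" "lead_coeff q' = 1"
    unfolding p'_def q'_def using p q by (simp_all add: coeff_map_poly)
  obtain e where e: "e > 0" "[:tpow e:] dvd g - p' * q'"
  proof -
    have "red_poly (g - p' * q') = 0"
      unfolding p'_def q'_def using g(2) by (simp add: red_poly.hom_mult red_poly.hom_minus)
    then have "rcoeff (coeff (g - p' * q') i) 0 = 0" for i
      by (simp add: poly_eq_iff coeff_map_poly)
    then have "\<exists>e>0. \<forall>c\<in>coeff (g - p' * q') ` {..degree (g - p' * q')}. tpow e dvd c"
      by (intro common_tpow_divisor) blast+
    then obtain e where "e > 0" "\<forall>c\<in>coeff (g - p' * q') ` {..degree (g - p' * q')}. tpow e dvd c"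
      by blast
    then have "tpow e dvd coeff (g - p' * q') i" for i
      by (cases "i \<le> degree (g - p' * q')") (auto simp: coeff_eq_0 simp del: coeff_diff)
    then show ?thesis using that[OF \<open>e > 0\<close>] by (simp add: const_poly_dvd_iff)
  qed
  \<comment> \<open>Factors after \<open>k\<close> corrections, and the size of the correction that leads to the next ones.\<close>
  define Inv where "Inv k PQ \<longleftrightarrow> (case PQ of (P, Q) \<Rightarrow>
     degree (P - p') < degree p \<and> degree (Q - q') < degree q \<and>
     [:tpow e:] dvd P - p' \<and> [:tpow e:] dvd Q - q' \<and>
     [:tpow (real (Suc k) * e):] dvd g - P * Q)" for k and PQ :: "'a rps poly \<times> 'a rps poly"
  define Rel where "Rel k PQ PQ' \<longleftrightarrow> (case PQ of (P, Q) \<Rightarrow> case PQ' of (P', Q') \<Rightarrow>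
     [:tpow (real (Suc k) * e):] dvd P' - P \<and> [:tpow (real (Suc k) * e):] dvd Q' - Q)"
    for k :: nat and PQ PQ' :: "'a rps poly \<times> 'a rps poly"
  have monicI: "degree P = degree p' \<and> lead_coeff P = 1"
    if "degree (P - p') < degree p'" "lead_coeff p' = 1" for P p' :: "'a rps poly"
  proof -
    have "P = p' + (P - p')" by simp
    then have "degree P = degree p'" using degree_add_eq_left[OF that(1)] by metis
    moreover have "coeff (P - p') (degree p') = 0" using that(1) by (rule coeff_eq_0)
    ultimately show ?thesis using that(2) by simp
  qed
  have step: "\<exists>PQ'. Inv (Suc k) PQ' \<and> Rel k PQ PQ'" if inv: "Inv k PQ" for k PQ
  proof -
    obtain P Q where PQ: "PQ = (P, Q)" by (cases PQ)
    note i = inv[unfolded Inv_def PQ prod.case]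
    define E where "E = g - P * Q"
    have P: "degree P = degree p" "lead_coeff P = 1" using monicI[of P p'] i p' by auto
    have Q: "degree Q = degree q" "lead_coeff Q = 1" using monicI[of Q q'] i q' by auto
    have "degree E < degree p + degree q"
    proof -
      have "coeff (P * Q) (degree g) = 1"
        using coeff_mult_degree_sum[of P Q] P Q degg by simp
      moreover have "degree (P * Q) \<le> degree g" using degree_mult_le[of P Q] P Q degg by simp
      ultimately have "coeff E j = 0" if "j \<ge> degree g" for j
        using that g(1) unfolding E_def by (cases "j = degree g") (auto simp: coeff_eq_0)
      then have "degree E < degree g" using degg p by (intro degree_lessI) auto
      then show ?thesis using degg by simp
    qed
    from hensel_linear_step[OF p q(2) uv this, of "real (Suc k) * e"] i e obtain A B where
      AB: "degree A < degree p" "degree B < degree q" "[:tpow (real (Suc k) * e):] dvd A"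
        "[:tpow (real (Suc k) * e):] dvd B" "E = A * q' + B * p'"
      unfolding E_def p'_def q'_def by auto
    have tdvd: "[:tpow (real (Suc (Suc k)) * e):] dvd F * G"
      if "[:tpow (real (Suc k) * e):] dvd F" "[:tpow e:] dvd G" for F G :: "'a rps poly"
    proof -
      have "[:tpow (real (Suc (Suc k)) * e):] = [:tpow (real (Suc k) * e):] * [:tpow e :: 'a rps:]"
        using e by (simp add: rmonom_mult algebra_simps)
      then show ?thesis using mult_dvd_mono[OF that] by simp
    qed
    have te: "[:tpow e:] dvd F" if "[:tpow (real (Suc k) * e):] dvd F" for F :: "'a rps poly"
    proof (rule dvd_trans[OF _ that])
      show "[:tpow e:] dvd [:tpow (real (Suc k) * e) :: 'a rps:]"
        using e by (simp add: tpow_dvd_tpow)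
    qed
    define P' where "P' = P + A"
    define Q' where "Q' = Q + B"
    have "g - P' * Q' = E - A * Q - B * P - A * B"
      unfolding E_def P'_def Q'_def by (simp add: algebra_simps)
    also have "\<dots> = - (A * (Q - q') + B * (P - p') + A * B)"
      unfolding AB(5) by (simp add: algebra_simps)
    finally have "[:tpow (real (Suc (Suc k)) * e):] dvd g - P' * Q'"
      using tdvd AB te i by (simp add: dvd_add)
    moreover have "degree (P' - p') < degree p" "degree (Q' - q') < degree q"
      using degree_add_less[of "P - p'" "degree p" A] degree_add_less[of "Q - q'" "degree q" B] i AB
      unfolding P'_def Q'_def by (simp_all add: algebra_simps)
    moreover have "[:tpow e:] dvd P' - p'" "[:tpow e:] dvd Q' - q'"
      using dvd_add[of "[:tpow e:]" "P - p'" A] dvd_add[of "[:tpow e:]" "Q - q'" B] i te[OF AB(3)] te[OF AB(4)]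
      unfolding P'_def Q'_def by (simp_all add: algebra_simps)
    ultimately have "Inv (Suc k) (P', Q')" unfolding Inv_def by simp
    moreover have "Rel k PQ (P', Q')" unfolding Rel_def PQ P'_def Q'_def using AB by simp
    ultimately show ?thesis by blast
  qed
  have "Inv 0 (p', q')" unfolding Inv_def using e p q by simp
  then have "\<exists>PQ. Inv 0 PQ" ..
  from dependent_nat_choice[of Inv Rel, OF this] step obtain F where
    F: "\<And>k. Inv k (F k)" "\<And>k. Rel k (F k) (F (Suc k))" by metis
  define P Q where "P = fst \<circ> F" and "Q = snd \<circ> F"
  have FP: "F k = (P k, Q k)" for k unfolding P_def Q_def by simp
  have inv: "degree (P k - p') < degree p" "degree (Q k - q') < degree q"
     "[:tpow (real (Suc k) * e):] dvd g - P k * Q k"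
     "[:tpow (real (Suc k) * e):] dvd P (Suc k) - P k"
     "[:tpow (real (Suc k) * e):] dvd Q (Suc k) - Q k" for k
    using F[of k] F[of "Suc k"] unfolding FP Inv_def Rel_def by auto
  have dP: "degree (P k) = degree p" "lead_coeff (P k) = 1"
    and dQ: "degree (Q k) = degree q" "lead_coeff (Q k) = 1" for k
    using monicI[of "P k" p'] monicI[of "Q k" q'] inv[of k] p' q' by auto
  obtain L where L: "\<And>k. [:tpow (real (Suc k) * e):] dvd L - P k" "degree L \<le> degree p"
    using poly_cauchy_limit[of e P "degree p"] e inv dP by auto
  obtain M where M: "\<And>k. [:tpow (real (Suc k) * e):] dvd M - Q k" "degree M \<le> degree q"
    using poly_cauchy_limit[of e Q "degree q"] e inv dQ by auto
  have "coeff L (degree p) - 1 = 0" "coeff M (degree q) - 1 = 0"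
    using rps_eq_0I[OF e(1), of "coeff L (degree p) - 1"] rps_eq_0I[OF e(1), of "coeff M (degree q) - 1"]
      L(1) M(1) dP dQ by (simp_all add: const_poly_dvd_iff) (metis+)
  then have lc: "coeff L (degree p) = 1" "coeff M (degree q) = 1" by simp_all
  then have deg: "degree L = degree p" "degree M = degree q"
    using L(2) M(2) by (metis le_antisym le_degree zero_neq_one)+
  have "g - L * M = 0"
  proof (rule poly_rps_eq_0I[OF e(1)])
    fix k
    have "g - L * M = (g - P k * Q k) - (L - P k) * M - P k * (M - Q k)"
      by (simp add: algebra_simps)
    then show "[:tpow (real (Suc k) * e):] dvd g - L * M"
      using inv(3)[of k] L(1)[of k] M(1)[of k] by (metis dvd_diff dvd_mult dvd_mult2)
  qed
  then show ?thesis using deg lc by (intro exI[of _ L] exI[of _ M]) auto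
qed

definition splits :: "'a::comm_ring_1 poly \<Rightarrow> bool" where
  "splits p \<longleftrightarrow> (\<exists>M. p = (\<Prod>z\<in>#M. [:- z, 1:]))"

lemma splits_mult: "splits p \<Longrightarrow> splits q \<Longrightarrow> splits (p * q)"
  unfolding splits_def by (metis image_mset_union prod_mset.union)

lemma splits_shift: "splits p \<Longrightarrow> splits (pcompose p [:a, 1:])" for p :: "'a::comm_ring_1 poly"
proof -
  have "pcompose (\<Prod>z\<in>#M. [:- z, 1:]) [:a, 1:] = (\<Prod>z\<in>#image_mset (\<lambda>z. z - a) M. [:- z, 1:])" for M :: "'a multiset"
    by (induction M) (simp_all add: pcompose_mult pcompose_pCons algebra_simps del: mult_pCons_left)
  then show "splits p \<Longrightarrow> splits (pcompose p [:a, 1:])" unfolding splits_def by metis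
qed

lemma monic_prod_linear:
  "degree (\<Prod>z\<in>#M. [:- z, 1::'a::idom:]) = size M" "lead_coeff (\<Prod>z\<in>#M. [:- z, 1::'a:]) = 1"
proof -
  have "degree (\<Prod>z\<in>#M. [:- z, 1::'a:]) = size M \<and> lead_coeff (\<Prod>z\<in>#M. [:- z, 1::'a:]) = 1"
  proof (induction M)
    case (add z M)
    then have "(\<Prod>z\<in>#M. [:- z, 1:]) \<noteq> 0" by (metis leading_coeff_0_iff zero_neq_one)
    then have "degree ([:- z, 1:] * (\<Prod>z\<in>#M. [:- z, 1:])) = Suc (size M)"
      using add by (subst degree_mult_eq) auto
    moreover have "lead_coeff ([:- z, 1:] * (\<Prod>z\<in>#M. [:- z, 1:])) = 1"
      using add by (subst lead_coeff_mult) auto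
    ultimately show ?case by simp
  qed simp
  then show "degree (\<Prod>z\<in>#M. [:- z, 1::'a:]) = size M" "lead_coeff (\<Prod>z\<in>#M. [:- z, 1::'a:]) = 1"
    by blast+
qed

text \<open>
  Multiplying all roots by \<open>t\<close> is the substitution \<open>Y = t Z\<close> up to a factor, written in terms of
  coefficients so that \<open>t\<close> need not be invertible.
\<close>

lemma coeff_prod_scaled_linear:
  fixes t :: "'a::idom"
  shows "i \<le> size M \<Longrightarrow>
    coeff (\<Prod>z\<in>#M. [:- (t * z), 1:]) i = t ^ (size M - i) * coeff (\<Prod>z\<in>#M. [:- z, 1:]) i"
proof (induction M arbitrary: i)
  case (add z M)
  have c: "coeff ([:a, 1:] * q) i = a * coeff q i + (case i of 0 \<Rightarrow> 0 | Suc j \<Rightarrow> coeff q j)"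
    for a :: 'a and q by (cases i) auto
  show ?case
  proof (cases i)
    case 0
    then show ?thesis using add.IH[of 0] by (simp add: mult.commute)
  next
    case (Suc j)
    have IHj: "coeff (\<Prod>z\<in>#M. [:- (t * z), 1:]) j = t ^ (size M - j) * coeff (\<Prod>z\<in>#M. [:- z, 1:]) j"
      using add Suc by simp
    show ?thesis
    proof (cases "i \<le> size M")
      case True
      then have "t ^ (size M - j) = t * t ^ (size M - i)" unfolding Suc
        by (metis Suc_diff_le diff_Suc_Suc power_Suc)
      then show ?thesis using add.IH[OF True] IHj Suc by (simp add: c algebra_simps)
    next
      case False
      have "(\<Prod>z\<in>#M. [:- (t * z), 1:]) = (\<Prod>z\<in>#image_mset (\<lambda>z. t * z) M. [:- z, 1:])"
        by (simp add: image_mset.compositionality o_def)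
      then have "degree (\<Prod>z\<in>#M. [:- (t * z), 1:]) = size M"
        by (simp only: monic_prod_linear size_image_mset)
      then have "coeff (\<Prod>z\<in>#M. [:- (t * z), 1:]) i = 0" "coeff (\<Prod>z\<in>#M. [:- z, 1:]) i = 0"
        using False monic_prod_linear(1)[of M] by (auto intro!: coeff_eq_0)
      then show ?thesis using IHj Suc by (simp add: c)
    qed
  qed
qed simp

text \<open>
  Modulo \<open>q\<close> the element \<open>w = q / q(a)\<close> vanishes, and \<open>1 - w\<close> is divisible by \<open>Y - a\<close>; so the
  \<open>k\<close>-th power of \<open>1 - w\<close> is divisible by the \<open>k\<close>-th power of \<open>Y - a\<close> and is \<open>1\<close> modulo \<open>q\<close>.
\<close>

lemma bezout_linear_power:
  fixes q :: "'a::field poly"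
  assumes "poly q a \<noteq> 0"
  shows "\<exists>u v. u * [:- a, 1:] ^ k + v * q = 1"
proof -
  define w where "w = [:inverse (poly q a):] * q"
  have "poly (1 - w) a = 0" unfolding w_def using assms by simp
  then obtain t where t: "1 - w = [:- a, 1:] * t" by (metis poly_eq_0_iff_dvd dvdE)
  have "w dvd 1 - (1 - w) ^ k"
  proof (induction k)
    case (Suc k)
    have "1 - (1 - w) ^ Suc k = (1 - (1 - w) ^ k) + w * (1 - w) ^ k" by (simp add: algebra_simps)
    then show ?case using Suc by (metis dvd_add dvd_triv_left)
  qed simp
  then have "q dvd 1 - (1 - w) ^ k" unfolding w_def using dvd_mult_right by blast
  then obtain v where "1 - (1 - w) ^ k = q * v" by (elim dvdE)
  then have "t ^ k * [:- a, 1:] ^ k + v * q = 1"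
    unfolding t power_mult_distrib by (simp add: algebra_simps)
  then show ?thesis by blast
qed

lemma pcompose_power: "pcompose (p ^ n) q = pcompose p q ^ n" for p :: "'a::comm_semiring_1 poly"
  by (induction n) (simp_all add: pcompose_mult pcompose_1)

lemma coeff_shift_subleading:
  fixes p :: "'a::idom poly"
  assumes "lead_coeff p = 1" "degree p = Suc m"
  shows "coeff (pcompose p [:c, 1:]) m = coeff p m + of_nat (Suc m) * c"
proof -
  define r where "r = p - monom 1 (Suc m) - monom (coeff p m) m"
  have r0: "coeff r i = 0" if "i \<ge> m" for i
  proof -
    consider "i = m" | "i = Suc m" | "i > Suc m" using \<open>i \<ge> m\<close> by linarith
    then show ?thesis by cases (use assms in \<open>auto simp: r_def coeff_eq_0\<close>)
  qed
  have r: "coeff (pcompose r [:c, 1:]) m = 0"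
  proof (cases "r = 0")
    case False
    then have "degree r < m" using r0 by (metis leading_coeff_0_iff not_le)
    then show ?thesis by (simp add: coeff_eq_0)
  qed simp
  have "p = monom 1 (Suc m) + monom (coeff p m) m + r" unfolding r_def by simp
  then have "pcompose p [:c, 1:] = pcompose (monom 1 (Suc m) + monom (coeff p m) m + r) [:c, 1:]" by metis
  also have "\<dots> = [:c, 1:] ^ Suc m + Polynomial.smult (coeff p m) ([:c, 1:] ^ m) + pcompose r [:c, 1:]"
    by (simp add: pcompose_add monom_altdef pcompose_smult pcompose_power pcompose_pCons del: power_Suc)
  finally have "coeff (pcompose p [:c, 1:]) m =
      coeff ([:c, 1:] ^ Suc m) m + coeff p m * coeff ([:c, 1:] ^ m) m"
    using r by (simp del: power_Suc)
  then show ?thesis by (simp only: coeff_linear_poly_power) simp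
qed

text \<open>
  The Newton-Puiseux theorem, by induction on the degree \<open>n\<close>. A shift of \<open>Y\<close> removes the
  coefficient of \<open>Y\<^bsup>n-1\<^esup>\<close>, and a substitution \<open>Y = T\<^sup>c Z\<close> with the largest possible \<open>c\<close> makes some
  lower coefficient a unit. The reduction then has vanishing subleading coefficient without being
  \<open>Z\<^sup>n\<close>, so in characteristic \<open>0\<close> it is not a power of a linear polynomial. Splitting off the full
  power of one linear factor gives coprime factors of smaller degree, which lift by Hensel's lemma.
\<close>

theorem monic_rps_poly_splits:
  fixes p :: "'a::{alg_closed_field, field_char_0} rps poly"
  assumes "lead_coeff p = 1"
  shows "splits p"
  using assms
proof (induction "degree p" arbitrary: p rule: less_induct)
  case less
  show ?case
  proof (cases "degree p")
    case 0
    then have "p = 1" using less.prems by (metis degree_eq_zeroE lead_coeff_pCons(2) one_pCons)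
    then show ?thesis unfolding splits_def by (intro exI[of _ "{#}"]) simp
  next
    case (Suc m)
    define n where "n = degree p"
    define a where "a = coeff p m * rmonom (1 / of_nat n) 0"
    define p1 where "p1 = pcompose p [:- a, 1:]"
    have p_p1: "p = pcompose p1 [:a, 1:]"
      unfolding p1_def by (simp add: pcompose_assoc[symmetric] pcompose_pCons)
    have p1: "degree p1 = n" "lead_coeff p1 = 1"
      using less.prems lead_coeff_comp[of "[:- a, 1:]" p] unfolding p1_def n_def
      by (simp_all add: degree_pcompose)
    have nz: "(of_nat n :: 'a) \<noteq> 0" unfolding n_def Suc by (simp del: of_nat_Suc)
    have ofn: "(of_nat n :: 'a rps) = rmonom (of_nat n) 0"
      by (rule rconst.hom_of_nat[symmetric])
    have "coeff p1 m = coeff p m - of_nat n * a"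
      unfolding p1_def using coeff_shift_subleading[OF less.prems Suc, of "- a"] by (simp add: n_def Suc)
    also have "\<dots> = 0" unfolding a_def ofn using nz by (simp add: mult.left_commute rmonom_mult)
    finally have p1m: "coeff p1 m = 0" .
    define I where "I = {i. i < n \<and> coeff p1 i \<noteq> 0}"
    have "splits p1"
    proof (cases "I = {}")
      case True
      have "p1 = monom 1 n"
      proof (rule poly_eqI)
        fix i show "coeff p1 i = coeff (monom 1 n) i"
          using True p1 unfolding I_def by (cases i n rule: linorder_cases) (auto simp: coeff_eq_0)
      qed
      also have "\<dots> = (\<Prod>z\<in>#replicate_mset n 0. [:- z, 1:])" by (simp add: monom_altdef)
      finally show ?thesis unfolding splits_def by blast
    next
      case False
      \<comment> \<open>\<open>c\<close> is the least slope of the Newton polygon, so all \<open>coeff p1 i\<close> stay divisible below\<close>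
      define s where "s i = rord (coeff p1 i) / real (n - i)" for i
      define c where "c = Min (s ` I)"
      have fin: "finite (s ` I)" "s ` I \<noteq> {}" using False unfolding I_def by auto
      have c_le: "c \<le> s i" if "i \<in> I" for i unfolding c_def using fin that by simp
      obtain i0 where i0: "i0 \<in> I" "c = s i0" using Min_in[OF fin] unfolding c_def by auto
      have c0: "c \<ge> 0" using i0 rord_nonneg[of "coeff p1 i0"] unfolding s_def I_def
        by (auto intro!: divide_nonneg_nonneg)
      have "\<exists>d. coeff p1 i = tpow c ^ (n - i) * d \<and> (i = n \<longrightarrow> d = 1)" if "i \<le> n" for i
      proof -
        consider "i = n" | "coeff p1 i = 0" "i < n" | "i \<in> I" using \<open>i \<le> n\<close> unfolding I_def by fastforce
        then show ?thesis
        proof cases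
          case 3
          have "real (n - i) * c \<le> rord (coeff p1 i)"
            using c_le[OF 3] 3 unfolding s_def I_def by (simp add: field_simps)
          then have "tpow (real (n - i) * c) dvd coeff p1 i"
            using 3 c0 unfolding I_def by (simp add: tpow_dvd_iff_rord)
          then show ?thesis using 3 c0 unfolding I_def by (auto simp: tpow_power dvd_def)
        qed (use p1 in auto)
      qed
      then obtain d where d: "\<And>i. i \<le> n \<Longrightarrow> coeff p1 i = tpow c ^ (n - i) * d i" "d n = 1" by (metis order_refl)
      define g where "g = (\<Sum>i\<le>n. monom (d i) i)"
      have g: "coeff g i = (if i \<le> n then d i else 0)" for i unfolding g_def by (simp add: coeff_sum)
      have degg: "degree g = n"
        by (rule antisym[OF degree_le le_degree]) (auto simp: g d)
      have lcg: "lead_coeff g = 1" using degg g d by simp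
      have tn: "tpow c ^ k \<noteq> (0 :: 'a rps)" for k using c0 by simp
      have "splits g"
      proof -
        define h where "h = red_poly g"
        have degh: "degree h = n" unfolding h_def using lcg degg by (subst degree_map_poly) auto
        have lch: "lead_coeff h = 1" using lcg degg degh unfolding h_def by (simp add: coeff_map_poly)
        have "d m = 0" using d(1)[of m] p1m tn unfolding n_def Suc by auto
        then have hm: "coeff h m = 0" unfolding h_def by (simp add: coeff_map_poly g)
        have hi0: "coeff h i0 \<noteq> 0"
        proof -
          have i0n: "i0 < n" "coeff p1 i0 \<noteq> 0" using i0 unfolding I_def by auto
          have eq: "coeff p1 i0 = tpow (real (n - i0) * c) * d i0"
            using d(1)[of i0] i0n c0 by (simp add: tpow_power)
          then have d0: "d i0 \<noteq> 0" using i0n by auto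
          have "rord (coeff p1 i0) = real (n - i0) * c + rord (d i0)"
          proof -
            have nn: "0 \<le> real (n - i0) * c" using c0 by (intro mult_nonneg_nonneg) simp_all
            then have "(tpow (real (n - i0) * c) :: 'a rps) \<noteq> 0" unfolding rmonom_eq_0_iff by (metis not_less one_neq_zero)
            from rord_mult[OF this d0] show ?thesis unfolding eq rord_rmonom[OF one_neq_zero nn] .
          qed
          moreover have "rord (coeff p1 i0) = real (n - i0) * c"
            unfolding i0(2) s_def using i0n by simp
          ultimately have "rord (d i0) = 0" by simp
          then show ?thesis using rord_props(1)[OF d0] i0n by (simp add: h_def coeff_map_poly g)
        qed
        have "degree h > 0" using degh n_def Suc by simp
        then obtain b where b: "poly h b = 0" using alg_closed_imp_poly_has_root by blast
        have h0: "h \<noteq> 0" using lch by auto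
        define k where "k = order b h"
        obtain q where q: "h = [:- b, 1:] ^ k * q" "\<not> [:- b, 1:] dvd q"
          using order_decomp[OF h0, of b] unfolding k_def by blast
        have k: "k \<ge> 1" using b h0 order_root[of h b] unfolding k_def by simp
        have q0: "q \<noteq> 0" using q h0 by auto
        have lcq: "lead_coeff q = 1" using lch unfolding q(1) lead_coeff_mult
          by (simp add: lead_coeff_power)
        have degs: "degree h = k + degree q"
          unfolding q(1) using q0 by (simp add: degree_mult_eq degree_linear_power)
        have degq: "degree q \<ge> 1"
        proof (rule ccontr)
          assume "\<not> degree q \<ge> 1"
          then have "q = 1" using lcq by (metis degree_eq_zeroE lead_coeff_pCons(2) one_pCons less_one not_le)
          then have h: "h = [:- b, 1:] ^ n" using q(1) degs degh by simp
          have "coeff h m = of_nat (n choose m) * 1 ^ m * (- b) ^ (n - m)"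
            unfolding h by (rule coeff_linear_poly_power) (simp add: n_def Suc)
          also have "\<dots> = of_nat n * (- b)" by (simp add: n_def Suc)
          finally have "coeff h m = of_nat n * (- b)" .
          then have "b = 0" using hm nz by simp
          then have "h = monom 1 n" unfolding h by (simp add: monom_altdef)
          then show False using hi0 i0 unfolding I_def by simp
        qed
        have "poly q b \<noteq> 0" using q(2) by (simp add: poly_eq_0_iff_dvd)
        from bezout_linear_power[OF this] obtain u v where "u * [:- b, 1:] ^ k + v * q = 1" by blast
        moreover have "lead_coeff ([:- b, 1:] ^ k) = 1" by (subst lead_coeff_power) simp
        moreover have dk: "degree ([:- b, 1:] ^ k) = k" by (rule degree_linear_power)
        ultimately obtain P Q where
          PQ: "g = P * Q" "lead_coeff P = 1" "lead_coeff Q = 1" "degree P = k" "degree Q = degree q"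
          using hensel_factorization[OF lcg q(1)[unfolded h_def] _ _ lcq degq] k unfolding dk by metis
        have "degree P < degree p" "degree Q < degree p"
          using PQ degs degh degq k unfolding n_def by auto
        then show ?thesis unfolding PQ(1) using less.hyps PQ by (blast intro: splits_mult)
      qed
      then obtain M where M: "g = (\<Prod>z\<in>#M. [:- z, 1:])" unfolding splits_def by blast
      have sM: "size M = n" using degg monic_prod_linear(1)[of M] M by simp
      have "p1 = (\<Prod>z\<in>#M. [:- (tpow c * z), 1:])"
      proof (rule poly_eqI)
        fix i
        have "(\<Prod>z\<in>#M. [:- (tpow c * z), 1:]) = (\<Prod>z\<in>#image_mset (\<lambda>z. tpow c * z) M. [:- z, 1:])"
          by (simp add: image_mset.compositionality o_def)
        then have deg: "degree (\<Prod>z\<in>#M. [:- (tpow c * z), 1:]) = n"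
          by (simp only: monic_prod_linear size_image_mset sM)
        show "coeff p1 i = coeff (\<Prod>z\<in>#M. [:- (tpow c * z), 1:]) i"
        proof (cases "i \<le> n")
          case True
          then show ?thesis using coeff_prod_scaled_linear[of i M "tpow c"] d(1)[of i] g[of i] sM M by simp
        qed (use deg p1 in \<open>simp add: coeff_eq_0\<close>)
      qed
      also have "\<dots> = (\<Prod>z\<in>#image_mset (\<lambda>z. tpow c * z) M. [:- z, 1:])"
        by (simp add: image_mset.compositionality o_def)
      finally show ?thesis unfolding splits_def by blast
    qed
    then show ?thesis unfolding p_p1 by (rule splits_shift)
  qed
qed

section \<open>Sums over roots and resultants\<close>

lemma lead_coeff_prod_linear:
  fixes y :: "'i \<Rightarrow> 'b::idom"
  shows "lead_coeff (\<Prod>i\<in>I. [:- y i, 1:]) = 1" "finite I \<Longrightarrow> degree (\<Prod>i\<in>I. [:- y i, 1:]) = card I"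
proof -
  show "lead_coeff (\<Prod>i\<in>I. [:- y i, 1:]) = 1" by (simp add: lead_coeff_prod)
  show "finite I \<Longrightarrow> degree (\<Prod>i\<in>I. [:- y i, 1:]) = card I"
    by (subst degree_prod_eq_sum_degree) auto
qed

lemma splits_indexed:
  fixes p :: "'b::idom poly"
  assumes "splits p"
  shows "\<exists>y :: nat \<Rightarrow> 'b. p = (\<Prod>i<degree p. [:- y i, 1:])"
proof -
  obtain M where M: "p = (\<Prod>z\<in>#M. [:- z, 1:])" using assms unfolding splits_def by blast
  obtain zs where zs: "M = mset zs" using ex_mset by metis
  have "p = prod_list (map (\<lambda>z. [:- z, 1:]) zs)"
    unfolding M zs by (metis mset_map prod_mset_prod_list)
  also have "\<dots> = (\<Prod>i<length zs. [:- (zs ! i), 1:])"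
    by (simp add: prod.list_conv_set_nth lessThan_atLeast0)
  finally have "p = (\<Prod>i<length zs. [:- (zs ! i), 1:])" .
  moreover have "length zs = degree p" unfolding M monic_prod_linear zs by simp
  ultimately show ?thesis by metis
qed

text \<open>
  Euler's trace formula. As \<open>f'\<close> is the sum of the \<open>f / (Y - y i)\<close>, the polynomial \<open>H f'\<close> is
  congruent modulo \<open>f\<close> to \<open>\<Sum>i. H(y i) f / (Y - y i)\<close>, whose coefficient of degree \<open>n - 1\<close> is the
  sum of the \<open>H(y i)\<close>. The left-hand side can be computed without knowing the roots.
\<close>

lemma sum_over_roots_coeff_remainder:
  fixes y :: "'i \<Rightarrow> 'b::idom"
  assumes I: "finite I" "I \<noteq> {}" and f: "f = (\<Prod>i\<in>I. [:- y i, 1:])"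
    and H: "H * pderiv f = Q * f + R" and R: "degree R < card I"
  shows "coeff R (card I - 1) = (\<Sum>i\<in>I. poly H (y i))"
proof -
  define g where "g i = (\<Prod>j\<in>I - {i}. [:- y j, 1:])" for i
  have fg: "f = [:- y i, 1:] * g i" if "i \<in> I" for i
    unfolding f g_def using I that by (simp add: prod.remove)
  have g: "coeff (g i) (card I - 1) = 1" "degree (g i) = card I - 1" if "i \<in> I" for i
    using lead_coeff_prod_linear[where y=y and I="I - {i}"] that I unfolding g_def by auto
  have df: "pderiv f = (\<Sum>i\<in>I. g i)"
    unfolding f g_def by (simp add: pderiv_prod pderiv_pCons)
  have "\<exists>K. H = [:- y i, 1:] * K + [:poly H (y i):]" for i
  proof -
    have "[:- y i, 1:] dvd H - [:poly H (y i):]" by (simp add: poly_eq_0_iff_dvd[symmetric])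
    then show ?thesis by (metis dvdE diff_add_cancel)
  qed
  then obtain K where K: "\<And>i. H = [:- y i, 1:] * K i + [:poly H (y i):]" by metis
  define T where "T = (\<Sum>i\<in>I. [:poly H (y i):] * g i)"
  have "H * pderiv f = (\<Sum>i\<in>I. H * g i)" unfolding df by (simp add: sum_distrib_left)
  also have "\<dots> = (\<Sum>i\<in>I. K i * f + [:poly H (y i):] * g i)"
  proof (rule sum.cong[OF refl])
    fix i assume "i \<in> I"
    have "H * g i = ([:- y i, 1:] * K i + [:poly H (y i):]) * g i" using K by metis
    also have "\<dots> = K i * f + [:poly H (y i):] * g i"
      unfolding fg[OF \<open>i \<in> I\<close>] by (simp only: algebra_simps)
    finally show "H * g i = K i * f + [:poly H (y i):] * g i" .
  qed
  also have "\<dots> = (\<Sum>i\<in>I. K i) * f + T" by (simp add: T_def sum.distrib sum_distrib_right)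
  finally have eq: "R - T = ((\<Sum>i\<in>I. K i) - Q) * f" using H by (simp add: algebra_simps)
  have c: "card I > 0" using I by (simp add: card_gt_0_iff)
  have "degree T < card I" unfolding T_def
  proof (rule degree_sum_less)
    fix i assume "i \<in> I"
    then show "degree ([:poly H (y i):] * g i) < card I"
      using g[of i] c by (intro le_less_trans[OF degree_mult_le]) auto
  qed (use c in simp)
  then have "degree (R - T) < card I" using R by (intro degree_diff_less)
  moreover have lf: "degree f = card I" "f \<noteq> 0" using lead_coeff_prod_linear[where y=y and I=I] I f by auto
  ultimately have "(\<Sum>i\<in>I. K i) - Q = 0"
    unfolding eq by (metis degree_mult_eq le_add2 not_le)
  then have "R = T" using eq by simp
  then show ?thesis unfolding T_def using g by (simp add: coeff_sum)
qed

text \<open>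
  If the first \<open>card I\<close> power sums vanished, so would \<open>\<Sum>i. P(c i)\<close> for each \<open>P\<close> of degree at most
  \<open>card I\<close> with \<open>P(0) = 0\<close>. Taking for \<open>P\<close> a polynomial that vanishes at \<open>0\<close> and at all values
  other than \<open>c k\<close> leaves a nonzero multiple of \<open>P(c k)\<close>. The bound on \<open>r\<close> will bound the
  denominators of the exponents of the roots.
\<close>

lemma power_sum_nonzero:
  fixes c :: "'i \<Rightarrow> 'b::{idom, ring_char_0}"
  assumes I: "finite I" and k: "k \<in> I" "c k \<noteq> 0"
  shows "\<exists>r\<in>{1..card I}. (\<Sum>i\<in>I. c i ^ r) \<noteq> 0"
proof (rule ccontr)
  assume "\<not> ?thesis"
  then have z: "(\<Sum>i\<in>I. c i ^ r) = 0" if "1 \<le> r" "r \<le> card I" for r using that by auto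
  define C where "C = c ` I - {0, c k}"
  \<comment> \<open>The factor \<open>Y\<close> removes the power sum with exponent \<open>0\<close>, which is \<open>card I\<close>.\<close>
  define P where "P = [:0, 1:] * (\<Prod>x\<in>C. [:- x, 1:])"
  have C: "finite C" unfolding C_def using I by simp
  have "card C < card (c ` I)" unfolding C_def using I k by (intro psubset_card_mono) auto
  then have cC: "card C < card I" using card_image_le[OF I, of c] by simp
  have degP: "degree P \<le> card I"
  proof -
    have "degree P \<le> 1 + card C"
      unfolding P_def using lead_coeff_prod_linear(2)[OF C, where y="\<lambda>x. x"]
      by (intro order_trans[OF degree_mult_le]) simp
    then show ?thesis using cC by simp
  qed
  have "(\<Sum>i\<in>I. poly P (c i)) = (\<Sum>i\<in>I. \<Sum>r\<le>degree P. coeff P r * c i ^ r)"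
    by (simp add: poly_altdef)
  also have "\<dots> = (\<Sum>r\<le>degree P. coeff P r * (\<Sum>i\<in>I. c i ^ r))"
    by (subst sum.swap) (simp add: sum_distrib_left)
  also have "\<dots> = 0"
  proof (rule sum.neutral, intro ballI)
    fix r assume r: "r \<in> {..degree P}"
    show "coeff P r * (\<Sum>i\<in>I. c i ^ r) = 0"
    proof (cases r)
      case 0
      then show ?thesis by (simp add: P_def)
    qed (use r degP z[of r] in simp)
  qed
  finally have "(\<Sum>i\<in>I. poly P (c i)) = 0" .
  moreover have "(\<Sum>i\<in>I. poly P (c i)) = (\<Sum>i\<in>{i\<in>I. c i = c k}. poly P (c i))"
  proof (rule sum.mono_neutral_right)
    show "\<forall>i\<in>I - {i \<in> I. c i = c k}. poly P (c i) = 0"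
    proof
      fix i assume i: "i \<in> I - {i \<in> I. c i = c k}"
      show "poly P (c i) = 0"
      proof (cases "c i = 0")
        case False
        then have "c i \<in> C" using i unfolding C_def by auto
        then show ?thesis using C unfolding P_def by (auto simp: poly_prod)
      qed (simp add: P_def)
    qed
  qed (use I in auto)
  moreover have "\<dots> = of_nat (card {i\<in>I. c i = c k}) * poly P (c k)" by simp
  moreover have "poly P (c k) \<noteq> 0" using k C by (auto simp: P_def C_def poly_prod)
  moreover have "card {i\<in>I. c i = c k} \<noteq> 0" using I k by auto
  ultimately show False by simp
qed

text \<open>
  The polynomial whose coefficients, from the highest down, are row \<open>i\<close> of the Sylvester matrix.
\<close>

definition sylvester_row :: "'b::comm_ring_1 poly \<Rightarrow> 'b poly \<Rightarrow> nat \<Rightarrow> 'b poly" where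
  "sylvester_row p q i = (if i < degree q then monom 1 (degree q - 1 - i) * p
     else monom 1 (degree p + degree q - 1 - i) * q)"

lemma sylvester_entry:
  assumes "i < degree p + degree q" "j < degree p + degree q"
  shows "sylvester_mat p q $$ (i, j) = coeff (sylvester_row p q i) (degree p + degree q - 1 - j)"
  using assms
  by (subst sylvester_index_mat) (auto simp: sylvester_row_def coeff_monom_mult coeff_eq_0
      intro!: arg_cong[of _ _ "coeff p"] arg_cong[of _ _ "coeff q"])

lemma degree_sylvester_row:
  assumes "i < degree p + degree q"
  shows "degree (sylvester_row p q i) < degree p + degree q"
  using assms unfolding sylvester_row_def
  by (auto intro!: le_less_trans[OF degree_mult_le] simp: degree_monom_eq)

text \<open>
  The entries in the last row of the adjugate matrix combine the rows of the Sylvester matrix to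
  \<open>(0, \<dots>, 0, det)\<close>, that is, to the constant polynomial \<open>resultant p q\<close>.
\<close>

lemma resultant_in_ideal:
  fixes p q :: "'b::comm_ring_1 poly"
  assumes d: "degree p + degree q > 0"
  shows "\<exists>A B. [:resultant p q:] = A * p + B * q"
proof -
  define N where "N = degree p + degree q"
  define S where "S = sylvester_mat p q"
  have S: "S \<in> carrier_mat N N" unfolding S_def N_def by (rule sylvester_carrier_mat)
  define c where "c i = adj_mat S $$ (N - 1, i)" for i
  have T: "[:resultant p q:] = (\<Sum>i<N. [:c i:] * sylvester_row p q i)"
  proof (rule poly_eqI)
    fix e
    show "coeff [:resultant p q:] e = coeff (\<Sum>i<N. [:c i:] * sylvester_row p q i) e"
    proof (cases "e < N")
      case True
      define j where "j = N - 1 - e"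
      have j: "j < N" "e = N - 1 - j" unfolding j_def using True by auto
      have "coeff (\<Sum>i<N. [:c i:] * sylvester_row p q i) e = (\<Sum>i<N. c i * S $$ (i, j))"
        unfolding S_def using j by (simp add: coeff_sum sylvester_entry N_def)
      also have "\<dots> = (adj_mat S * S) $$ (N - 1, j)"
        using j adj_mat(1)[OF S] S by (simp add: c_def scalar_prod_def lessThan_atLeast0)
      also have "\<dots> = (if j = N - 1 then det S else 0)"
        unfolding adj_mat(3)[OF S] using j by auto
      also have "\<dots> = coeff [:resultant p q:] e"
        using j True by (auto simp: resultant_def S_def coeff_pCons split: nat.splits)
      finally show ?thesis by simp
    next
      case False
      have "coeff (\<Sum>i<N. [:c i:] * sylvester_row p q i) e = 0"
        using False degree_sylvester_row[of _ p q] unfolding N_def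
        by (auto simp: coeff_sum intro!: sum.neutral) (metis coeff_eq_0 le_less_trans mult_zero_right not_le)
      then show ?thesis using False d N_def by (cases e) auto
    qed
  qed
  have "\<exists>a b. [:c i:] * sylvester_row p q i = a * p + b * q" for i
  proof (cases "i < degree q")
    case True
    then show ?thesis unfolding sylvester_row_def
      by (intro exI[of _ "[:c i:] * monom 1 (degree q - 1 - i)"] exI[of _ 0]) (simp only: mult.assoc if_True, simp)
  next
    case False
    then show ?thesis unfolding sylvester_row_def
      by (intro exI[of _ 0] exI[of _ "[:c i:] * monom 1 (degree p + degree q - 1 - i)"]) (simp only: mult.assoc if_False, simp)
  qed
  then obtain a b where ab: "\<And>i. [:c i:] * sylvester_row p q i = a i * p + b i * q" by metis
  show ?thesis unfolding T ab sum.distrib sum_distrib_right[symmetric] by blast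
qed

lemma det_upper_unitriangular:
  assumes A: "A \<in> carrier_mat n n" and "\<And>i j. i < n \<Longrightarrow> j < i \<Longrightarrow> A $$ (i, j) = 0"
    and "\<And>i. i < n \<Longrightarrow> A $$ (i, i) = 1"
  shows "det A = (1::'b::comm_ring_1)"
proof -
  have "upper_triangular A" using assms by (auto simp: upper_triangular_def)
  then have "det A = prod_list (diag_mat A)" using A by (rule det_upper_triangular)
  also have "diag_mat A = map (\<lambda>i. 1) [0..<n]"
    unfolding diag_mat_def using A assms(3) by auto
  also have "prod_list \<dots> = (1::'b)" by (induction n) auto
  finally show ?thesis .
qed

lemma coeff_linear_mult:
  "coeff ([:- z, 1:] * u) e = (if e = 0 then 0 else coeff u (e - 1)) - z * coeff u e"
  for z :: "'b::comm_ring_1"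
  by (cases e) auto

text \<open>
  Subtracting \<open>z\<close> times the next row from the first \<open>degree G\<close> rows makes the polynomials of all
  rows but one divisible by \<open>Y - z\<close>; the remaining one is \<open>p\<close>. Passing to coordinates with respect
  to \<open>1\<close> and the \<open>(Y - z) Y\<^sup>i\<close>, a unitriangular change, produces a column whose only nonzero entry is \<open>p(z)\<close>,
  and deleting its row and column leaves the Sylvester matrix of \<open>p\<close> and \<open>G\<close>.
\<close>

lemma resultant_linear_mult:
  fixes p G :: "'b::idom poly"
  assumes G: "G \<noteq> 0"
  shows "resultant p ([:- z, 1:] * G) = (- 1) ^ degree p * poly p z * resultant p G"
proof -
  define m k N where "m = degree p" and "k = degree G" and "N = m + k + 1"
  define q where "q = [:- z, 1:] * G"
  have dq: "degree q = k + 1" unfolding q_def k_def using G by (subst degree_mult_eq) auto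
  obtain s where s: "p = [:- z, 1:] * s + [:poly p z:]"
  proof -
    have "[:- z, 1:] dvd p - [:poly p z:]" by (simp add: poly_eq_0_iff_dvd[symmetric])
    then show ?thesis using that by (metis dvdE diff_add_cancel)
  qed
  have ds: "s = 0 \<or> degree s < m"
  proof (cases "s = 0")
    case False
    have "degree ([:- z, 1:] * s) = 1 + degree s" using False by (subst degree_mult_eq) auto
    moreover have "[:- z, 1:] * s = p - [:poly p z:]" using s by (metis add_diff_cancel_right')
    moreover have "degree (p - [:poly p z:]) \<le> m" unfolding m_def
      by (rule degree_diff_le) auto
    ultimately show ?thesis by simp
  qed simp
  define S where "S = sylvester_mat p q"
  have S: "S \<in> carrier_mat N N" unfolding S_def N_def m_def using dq by auto
  have Sij: "S $$ (i, j) = coeff (sylvester_row p q i) (N - 1 - j)" if "i < N" "j < N" for i j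
    unfolding S_def using that sylvester_entry[of i p q j] dq by (simp add: N_def m_def)
  \<comment> \<open>After the row operations row \<open>i\<close> is \<open>(Y - z) u i + c i\<close>, and \<open>B\<close> is the matrix in the new coordinates.\<close>
  define u where "u i = (if i = k then s else sylvester_row p G (if i < k then i else i - 1))" for i
  define c where "c i = (if i = k then poly p z else 0)" for i
  define B where "B = mat N N (\<lambda>(i, l). if l = N - 1 then c i else coeff (u i) (N - 2 - l))"
  define L where "L = mat N N (\<lambda>(i, j). if i = j then 1 else if j = i + 1 \<and> i < k then - z else 0)"
  define M where "M = mat N N (\<lambda>(i, j). if i = j then 1 else if j = i + 1 then - z else 0)"
  have B: "B \<in> carrier_mat N N" and L: "L \<in> carrier_mat N N" and M: "M \<in> carrier_mat N N"
    unfolding B_def L_def M_def by auto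
  have du: "coeff (u i) (N - 1) = 0" if "i < N" for i
  proof (cases "i = k")
    case True
    then show ?thesis unfolding u_def using s ds
      by (auto simp: N_def coeff_eq_0)
  next
    case False
    then have "degree (u i) < m + k"
      unfolding u_def m_def k_def using that degree_sylvester_row[of _ p G]
      by (auto simp: N_def m_def k_def)
    then show ?thesis by (simp add: coeff_eq_0 N_def)
  qed
  define R where "R i = [:- z, 1:] * u i + [:c i:]" for i
  have BM: "(B * M) $$ (i, l) = coeff (R i) (N - 1 - l)" if il: "i < N" "l < N" for i l
  proof -
    have "(B * M) $$ (i, l) = (\<Sum>j<N. B $$ (i, j) * M $$ (j, l))"
      using il B M by (simp add: scalar_prod_def lessThan_atLeast0)
    also have "\<dots> = (\<Sum>j<N. (if j = l then B $$ (i, j) else 0) + (if j + 1 = l then - z * B $$ (i, j) else 0))"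
      unfolding M_def using il by (intro sum.cong) auto
    also have "\<dots> = B $$ (i, l) + (if l = 0 then 0 else - z * B $$ (i, l - 1))"
    proof -
      have "(\<Sum>j<N. if j + 1 = l then - z * B $$ (i, j) else 0) = (if l = 0 then 0 else - z * B $$ (i, l - 1))"
        using il by (cases l) auto
      then show ?thesis using il by (simp add: sum.distrib)
    qed
    also have "\<dots> = coeff (R i) (N - 1 - l)"
      using il du[OF il(1)] unfolding R_def B_def coeff_add coeff_linear_mult
      by (cases "l = 0"; cases "l = N - 1") (auto simp: coeff_pCons numeral_2_eq_2 split: nat.splits)
    finally show ?thesis .
  qed
  have row: "(if i < k then sylvester_row p q i - Polynomial.smult z (sylvester_row p q (i + 1))
      else sylvester_row p q i) = R i" if "i < N" for i
  proof -
    consider "i < k" | "i = k" | "i > k" by linarith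
    then show ?thesis
    proof cases
      case 1
      then have "k - i = Suc (k - 1 - i)" by simp
      then have "monom 1 (k - i) = [:0, 1:] * (monom 1 (k - 1 - i) :: 'b poly)"
        by (simp only: monom_Suc) simp
      then show ?thesis using 1 unfolding R_def u_def c_def sylvester_row_def dq k_def[symmetric]
        by (simp add: algebra_simps)
    next
      case 2
      then show ?thesis unfolding R_def u_def c_def sylvester_row_def dq using s
        by (simp add: monom_altdef)
    next
      case 3
      then have "m + k - i = m + k - 1 - (i - 1)" "\<not> i - 1 < k" by simp_all
      then show ?thesis using 3 unfolding R_def u_def c_def sylvester_row_def dq k_def[symmetric] m_def[symmetric]
        by (simp add: q_def algebra_simps)
    qed
  qed
  have LS: "(L * S) $$ (i, l) = coeff (R i) (N - 1 - l)" if il: "i < N" "l < N" for i l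
  proof -
    have "(L * S) $$ (i, l) = (\<Sum>j<N. L $$ (i, j) * S $$ (j, l))"
      using il S L by (simp add: scalar_prod_def lessThan_atLeast0)
    also have "\<dots> = (\<Sum>j<N. (if j = i then S $$ (j, l) else 0) + (if j = i + 1 \<and> i < k then - z * S $$ (j, l) else 0))"
      unfolding L_def using il by (intro sum.cong) auto
    also have "\<dots> = S $$ (i, l) + (if i < k then - z * S $$ (i + 1, l) else 0)"
    proof -
      have "i < k \<Longrightarrow> i + 1 < N" unfolding N_def by simp
      then show ?thesis using il by (simp add: sum.distrib)
    qed
    also have "\<dots> = coeff (if i < k then sylvester_row p q i - Polynomial.smult z (sylvester_row p q (i + 1))
      else sylvester_row p q i) (N - 1 - l)"
      using il Sij[of i l] Sij[of "i + 1" l] by (simp add: N_def)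
    finally show ?thesis unfolding row[OF il(1)] .
  qed
  have "L * S = B * M"
    by (rule eq_matI) (use LS BM L S B M in auto)
  then have "det L * det S = det B * det M" using det_mult L S B M by metis
  moreover have "det L = 1" "det M = 1"
    by (rule det_upper_unitriangular[OF L]; auto simp: L_def)
       (rule det_upper_unitriangular[OF M]; auto simp: M_def)
  ultimately have "det S = det B" by simp
  also have "\<dots> = (\<Sum>i<N. B $$ (i, N - 1) * cofactor B i (N - 1))"
    by (rule laplace_expansion_column[OF B]) (simp add: N_def)
  also have "\<dots> = (\<Sum>i<N. if i = k then poly p z * cofactor B k (N - 1) else 0)"
    by (rule sum.cong) (auto simp: B_def N_def c_def)
  also have "\<dots> = poly p z * cofactor B k (N - 1)" by (simp add: N_def)
  also have "mat_delete B k (N - 1) = sylvester_mat p G"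
  proof (rule eq_matI)
    fix i j assume "i < dim_row (sylvester_mat p G)" "j < dim_col (sylvester_mat p G)"
    then have ij: "i < m + k" "j < m + k" by (simp_all add: m_def k_def)
    have "mat_delete B k (N - 1) $$ (i, j) = B $$ (if i < k then i else Suc i, j)"
      using ij B unfolding mat_delete_def by (auto simp: N_def)
    also have "\<dots> = coeff (sylvester_row p G i) (m + k - 1 - j)"
      using ij unfolding B_def u_def by (auto simp: N_def)
    also have "\<dots> = sylvester_mat p G $$ (i, j)"
      using ij sylvester_entry[of i p G j] by (simp add: m_def k_def)
    finally show "mat_delete B k (N - 1) $$ (i, j) = sylvester_mat p G $$ (i, j)" .
  qed (use B in \<open>auto simp: mat_delete_def N_def m_def k_def\<close>)
  then have "cofactor B k (N - 1) = (- 1) ^ m * resultant p G"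
    unfolding cofactor_def resultant_def N_def by (simp add: power_add mult.assoc flip: power_mult_distrib)
  finally show ?thesis unfolding S_def q_def resultant_def m_def by (simp add: ac_simps)
qed

lemma resultant_prod_linear:
  fixes p :: "'b::idom poly"
  assumes "finite J" "c \<noteq> 0"
  shows "\<exists>e\<in>{1, - 1}. resultant p (Polynomial.smult c (\<Prod>j\<in>J. [:- z j, 1:])) =
    e * c ^ degree p * (\<Prod>j\<in>J. poly p (z j))"
  using assms(1)
proof (induction J rule: finite_induct)
  case empty
  then show ?case using resultant_const(2)[of p c] by (auto simp: one_pCons)
next
  case (insert j J)
  define G where "G = Polynomial.smult c (\<Prod>j\<in>J. [:- z j, 1:])"
  have G: "G \<noteq> 0" unfolding G_def using assms insert by auto
  obtain e where e: "e \<in> {1, -1}" "resultant p G = e * c ^ degree p * (\<Prod>j\<in>J. poly p (z j))"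
    using insert.IH unfolding G_def by blast
  have "Polynomial.smult c (\<Prod>j\<in>insert j J. [:- z j, 1:]) = [:- z j, 1:] * G"
    unfolding G_def by (simp only: prod.insert[OF insert.hyps] mult_smult_right)
  then have "resultant p (Polynomial.smult c (\<Prod>j\<in>insert j J. [:- z j, 1:])) =
      (- 1) ^ degree p * poly p (z j) * resultant p G"
    using resultant_linear_mult[OF G] by metis
  then have "resultant p (Polynomial.smult c (\<Prod>j\<in>insert j J. [:- z j, 1:])) =
      ((- 1) ^ degree p * e) * c ^ degree p * (\<Prod>j\<in>insert j J. poly p (z j))"
    by (simp only: e(2) prod.insert[OF insert.hyps] ac_simps)
  moreover have "(- 1) ^ degree p * e \<in> {1, -1}"
    using e by (cases "even (degree p)") auto
  ultimately show ?case by blast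
qed

section \<open>Generic weights and monomial substitutions\<close>

definition rv :: "rat ^ 's \<Rightarrow> real ^ 's" where
  "rv e = (\<chi> i. of_rat (e $ i))"

lemma rv_simps [simp]:
  "rv 0 = 0" "rv (a + b) = rv a + rv b" "rv (a - b) = rv a - rv b" "rv (c *s a) = of_rat c *\<^sub>R rv a"
  by (simp_all add: rv_def cart_eq_iff of_rat_add of_rat_diff of_rat_mult)

lemma rv_sum: "rv (sum g A) = (\<Sum>i\<in>A. rv (g i))"
  by (induction A rule: infinite_finite_induct) auto

text \<open>
  A weight is used as a linear form on exponents; a generic one separates all rational exponents,
  so every nonzero series has exactly one term of least weight.
\<close>

definition generic :: "real ^ 's::finite \<Rightarrow> bool" where
  "generic W \<longleftrightarrow> (\<forall>i. 0 < W $ i) \<and> inj (\<lambda>e. W \<bullet> rv e)"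

lemma generic_pos: "generic W \<Longrightarrow> 0 < W $ i"
  and generic_eq: "generic W \<Longrightarrow> W \<bullet> rv e = W \<bullet> rv e' \<Longrightarrow> e = e'"
  by (auto simp: generic_def inj_def)

lemma inner_rv_nonneg: "generic W \<Longrightarrow> 0 \<le> e \<Longrightarrow> 0 \<le> W \<bullet> rv e"
  unfolding inner_vec_def rv_def generic_def
  by (auto intro!: sum_nonneg mult_nonneg_nonneg simp: cart_le_iff less_imp_le)

lemma inner_rv_mono: "generic W \<Longrightarrow> a \<le> b \<Longrightarrow> W \<bullet> rv a \<le> W \<bullet> rv b"
  using inner_rv_nonneg[of W "b - a"] by (simp add: inner_diff_right cart_le_iff)

lemma inner_rv_strict_mono: "generic W \<Longrightarrow> a < b \<Longrightarrow> W \<bullet> rv a < W \<bullet> rv b"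
  using inner_rv_mono[of W a b] generic_eq[of W a b] by (auto simp: less_le)

text \<open>
  The components are chosen one after the other; each has to avoid only the countable rational span
  of the earlier ones.
\<close>

lemma rationally_independent_near:
  fixes t :: "'s \<Rightarrow> real" and \<epsilon> :: real
  assumes "finite F" "\<epsilon> > 0"
  shows "\<exists>w. (\<forall>i\<in>F. t i < w i \<and> w i < t i + \<epsilon>) \<and>
    (\<forall>e :: 's \<Rightarrow> rat. (\<Sum>i\<in>F. w i * of_rat (e i)) = 0 \<longrightarrow> (\<forall>i\<in>F. e i = 0))"
  using assms(1)
proof (induction F rule: finite_induct)
  case empty
  then show ?case by auto
next
  case (insert j F)
  then obtain w where w: "\<forall>i\<in>F. t i < w i \<and> w i < t i + \<epsilon>"
    and w': "\<forall>e :: 's \<Rightarrow> rat. (\<Sum>i\<in>F. w i * of_rat (e i)) = 0 \<longrightarrow> (\<forall>i\<in>F. e i = 0)" by (elim exE conjE)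
  define D where "D = (\<lambda>c. \<Sum>i\<in>F. w i * of_rat (c i)) ` PiE F (\<lambda>_. UNIV :: rat set)"
  have "countable D" unfolding D_def using insert by (intro countable_image countable_PiE) auto
  moreover have "uncountable {t j<..<t j + \<epsilon>}" using assms(2) by (simp add: uncountable_open_interval)
  ultimately have "\<not> {t j<..<t j + \<epsilon>} \<subseteq> D" using countable_subset by blast
  then obtain x where "x \<in> {t j<..<t j + \<epsilon>}" "x \<notin> D" by blast
  then have x: "t j < x" "x < t j + \<epsilon>" "x \<notin> D" by auto
  define w' where "w' = w(j := x)"
  have sumF: "(\<Sum>i\<in>F. w' i * of_rat (e i)) = (\<Sum>i\<in>F. w i * of_rat (e i))" for e :: "'s \<Rightarrow> rat"
    unfolding w'_def using insert by (intro sum.cong) auto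
  have "\<forall>i\<in>insert j F. e i = 0" if e: "(\<Sum>i\<in>insert j F. w' i * of_rat (e i)) = 0" for e :: "'s \<Rightarrow> rat"
  proof -
    have eq: "x * of_rat (e j) + (\<Sum>i\<in>F. w i * of_rat (e i)) = 0"
      using e sumF[of e] insert by (simp add: w'_def)
    have "e j = 0"
    proof (rule ccontr)
      assume ej: "e j \<noteq> 0"
      have "x = - (\<Sum>i\<in>F. w i * of_rat (e i)) / of_rat (e j)"
      proof -
        have "x * of_rat (e j) = - (\<Sum>i\<in>F. w i * of_rat (e i))" using eq by linarith
        then show ?thesis using ej by (metis nonzero_eq_divide_eq of_rat_eq_0_iff)
      qed
      also have "\<dots> = (\<Sum>i\<in>F. w i * of_rat (restrict (\<lambda>i. - e i / e j) F i))"
        by (simp add: sum_divide_distrib sum_negf of_rat_divide of_rat_minus cong: sum.cong)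
      finally have "x \<in> D" unfolding D_def by (intro image_eqI[of _ _ "restrict (\<lambda>i. - e i / e j) F"]) auto
      then show False using x by blast
    qed
    then show ?thesis using eq w' by auto
  qed
  moreover have "\<forall>i\<in>insert j F. t i < w' i \<and> w' i < t i + \<epsilon>" using w x insert unfolding w'_def by auto
  ultimately show ?case by blast
qed

lemma generic_dense:
  fixes t :: "real ^ 's::finite"
  assumes "open U" "t \<in> U" "0 \<le> t"
  shows "\<exists>W\<in>U. generic W"
proof -
  obtain \<epsilon> where \<epsilon>: "\<epsilon> > 0" "ball t \<epsilon> \<subseteq> U" using assms open_contains_ball by blast
  define \<delta> where "\<delta> = \<epsilon> / (2 * real CARD('s))"
  have \<delta>: "\<delta> > 0" unfolding \<delta>_def using \<epsilon> by simp
  obtain w where w: "\<And>i. t $ i < w i" "\<And>i. w i < t $ i + \<delta>"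
    "\<And>e :: 's \<Rightarrow> rat. (\<Sum>i\<in>UNIV. w i * of_rat (e i)) = 0 \<Longrightarrow> \<forall>i. e i = 0"
    using rationally_independent_near[OF finite_class.finite_UNIV \<delta>, of "\<lambda>i. t $ i"] by auto
  define W where "W = (\<chi> i. w i)"
  have "dist t W \<le> (\<Sum>i\<in>UNIV. dist (t $ i) (W $ i))"
    unfolding dist_vec_def by (rule L2_set_le_sum) simp
  also have "\<dots> \<le> (\<Sum>i\<in>(UNIV :: 's set). \<delta>)"
  proof (rule sum_mono)
    fix i show "dist (t $ i) (W $ i) \<le> \<delta>"
      using w(1)[of i] w(2)[of i] by (simp add: W_def dist_real_def)
  qed
  also have "\<dots> < \<epsilon>" unfolding \<delta>_def using \<epsilon> by simp
  finally have "W \<in> U" using \<epsilon> by auto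
  moreover have "generic W" unfolding generic_def
  proof (intro conjI allI injI)
    show "0 < W $ i" for i
      using w(1)[of i] assms(3) by (auto simp: W_def cart_le_iff intro: le_less_trans)
    fix a b assume "W \<bullet> rv a = W \<bullet> rv b"
    then have "W \<bullet> rv (a - b) = 0" by (simp add: inner_diff_right)
    then have "(\<Sum>i\<in>UNIV. w i * of_rat ((a - b) $ i)) = 0"
      by (simp add: inner_vec_def W_def rv_def of_rat_diff)
    then show "a = b" using w(3)[of "\<lambda>i. (a - b) $ i"] by (simp add: cart_eq_iff)
  qed
  ultimately show ?thesis by blast
qed

lemma generic_exists: "\<exists>W :: real ^ 's::finite. generic W"
  using generic_dense[of UNIV "0 :: real ^ 's"] by auto

text \<open>
  Generic weights approximate the coordinate vectors, so they detect a negative component of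
  \<open>b - a\<close>. This is how properties of one-variable series for all weights give componentwise
  inequalities between exponents.
\<close>

lemma le_if_generic_le:
  fixes a b :: "rat ^ 's::finite"
  assumes "\<And>W. generic W \<Longrightarrow> W \<bullet> rv a \<le> W \<bullet> rv b"
  shows "a \<le> b"
proof (rule ccontr)
  assume "\<not> a \<le> b"
  then obtain j where j: "b $ j < a $ j" by (auto simp: cart_le_iff not_le)
  define U where "U = {W :: real ^ 's. W \<bullet> rv b < W \<bullet> rv a}"
  have "open U" unfolding U_def by (intro open_Collect_less continuous_intros)
  moreover have "axis j 1 \<in> U" using j by (simp add: U_def inner_axis' rv_def of_rat_less)
  moreover have "0 \<le> (axis j 1 :: real ^ 's)" by (auto simp: cart_le_iff axis_def)
  ultimately obtain W where "W \<in> U" "generic W" using generic_dense by blast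
  then show False using assms[of W] by (simp add: U_def)
qed

lemma finite_grid_le:
  fixes W :: "real ^ 's::finite"
  assumes W: "\<And>i. 0 < W $ i" and k: "k > 0"
  shows "finite {e \<in> grid k. W \<bullet> rv e \<le> b}"
proof -
  obtain N :: nat where N: "\<And>i. b * real k / W $ i \<le> real N"
  proof -
    have "finite (range (\<lambda>i. nat \<lceil>b * real k / W $ i\<rceil>))" by simp
    then obtain N where "\<And>i. nat \<lceil>b * real k / W $ i\<rceil> \<le> N"
      by (metis Max_ge rangeI)
    then show ?thesis using that by (metis of_nat_ceiling of_nat_le_iff order_trans)
  qed
  define S :: "rat set" where "S = (\<lambda>m::nat. of_nat m / of_nat k) ` {..N}"
  have "{e \<in> grid k. W \<bullet> rv e \<le> b} \<subseteq> vec_lambda ` PiE UNIV (\<lambda>_. S)"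
  proof
    fix e assume e: "e \<in> {e \<in> grid k. W \<bullet> rv e \<le> b}"
    have "e $ i \<in> S" for i
    proof -
      obtain m :: nat where m: "e $ i = of_nat m / of_nat k" using e unfolding grid_def by blast
      have "W $ i * of_rat (e $ i) \<le> (\<Sum>j\<in>UNIV. W $ j * of_rat (e $ j))"
        using e grid_nonneg[of e k] W by (intro member_le_sum) (auto simp: less_imp_le)
      then have "W $ i * of_rat (e $ i) \<le> b" using e by (simp add: inner_vec_def rv_def)
      then have "W $ i * (real m / real k) \<le> b" by (simp add: m of_rat_divide)
      then have "real m \<le> b * real k / W $ i" using W[of i] k by (simp add: field_simps)
      then have "m \<le> N" using N[of i] by linarith
      then show ?thesis unfolding S_def m by blast
    qed
    then have "vec_nth e \<in> PiE UNIV (\<lambda>_. S)" by auto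
    then show "e \<in> vec_lambda ` PiE UNIV (\<lambda>_. S)" by (metis image_eqI vec_nth_inverse)
  qed
  moreover have "finite (PiE (UNIV :: 's set) (\<lambda>_. S))" by (rule finite_PiE) (auto simp: S_def)
  ultimately show ?thesis by (rule finite_subset[OF _ finite_imageI])
qed

text \<open>
  The substitution of \<open>T\<close> to the power \<open>W $ i\<close> for \<open>X\<^sub>i\<close>. For generic \<open>W\<close> no two exponents collide, so
  each coefficient is just moved to its new place.
\<close>

definition emb :: "real ^ 's::finite \<Rightarrow> ('a::zero, 's) pps \<Rightarrow> 'a rps" where
  "emb W h = Abs_rps (\<lambda>x. if \<exists>e. W \<bullet> rv e = x then pps_coeff h (THE e. W \<bullet> rv e = x) else 0)"

lemma rcoeff_emb:
  assumes W: "generic W"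
  shows "rcoeff (emb W h) (W \<bullet> rv e) = pps_coeff h e"
    and "x \<notin> range (\<lambda>e. W \<bullet> rv e) \<Longrightarrow> rcoeff (emb W h) x = 0"
proof -
  define c where "c x = (if \<exists>e. W \<bullet> rv e = x then pps_coeff h (THE e. W \<bullet> rv e = x) else 0)" for x
  have the: "(THE e'. W \<bullet> rv e' = W \<bullet> rv e) = e" for e using generic_eq[OF W] by blast
  have c1: "c (W \<bullet> rv e) = pps_coeff h e" for e unfolding c_def the by auto
  have c2: "c x = 0" if "x \<notin> range (\<lambda>e. W \<bullet> rv e)" for x using that unfolding c_def by auto
  obtain k where k: "k > 0" "supported k h" using supported_ex by blast
  have cx: "\<exists>e. x = W \<bullet> rv e \<and> e \<in> grid k \<and> pps_coeff h e \<noteq> 0" if "c x \<noteq> 0" for x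
    using c1 c2[of x] that k(2) unfolding supported_def by force
  have "rcoeff (emb W h) = c" unfolding emb_def c_def[symmetric]
  proof (rule Abs_rps_inverse, intro CollectI conjI allI impI)
    fix x :: real assume "x < 0"
    show "c x = 0"
    proof (rule ccontr)
      assume "c x \<noteq> 0"
      then obtain e where e: "x = W \<bullet> rv e" "e \<in> grid k" using cx by blast
      have "0 \<le> e" using grid_nonneg[OF e(2)] by (simp add: cart_le_iff)
      then show False using inner_rv_nonneg[OF W] e(1) \<open>x < 0\<close> by force
    qed
  next
    fix b
    have "finite ((\<lambda>e. W \<bullet> rv e) ` {e \<in> grid k. W \<bullet> rv e \<le> b})"
      using finite_grid_le[OF generic_pos[OF W] k(1)] by simp
    then show "finite {x. c x \<noteq> 0 \<and> x \<le> b}" by (rule rev_finite_subset) (use cx in blast)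
  qed
  then show "rcoeff (emb W h) (W \<bullet> rv e) = pps_coeff h e"
    "x \<notin> range (\<lambda>e. W \<bullet> rv e) \<Longrightarrow> rcoeff (emb W h) x = 0" using c1 c2 by auto
qed

lemma emb_eqI:
  assumes "generic W" "\<And>e. rcoeff r (W \<bullet> rv e) = pps_coeff h e"
    "\<And>x. x \<notin> range (\<lambda>e. W \<bullet> rv e) \<Longrightarrow> rcoeff r x = 0"
  shows "emb W h = r"
proof (rule rps_eqI)
  fix x show "rcoeff (emb W h) x = rcoeff r x"
    using rcoeff_emb[OF assms(1), where h=h] assms(2,3) by (cases "x \<in> range (\<lambda>e. W \<bullet> rv e)") auto
qed

lemma emb_nonzeroE:
  assumes "generic W" "rcoeff (emb W h) x \<noteq> 0"
  obtains e where "x = W \<bullet> rv e" "pps_coeff h e \<noteq> 0"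
proof -
  have "x \<in> range (\<lambda>e. W \<bullet> rv e)" using rcoeff_emb(2)[OF assms(1)] assms(2) by blast
  then obtain e where "x = W \<bullet> rv e" by blast
  then show thesis using that[of e] assms(2) by (simp add: rcoeff_emb(1)[OF assms(1)])
qed

lemma emb_hom:
  assumes W: "generic W"
  shows "inj_comm_ring_hom (emb W :: ('a::comm_ring_1, 's::finite) pps \<Rightarrow> 'a rps)"
proof
  fix f g :: "('a, 's) pps"
  note c = rcoeff_emb[OF W]
  show "emb W 0 = (0 :: 'a rps)" by (rule emb_eqI[OF W]) auto
  show "emb W (f + g) = emb W f + emb W g" by (rule emb_eqI[OF W]) (auto simp: c)
  show "emb W 1 = (1 :: 'a rps)"
  proof (rule emb_eqI[OF W])
    show "rcoeff 1 (W \<bullet> rv e) = pps_coeff 1 e" for e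
      using generic_eq[OF W, of e 0] by auto
    show "rcoeff 1 x = (0 :: 'a)" if "x \<notin> range (\<lambda>e. W \<bullet> rv e)" for x
    proof -
      have "0 \<in> range (\<lambda>e. W \<bullet> rv e)" by (rule image_eqI[of _ _ 0]) auto
      then show ?thesis using that by auto
    qed
  qed
  show "emb W (f * g) = emb W f * emb W g"
  proof (rule emb_eqI[OF W])
    fix e
    have "rcoeff (emb W f * emb W g) (W \<bullet> rv e) =
        (\<Sum>x | rcoeff (emb W f) x \<noteq> 0 \<and> rcoeff (emb W g) (W \<bullet> rv e - x) \<noteq> 0.
          rcoeff (emb W f) x * rcoeff (emb W g) (W \<bullet> rv e - x))"
      by (simp only: times_rps.rep_eq)
    also have "{x. rcoeff (emb W f) x \<noteq> 0 \<and> rcoeff (emb W g) (W \<bullet> rv e - x) \<noteq> 0} =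
        (\<lambda>a. W \<bullet> rv a) ` {a. pps_coeff f a \<noteq> 0 \<and> pps_coeff g (e - a) \<noteq> 0}"
    proof -
      have "W \<bullet> rv e - W \<bullet> rv a = W \<bullet> rv (e - a)" for a by (simp add: inner_diff_right)
      then have c': "rcoeff (emb W g) (W \<bullet> rv e - W \<bullet> rv a) = pps_coeff g (e - a)" for a
        by (metis c(1))
      show ?thesis
      proof (intro equalityI subsetI)
        fix x assume x: "x \<in> {x. rcoeff (emb W f) x \<noteq> 0 \<and> rcoeff (emb W g) (W \<bullet> rv e - x) \<noteq> 0}"
        then obtain a where "x = W \<bullet> rv a" "pps_coeff f a \<noteq> 0" by (auto elim: emb_nonzeroE[OF W])
        then show "x \<in> (\<lambda>a. W \<bullet> rv a) ` {a. pps_coeff f a \<noteq> 0 \<and> pps_coeff g (e - a) \<noteq> 0}"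
          using x c' by auto
      qed (auto simp: c c')
    qed
    also have "(\<Sum>x\<in>\<dots>. rcoeff (emb W f) x * rcoeff (emb W g) (W \<bullet> rv e - x)) =
        (\<Sum>a | pps_coeff f a \<noteq> 0 \<and> pps_coeff g (e - a) \<noteq> 0. pps_coeff f a * pps_coeff g (e - a))"
    proof (subst sum.reindex)
      show "inj_on (\<lambda>a. W \<bullet> rv a) {a. pps_coeff f a \<noteq> 0 \<and> pps_coeff g (e - a) \<noteq> 0}"
        using generic_eq[OF W] by (auto simp: inj_on_def)
      have "W \<bullet> rv e - W \<bullet> rv a = W \<bullet> rv (e - a)" for a by (simp add: inner_diff_right)
      then have "rcoeff (emb W g) (W \<bullet> rv e - W \<bullet> rv a) = pps_coeff g (e - a)" for a
        by (metis c(1))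
      then show "sum ((\<lambda>x. rcoeff (emb W f) x * rcoeff (emb W g) (W \<bullet> rv e - x)) \<circ> (\<lambda>a. W \<bullet> rv a))
          {a. pps_coeff f a \<noteq> 0 \<and> pps_coeff g (e - a) \<noteq> 0} =
        (\<Sum>a | pps_coeff f a \<noteq> 0 \<and> pps_coeff g (e - a) \<noteq> 0. pps_coeff f a * pps_coeff g (e - a))"
        by (simp add: c)
    qed
    also have "\<dots> = pps_coeff (f * g) e" by (simp add: times_pps.rep_eq)
    finally show "rcoeff (emb W f * emb W g) (W \<bullet> rv e) = pps_coeff (f * g) e" .
  next
    fix x assume x: "x \<notin> range (\<lambda>e. W \<bullet> rv e)"
    show "rcoeff (emb W f * emb W g) x = 0"
    proof (rule ccontr)
      assume "rcoeff (emb W f * emb W g) x \<noteq> 0"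
      then obtain a where a: "rcoeff (emb W f) a \<noteq> 0" "rcoeff (emb W g) (x - a) \<noteq> 0"
        using rcoeff_mult_nonzero by blast
      obtain e1 e2 where "a = W \<bullet> rv e1" "x - a = W \<bullet> rv e2"
        using a by (auto elim!: emb_nonzeroE[OF W])
      then have "x = W \<bullet> rv (e1 + e2)" by (simp add: inner_add_right)
      then show False using x by blast
    qed
  qed
  show "f = 0" if "emb W f = 0"
    by (rule pps_eqI) (use c(1)[of f] that in simp)
qed

lemma emb_eq_0_iff: "generic W \<Longrightarrow> emb W h = 0 \<longleftrightarrow> h = 0" for h :: "('a::comm_ring_1, 's::finite) pps"
proof -
  assume W: "generic W"
  interpret e: inj_comm_ring_hom "emb W :: ('a, 's) pps \<Rightarrow> 'a rps" by (rule emb_hom[OF W])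
  show ?thesis by simp
qed

lemma emb_X_pow:
  assumes W: "generic W" and "0 \<le> e"
  shows "emb W (X_pow e) = (tpow (W \<bullet> rv e) :: 'a::zero_neq_one rps)"
proof (rule emb_eqI[OF W])
  show "rcoeff (tpow (W \<bullet> rv e)) (W \<bullet> rv e') = (pps_coeff (X_pow e) e' :: 'a)" for e'
    using generic_eq[OF W, of e' e] inner_rv_nonneg[OF assms] assms(2) by (auto simp: X_pow.rep_eq)
qed auto

lemma emb_leadE:
  assumes W: "generic W" and h: "h \<noteq> (0 :: ('a::comm_ring_1, 's::finite) pps)"
  obtains e where "rord (emb W h) = W \<bullet> rv e" "pps_coeff h e \<noteq> 0"
  using rord_props(1)[of "emb W h"] emb_eq_0_iff[OF W, of h] h by (auto elim!: emb_nonzeroE[OF W])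

lemma rord_emb_le: "generic W \<Longrightarrow> pps_coeff h e \<noteq> 0 \<Longrightarrow> rord (emb W h) \<le> W \<bullet> rv e"
  by (rule rord_le) (simp add: rcoeff_emb)

lemma rord_emb_unit:
  assumes "generic W" "const_coeff u \<noteq> (0 :: 'a::comm_ring_1)"
  shows "rord (emb W u) = 0"
proof (rule rord_eqI)
  show "rcoeff (emb W u) 0 \<noteq> 0" using rcoeff_emb(1)[OF assms(1), of u 0] assms(2) by simp
qed (rule rcoeff_neg)

lemma rord_emb_monomial_unit:
  fixes u :: "('a::idom, 's::finite) pps"
  assumes W: "generic W" and u: "const_coeff u \<noteq> 0" and e: "0 \<le> e"
  shows "rord (emb W (X_pow e * u)) = W \<bullet> rv e"
proof -
  interpret e: inj_comm_ring_hom "emb W :: ('a, 's) pps \<Rightarrow> 'a rps" by (rule emb_hom[OF W])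
  have "u \<noteq> 0" using u by auto
  then show ?thesis using inner_rv_nonneg[OF W e] rord_emb_unit[OF W u]
    by (simp add: e.hom_mult emb_X_pow[OF W e] rord_mult not_less)
qed

lemma pps_coeff_X_pow_mult:
  fixes u :: "('a::comm_ring_1, 's::finite) pps"
  assumes "0 \<le> l"
  shows "pps_coeff (X_pow l * u) e = pps_coeff u (e - l)"
proof -
  have "{a. pps_coeff (X_pow l) a \<noteq> (0::'a::comm_ring_1) \<and> pps_coeff u (e - a) \<noteq> 0} =
      (if pps_coeff u (e - l) \<noteq> 0 then {l} else {})"
    using assms by (auto simp: X_pow.rep_eq split: if_splits)
  then show ?thesis unfolding times_pps.rep_eq using assms by (simp add: X_pow.rep_eq)
qed

lemma pps_coeff_nonneg:
  assumes "pps_coeff h l \<noteq> 0"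
  shows "0 \<le> l"
proof -
  obtain k where "supported k h" using supported_ex by blast
  then have "l \<in> grid k" using assms unfolding supported_def by blast
  then show ?thesis using grid_nonneg by (auto simp: cart_le_iff)
qed

lemma X_pow_dvdI:
  fixes h :: "('a::comm_ring_1, 's::finite) pps"
  assumes l: "pps_coeff h l \<noteq> 0" and le: "\<And>e. pps_coeff h e \<noteq> 0 \<Longrightarrow> l \<le> e"
  shows "\<exists>u. h = X_pow l * u \<and> const_coeff u \<noteq> 0"
proof -
  obtain k where k: "k > 0" "supported k h" using supported_ex by blast
  define c where "c e = pps_coeff h (e + l)" for e
  have grid: "e \<in> grid k" if "c e \<noteq> 0" for e
    unfolding grid_def
  proof (intro CollectI allI)
    fix i
    have "l \<in> grid k" "e + l \<in> grid k" using that l k unfolding c_def supported_def by auto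
    then obtain m n :: nat where mn: "l $ i = of_nat m / of_nat k" "(e + l) $ i = of_nat n / of_nat k"
      unfolding grid_def by blast
    have "l $ i \<le> (e + l) $ i" using le[of "e + l"] that by (simp add: c_def cart_le_iff)
    then have "m \<le> n" unfolding mn using k by (simp add: divide_le_cancel)
    then have "e $ i = of_nat (n - m) / of_nat k" using mn by (simp add: of_nat_diff diff_divide_distrib)
    then show "\<exists>m::nat. e $ i = of_nat m / of_nat k" by blast
  qed
  have "pps_coeff (Abs_pps c) = c" by (rule Abs_pps_inverse) (use grid k in blast)
  moreover have l0: "0 \<le> l" using l by (rule pps_coeff_nonneg)
  ultimately have "h = X_pow l * Abs_pps c" "const_coeff (Abs_pps c) \<noteq> 0"
    using l by (auto intro!: pps_eqI simp: pps_coeff_X_pow_mult c_def)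
  then show ?thesis by blast
qed

text \<open>
  For each generic weight the lowest exponents of \<open>g\<close> and \<open>h\<close> add up to \<open>a\<close>. Let \<open>b\<close> and \<open>l\<close> be
  those for one weight. For another weight \<open>W\<close>, the lowest weight of \<open>g\<close> is at most that of \<open>b\<close>, so
  that of \<open>h\<close> is at least that of \<open>a - b = l\<close>. Hence \<open>l\<close> lies below all exponents of \<open>h\<close>.
\<close>

lemma divisor_of_monomial_unit:
  fixes g h :: "('a::idom, 's::finite) pps"
  assumes eq: "g * h = X_pow a * u" and a: "0 \<le> a" and u: "const_coeff u \<noteq> 0"
  shows "\<exists>l u'. 0 \<le> l \<and> h = X_pow l * u' \<and> const_coeff u' \<noteq> 0"
proof -
  have "pps_coeff (g * h) a \<noteq> 0" using u unfolding eq by (simp add: pps_coeff_X_pow_mult[OF a])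
  then have nz: "g \<noteq> 0" "h \<noteq> 0" by auto
  obtain W0 :: "real ^ 's" where W0: "generic W0" using generic_exists by blast
  have ord: "rord (emb W g) + rord (emb W h) = W \<bullet> rv a" if W: "generic W" for W
  proof -
    interpret e: inj_comm_ring_hom "emb W :: ('a, 's) pps \<Rightarrow> 'a rps" by (rule emb_hom[OF W])
    have "rord (emb W (g * h)) = rord (emb W g) + rord (emb W h)"
      using nz by (simp add: e.hom_mult rord_mult)
    then show ?thesis unfolding eq rord_emb_monomial_unit[OF W u a] by simp
  qed
  obtain b where b: "rord (emb W0 g) = W0 \<bullet> rv b" "pps_coeff g b \<noteq> 0" using emb_leadE[OF W0 nz(1)] .
  obtain l where l: "rord (emb W0 h) = W0 \<bullet> rv l" "pps_coeff h l \<noteq> 0" using emb_leadE[OF W0 nz(2)] .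
  have "W0 \<bullet> rv (b + l) = W0 \<bullet> rv a" using ord[OF W0] b l by (simp add: inner_add_right)
  then have bl: "a = b + l" using generic_eq[OF W0] by metis
  have "l \<le> e" if e: "pps_coeff h e \<noteq> 0" for e
  proof (rule le_if_generic_le)
    fix W :: "real ^ 's" assume W: "generic W"
    have "W \<bullet> rv b + W \<bullet> rv l = rord (emb W g) + rord (emb W h)"
      unfolding ord[OF W] bl by (simp add: inner_add_right)
    moreover have "rord (emb W g) \<le> W \<bullet> rv b" "rord (emb W h) \<le> W \<bullet> rv e"
      using rord_emb_le[OF W] b e by auto
    ultimately show "W \<bullet> rv l \<le> W \<bullet> rv e" by linarith
  qed
  from X_pow_dvdI[OF l(2) this] obtain u' where "h = X_pow l * u'" "const_coeff u' \<noteq> 0" by blast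
  moreover have "0 \<le> l" using l(2) by (rule pps_coeff_nonneg)
  ultimately show ?thesis by blast
qed

section \<open>Derivations and the Abhyankar-Jung theorem\<close>

text \<open>
  The reals are a vector space over the rationals, where injective linear maps have linear left
  inverses (by extension of a basis).
\<close>

lemma rational_span_left_inverse:
  fixes f :: "'v::ab_group_add \<Rightarrow> real"
  assumes V: "vector_space (s :: rat \<Rightarrow> 'v \<Rightarrow> 'v)"
    and f: "\<And>a b. f (a + b) = f a + f b" "\<And>q a. f (s q a) = of_rat q * f a" "inj f"
  shows "\<exists>g. (\<forall>x y. g (x + y) = g x + g y) \<and> (\<forall>a. g (f a) = a)"
proof -
  interpret v1: vector_space s by (rule V)
  interpret v2: vector_space "\<lambda>q (x::real). of_rat q * x"
    by unfold_locales (auto simp: of_rat_add of_rat_mult algebra_simps)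
  interpret vector_space_pair s "\<lambda>q (x::real). of_rat q * x" ..
  have "Vector_Spaces.linear s (\<lambda>q (x::real). of_rat q * x) f"
    by unfold_locales (use f in auto)
  from linear_injective_left_inverse[OF this f(3)] obtain g where
    g: "Vector_Spaces.linear (\<lambda>q (x::real). of_rat q * x) s g" "g \<circ> f = id" by blast
  interpret g: Vector_Spaces.linear "\<lambda>q (x::real). of_rat q * x" s g by (rule g(1))
  show ?thesis using g.add g(2) by (metis comp_apply id_apply)
qed

text \<open>
  As a generic weight is injective on exponents, every additive function of exponents factors
  through it. So a derivation of the series in several variables extends to series in \<open>T\<close>, for each weight.
\<close>

lemma additive_extension:
  fixes l :: "rat ^ 's::finite \<Rightarrow> 'a::ab_group_add"
  assumes W: "generic W" and l: "\<And>a b. l (a + b) = l a + l b"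
  shows "\<exists>\<phi>. (\<forall>x y. \<phi> (x + y) = \<phi> x + \<phi> y) \<and> (\<forall>e. \<phi> (W \<bullet> rv e) = l e)"
proof -
  have "vector_space ((*s) :: rat \<Rightarrow> rat ^ 's \<Rightarrow> rat ^ 's)" ..
  from rational_span_left_inverse[OF this, of "\<lambda>e. W \<bullet> rv e"] obtain g where
    "\<forall>x y. g (x + y) = g x + g y" "\<forall>e. g (W \<bullet> rv e) = e"
    using W by (auto simp: inner_add_right generic_def)
  then show ?thesis using l by (intro exI[of _ "l \<circ> g"]) simp
qed

lemma additive_separating:
  fixes x :: real
  assumes "x \<noteq> 0"
  shows "\<exists>\<phi> :: real \<Rightarrow> 'a::field_char_0. (\<forall>x y. \<phi> (x + y) = \<phi> x + \<phi> y) \<and> \<phi> x \<noteq> 0"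
proof -
  have "vector_space ((*) :: rat \<Rightarrow> rat \<Rightarrow> rat)" by unfold_locales (auto simp: algebra_simps)
  from rational_span_left_inverse[OF this, of "\<lambda>q. of_rat q * x"] obtain g where
    g: "\<forall>x y. g (x + y) = g x + g y" "\<forall>q. g (of_rat q * x) = q"
    using assms by (auto simp: of_rat_add of_rat_mult algebra_simps inj_def)
  have "g x = 1" using g(2)[rule_format, of 1] by simp
  then show ?thesis using g(1) by (intro exI[of _ "\<lambda>x. of_rat (g x)"]) (simp add: of_rat_add)
qed

text \<open>
  For additive \<open>\<phi>\<close> this is a derivation, a kind of Euler operator: it multiplies the term with
  exponent \<open>x\<close> by \<open>\<phi> x\<close>. It does not lower orders. Arbitrary \<open>\<phi>\<close> are allowed so that constant \<open>\<phi>\<close>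
  give the multiplication by constants.
\<close>

lift_definition rder :: "(real \<Rightarrow> 'a) \<Rightarrow> 'a::comm_ring_1 rps \<Rightarrow> 'a rps"
  is "\<lambda>\<phi> f x. \<phi> x * f x"
proof (intro conjI allI impI)
  fix \<phi> f :: "real \<Rightarrow> 'a" and b
  assume f: "(\<forall>x<0. f x = 0) \<and> (\<forall>b. finite {x. f x \<noteq> 0 \<and> x \<le> b})"
  show "finite {x. \<phi> x * f x \<noteq> 0 \<and> x \<le> b}"
    by (rule rev_finite_subset[of "{x. f x \<noteq> 0 \<and> x \<le> b}"]) (use f in auto)
qed auto

lift_definition wder :: "(rat ^ 's \<Rightarrow> 'a) \<Rightarrow> ('a::comm_ring_1, 's::finite) pps \<Rightarrow> ('a, 's) pps"
  is "\<lambda>l f e. l e * f e"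
  by (metis mult_zero_right)

lemma rder_simps [simp]:
  "rder \<phi> 0 = 0" "rder \<phi> (f + g) = rder \<phi> f + rder \<phi> g"
  by (rule rps_eqI; simp add: rder.rep_eq algebra_simps)+

lemma wder_0 [simp]: "wder l 0 = 0"
  by (rule pps_eqI) (simp add: wder.rep_eq)

lemma rder_const: "rder (\<lambda>_. c) f = rmonom c 0 * f"
  by (rule rps_eqI) (simp add: rder.rep_eq rcoeff_rmonom_mult)

lemma rder_mult:
  assumes \<phi>: "\<And>x y. \<phi> (x + y) = \<phi> x + \<phi> y"
  shows "rder \<phi> (f * g) = rder \<phi> f * g + f * rder \<phi> g"
proof (rule rps_eqI)
  fix x
  define A where "A = {a. rcoeff f a \<noteq> 0 \<and> a \<le> x}"
  have A: "finite A" unfolding A_def by (rule finite_rcoeff_le)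
  have le: "a \<in> A" if "rcoeff f a \<noteq> 0" "rcoeff g (x - a) \<noteq> 0" for a
    using that rcoeff_nonneg[OF that(2)] unfolding A_def by simp
  have "rcoeff (f * g) x = (\<Sum>a\<in>A. rcoeff f a * rcoeff g (x - a))"
    by (rule rcoeff_mult[OF A]) (use le in auto)
  moreover have "rcoeff (rder \<phi> f * g) x = (\<Sum>a\<in>A. rcoeff (rder \<phi> f) a * rcoeff g (x - a))"
    by (rule rcoeff_mult[OF A]) (use le in \<open>metis rder.rep_eq mult_zero_right\<close>)
  moreover have "rcoeff (f * rder \<phi> g) x = (\<Sum>a\<in>A. rcoeff f a * rcoeff (rder \<phi> g) (x - a))"
    by (rule rcoeff_mult[OF A]) (use le in \<open>metis rder.rep_eq mult_zero_right\<close>)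
  moreover have "\<phi> x = \<phi> a + \<phi> (x - a)" for a using \<phi>[of a "x - a"] by simp
  then have "\<phi> x * (rcoeff f a * rcoeff g (x - a)) =
      \<phi> a * rcoeff f a * rcoeff g (x - a) + rcoeff f a * (\<phi> (x - a) * rcoeff g (x - a))" for a
    by (metis (no_types, lifting) distrib_right mult.assoc mult.left_commute)
  ultimately show "rcoeff (rder \<phi> (f * g)) x = rcoeff (rder \<phi> f * g + f * rder \<phi> g) x"
    by (simp add: rder.rep_eq sum_distrib_left sum.distrib)
qed

lemma rder_power:
  assumes \<phi>: "\<And>x y. \<phi> (x + y) = \<phi> x + \<phi> y"
  shows "f * rder \<phi> (f ^ s) = of_nat s * f ^ s * rder \<phi> f"
proof (induction s)
  case 0
  have "rder \<phi> 1 = rder \<phi> 1 + rder \<phi> 1" using rder_mult[of \<phi> 1 1, OF \<phi>] by simp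
  then show ?case by simp
next
  case (Suc s)
  have "f * rder \<phi> (f ^ Suc s) = f * (rder \<phi> f * f ^ s + f * rder \<phi> (f ^ s))"
    using rder_mult[of \<phi> f "f ^ s", OF \<phi>] by simp
  also have "\<dots> = f ^ Suc s * rder \<phi> f + f * (f * rder \<phi> (f ^ s))" by (simp add: algebra_simps)
  also have "\<dots> = of_nat (Suc s) * f ^ Suc s * rder \<phi> f" unfolding Suc by (simp add: algebra_simps)
  finally show ?case .
qed

lemma rder_poly:
  assumes \<phi>: "\<And>x y. \<phi> (x + y) = \<phi> x + \<phi> y"
  shows "rder \<phi> (poly P y) = poly (map_poly (rder \<phi>) P) y + poly (pderiv P) y * rder \<phi> y"
proof (induction P)
  case (pCons a P)
  then show ?case
    by (simp add: map_poly_pCons pderiv_pCons rder_mult[OF \<phi>] algebra_simps)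
qed simp

lemma emb_wder:
  assumes W: "generic W" and l: "\<And>e. \<phi> (W \<bullet> rv e) = l e"
  shows "emb W (wder l h) = rder \<phi> (emb W h)"
  by (rule emb_eqI[OF W]) (auto simp: rder.rep_eq wder.rep_eq rcoeff_emb[OF W] l)

text \<open>
  The product of the operators \<open>rder \<phi> - \<mu>\<close>. On the term with exponent \<open>x\<close> it acts as the scalar
  \<open>\<Prod>(\<phi> x - \<mu>)\<close>; in particular it can be made to annihilate any given exponents.
\<close>

fun apply_ops :: "((real \<Rightarrow> 'a) \<times> 'a) list \<Rightarrow> 'a::comm_ring_1 rps \<Rightarrow> 'a rps" where
  "apply_ops [] y = y"
| "apply_ops ((\<phi>, \<mu>) # ps) y = rder \<phi> (apply_ops ps y) - rder (\<lambda>_. \<mu>) (apply_ops ps y)"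

lemma rcoeff_apply_ops: "rcoeff (apply_ops ps y) x = (\<Prod>(\<phi>, \<mu>)\<leftarrow>ps. \<phi> x - \<mu>) * rcoeff y x"
  by (induction ps y rule: apply_ops.induct) (auto simp: rder.rep_eq algebra_simps)

text \<open>
  A root \<open>y\<close> of \<open>f\<close> satisfies \<open>f'(y) \<delta>y = - (\<delta>f)(y)\<close> for a derivation \<open>\<delta>\<close>, where \<open>\<delta>f\<close> applies \<open>\<delta>\<close> to the
  coefficients. If \<open>D = A f + B f'\<close>, then \<open>D = B(y) f'(y)\<close>, so \<open>D \<delta>y\<close> is a polynomial in \<open>y\<close>. By
  iteration, applying \<open>s\<close> operators to \<open>y\<close> and multiplying by \<open>D\<^sup>s\<close> gives a polynomial in \<open>y\<close>, the
  numerator. It depends neither on the root nor on the weight, only on the operators on the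
  coefficients.
\<close>

fun ops_numerator :: "('a::idom, 's::finite) pps poly \<Rightarrow> ('a, 's) pps poly \<Rightarrow> ('a, 's) pps \<Rightarrow>
    ((rat ^ 's \<Rightarrow> 'a) \<times> 'a) list \<Rightarrow> ('a, 's) pps poly" where
  "ops_numerator f B D [] = [:0, 1:]"
| "ops_numerator f B D ((l, \<mu>) # ls) =
     [:D:] * map_poly (wder l) (ops_numerator f B D ls) - pderiv (ops_numerator f B D ls) * map_poly (wder l) f * B
     - [:of_nat (length ls) * wder l D:] * ops_numerator f B D ls - map_poly (wder (\<lambda>_. \<mu>)) ([:D:] * ops_numerator f B D ls)"

text \<open>
  The operator \<open>pm\<close> on series in \<open>T\<close> restricts to the operator \<open>lm\<close> on the coefficients of \<open>f\<close>.
\<close>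

definition ops_compat :: "real ^ 's::finite \<Rightarrow> (rat ^ 's \<Rightarrow> 'a::comm_ring_1) \<times> 'a \<Rightarrow> (real \<Rightarrow> 'a) \<times> 'a \<Rightarrow> bool" where
  "ops_compat W lm pm \<longleftrightarrow> (\<forall>x y. fst pm (x + y) = fst pm x + fst pm y) \<and>
     (\<forall>e. fst pm (W \<bullet> rv e) = fst lm e) \<and> snd lm = snd pm"

lemma ops_numerator_eval:
  fixes f B :: "('a::idom, 's::finite) pps poly"
  assumes W: "generic W" and D: "[:D:] = A * f + B * pderiv f"
    and y: "poly (map_poly (emb W) f) y = 0"
    and ps: "list_all2 (ops_compat W) ls ps"
  shows "apply_ops ps y * emb W D ^ length ls = poly (map_poly (emb W) (ops_numerator f B D ls)) y"
  using ps
proof (induction ls ps rule: list_all2_induct)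
  case Nil
  interpret e: inj_comm_ring_hom "emb W :: ('a, 's) pps \<Rightarrow> 'a rps" by (rule emb_hom[OF W])
  show ?case by (simp add: map_poly_pCons)
next
  case (Cons lm ls pm ps)
  obtain l \<mu> where lm: "lm = (l, \<mu>)" by (cases lm)
  obtain \<phi> where pm: "pm = (\<phi>, \<mu>)" using Cons(1) lm by (cases pm) (auto simp: ops_compat_def)
  have \<phi>: "\<phi> (x + y) = \<phi> x + \<phi> y" for x y using Cons(1) by (simp add: ops_compat_def pm)
  have l: "\<phi> (W \<bullet> rv e) = l e" for e using Cons(1) by (simp add: ops_compat_def pm lm)
  interpret e: inj_comm_ring_hom "emb W :: ('a, 's) pps \<Rightarrow> 'a rps" by (rule emb_hom[OF W])
  interpret ep: map_poly_inj_comm_ring_hom "emb W :: ('a, 's) pps \<Rightarrow> 'a rps" ..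
  define h where "h P = poly (map_poly (emb W) P) y" for P :: "('a, 's) pps poly"
  have h: "h (P * Q) = h P * h Q" "h (P - Q) = h P - h Q" "h (P + Q) = h P + h Q" "h [:c:] = emb W c"
    for P Q c unfolding h_def by (simp_all add: ep.hom_mult ep.hom_minus ep.hom_add e.map_poly_pCons_hom)
  define dy where "dy = rder \<phi> y"
  have r: "rder \<phi> (h P) = h (map_poly (wder l) P) + h (pderiv P) * dy" for P
  proof -
    have "map_poly (rder \<phi>) (map_poly (emb W) P) = map_poly (emb W) (map_poly (wder l) P)"
      by (rule poly_eqI) (simp add: coeff_map_poly emb_wder[OF W, of \<phi>, OF l])
    moreover have "pderiv (map_poly (emb W) P) = map_poly (emb W) (pderiv P)"
      by (rule poly_eqI) (simp add: coeff_map_poly coeff_pderiv e.hom_mult e.hom_of_nat flip: of_nat_Suc)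
    ultimately show ?thesis unfolding h_def rder_poly[OF \<phi>] dy_def by simp
  qed
  define G where "G = ops_numerator f B D ls"
  define z where "z = apply_ops ps y"
  define s where "s = length ls"
  define D' where "D' = emb W D"
  have IH: "z * D' ^ s = h G" using Cons unfolding z_def D'_def s_def h_def G_def by simp
  have hf: "h f = 0" unfolding h_def by (rule y)
  have D1: "D' = h B * h (pderiv f)"
  proof -
    have "h [:D:] = h (A * f + B * pderiv f)" unfolding D ..
    then show ?thesis unfolding D'_def by (simp only: h hf mult_zero_right add_0)
  qed
  have "h (map_poly (wder l) f) + h (pderiv f) * dy = 0"
    using r[of f] by (simp add: hf)
  then have "h (pderiv f) * dy = - h (map_poly (wder l) f)" by (metis add.inverse_unique minus_minus add.commute)
  then have D2: "D' * dy = - (h B * h (map_poly (wder l) f))"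
    unfolding D1 by (simp add: mult.assoc)
  have "rder \<phi> (h G) = rder \<phi> z * D' ^ s + z * rder \<phi> (D' ^ s)"
    unfolding IH[symmetric] by (rule rder_mult[OF \<phi>])
  then have "D' * rder \<phi> (h G) = D' * rder \<phi> z * D' ^ s + z * (D' * rder \<phi> (D' ^ s))"
    by (simp add: algebra_simps)
  also have "D' * rder \<phi> (D' ^ s) = of_nat s * D' ^ s * rder \<phi> D'" by (rule rder_power[OF \<phi>])
  finally have "D' * rder \<phi> z * D' ^ s = D' * rder \<phi> (h G) - of_nat s * (z * D' ^ s) * rder \<phi> D'"
    by (simp add: algebra_simps)
  also have "\<dots> = D' * h (map_poly (wder l) G) + h (pderiv G) * (D' * dy) - of_nat s * h G * rder \<phi> D'"
    unfolding r IH by (simp add: algebra_simps)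
  also have "rder \<phi> D' = emb W (wder l D)" unfolding D'_def by (rule emb_wder[OF W, of \<phi>, OF l, symmetric])
  finally have dz: "rder \<phi> z * D' ^ Suc s = D' * h (map_poly (wder l) G)
      - h (pderiv G) * (h B * h (map_poly (wder l) f)) - of_nat s * h G * emb W (wder l D)"
    unfolding D2 by (simp add: algebra_simps)
  have "rder (\<lambda>_. \<mu>) z * D' ^ Suc s = rmonom \<mu> 0 * (D' * h G)"
    unfolding rder_const IH[symmetric] by (simp add: algebra_simps)
  also have "\<dots> = rder (\<lambda>_. \<mu>) (h ([:D:] * G))" unfolding rder_const h D'_def ..
  also have "\<dots> = h (map_poly (wder (\<lambda>_. \<mu>)) ([:D:] * G))"
  proof -
    have "map_poly (emb W) (map_poly (wder (\<lambda>_. \<mu>)) P) = [:rmonom \<mu> 0:] * map_poly (emb W) P"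
      for P :: "('a, 's) pps poly"
      by (rule poly_eqI) (simp add: coeff_map_poly emb_wder[OF W, of "\<lambda>_. \<mu>"] rder_const)
    then show ?thesis unfolding h_def rder_const by simp
  qed
  finally have mz: "rder (\<lambda>_. \<mu>) z * D' ^ Suc s = h (map_poly (wder (\<lambda>_. \<mu>)) ([:D:] * G))" .
  have hG: "h (ops_numerator f B D (lm # ls)) = h [:D:] * h (map_poly (wder l) G) - h (pderiv G) * h (map_poly (wder l) f) * h B
      - h [:of_nat s * wder l D:] * h G - h (map_poly (wder (\<lambda>_. \<mu>)) ([:D:] * G))"
    by (simp only: lm ops_numerator.simps G_def[symmetric] s_def[symmetric] h(1,2))
  have "apply_ops (pm # ps) y * D' ^ Suc s = rder \<phi> z * D' ^ Suc s - rder (\<lambda>_. \<mu>) z * D' ^ Suc s"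
    unfolding pm apply_ops.simps z_def[symmetric] by (simp only: left_diff_distrib)
  also have "\<dots> = h (ops_numerator f B D (lm # ls))"
    unfolding dz mz hG h(4) e.hom_mult e.hom_of_nat D'_def[symmetric] by (simp only: ac_simps)
  finally show ?case unfolding h_def D'_def s_def by simp
qed

text \<open>
  The common grid of the exponents has to be carried through all constructions, since it bounds the
  denominators of the exponents of the roots.
\<close>

definition poly_supported :: "nat \<Rightarrow> ('a::zero, 's::finite) pps poly \<Rightarrow> bool" where
  "poly_supported k P \<longleftrightarrow> (\<forall>i. supported k (coeff P i))"

lemma supported_0: "supported k 0"
  unfolding supported_def zero_pps.rep_eq by simp

lemma supported_simps:
  fixes f :: "('a::comm_ring_1, 's::finite) pps"
  shows "supported k (0 :: ('a, 's) pps)" "supported k (1 :: ('a, 's) pps)"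
    "supported k f \<Longrightarrow> supported k (- f)" "supported k f \<Longrightarrow> supported k (wder l f)"
proof -
  have "pps_coeff f e \<noteq> 0" if "l e * pps_coeff f e \<noteq> 0" for e using that by force
  then show "supported k f \<Longrightarrow> supported k (wder l f)"
    unfolding supported_def by (auto simp: wder.rep_eq)
qed (auto simp: supported_def grid_zero split: if_splits)

lemma supported_diff: "supported k f \<Longrightarrow> supported k g \<Longrightarrow> supported k (f - g)"
  for f :: "('a::comm_ring_1, 's::finite) pps"
  using supported_add[of k f "- g"] supported_simps(3)[of k g] by simp

lemma supported_sum:
  "(\<And>i. i \<in> I \<Longrightarrow> supported k (f i)) \<Longrightarrow> supported k (\<Sum>i\<in>I. f i :: ('a::comm_ring_1, 's::finite) pps)"
  by (induction I rule: infinite_finite_induct) (auto simp: supported_simps supported_add)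

lemma supported_of_nat: "supported k (of_nat n :: ('a::comm_ring_1, 's::finite) pps)"
  by (induction n) (auto simp: supported_simps supported_add)

lemma poly_supported_simps:
  fixes P Q :: "('a::comm_ring_1, 's::finite) pps poly"
  assumes "k > 0"
  shows "poly_supported k P \<Longrightarrow> poly_supported k Q \<Longrightarrow> poly_supported k (P - Q)"
    "poly_supported k P \<Longrightarrow> poly_supported k Q \<Longrightarrow> poly_supported k (P * Q)"
    "poly_supported k P \<Longrightarrow> poly_supported k (map_poly (wder l) P)"
    "poly_supported k (pCons c P) \<longleftrightarrow> supported k c \<and> poly_supported k P"
    "poly_supported k 0" "poly_supported k 1"
  using assms unfolding poly_supported_def
  by (auto simp: supported_diff coeff_mult coeff_map_poly supported_simps coeff_pCons
      intro!: supported_sum supported_mult supported_0 split: nat.splits)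

lemma poly_supported_pderiv:
  fixes P :: "('a::idom, 's::finite) pps poly"
  shows "k > 0 \<Longrightarrow> poly_supported k P \<Longrightarrow> poly_supported k (pderiv P)"
  unfolding poly_supported_def by (auto simp: coeff_pderiv intro!: supported_mult supported_of_nat simp del: of_nat_Suc)

lemma poly_supported_power:
  fixes P :: "('a::comm_ring_1, 's::finite) pps poly"
  shows "k > 0 \<Longrightarrow> poly_supported k P \<Longrightarrow> poly_supported k (P ^ r)"
  by (induction r) (auto simp: poly_supported_simps)

lemma poly_supported_ops_numerator:
  assumes "k > 0" "poly_supported k f" "poly_supported k B" "supported k D"
  shows "poly_supported k (ops_numerator f B D ls)"
proof (induction ls)
  case Nil
  show ?case using assms(1) by (simp add: poly_supported_simps supported_simps)
next
  case (Cons lm ls)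
  obtain l \<mu> where lm: "lm = (l, \<mu>)" by (cases lm)
  show ?case unfolding lm ops_numerator.simps
    by (intro poly_supported_simps(1-3) poly_supported_pderiv assms Cons)
       (use assms in \<open>auto simp: poly_supported_simps supported_simps supported_of_nat intro!: supported_mult\<close>)
qed

lemma common_support_finite:
  assumes "finite S"
  shows "\<exists>k>0. \<forall>h\<in>S. supported k h"
  using assms
proof (induction S rule: finite_induct)
  case empty
  then show ?case by auto
next
  case (insert h S)
  then obtain k l where "k > 0" "\<forall>h\<in>S. supported k h" "l > 0" "supported l h"
    using supported_ex[of h] by blast
  then have "k * l > 0 \<and> (\<forall>h\<in>insert h S. supported (k * l) h)"
    unfolding supported_def by (auto intro: grid_mult_right grid_mult_left)
  then show ?case by blast
qed

lemma grid_diff: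
  assumes "a \<in> grid k" "b \<in> grid k" "a \<le> b"
  shows "b - a \<in> grid k"
  unfolding grid_def
proof (intro CollectI allI)
  fix i
  obtain m n :: nat where mn: "a $ i = of_nat m / of_nat k" "b $ i = of_nat n / of_nat k"
    using assms unfolding grid_def by blast
  show "\<exists>m::nat. (b - a) $ i = of_nat m / of_nat k"
  proof (cases "k = 0")
    case False
    have "a $ i \<le> b $ i" using assms(3) by (simp add: cart_le_iff)
    then have "m \<le> n" unfolding mn using False by (simp add: divide_le_cancel)
    then have "(b - a) $ i = of_nat (n - m) / of_nat k" using mn by (simp add: of_nat_diff diff_divide_distrib)
    then show ?thesis by blast
  qed (use mn in simp)
qed

lemma grid_scale:
  assumes "a \<in> grid k"
  shows "of_nat m *s a \<in> grid k"
  unfolding grid_def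
proof (intro CollectI allI)
  fix i
  obtain n :: nat where "a $ i = of_nat n / of_nat k" using assms unfolding grid_def by blast
  then have "(of_nat m *s a) $ i = of_nat (m * n) / of_nat k" by simp
  then show "\<exists>m'::nat. (of_nat m *s a) $ i = of_nat m' / of_nat k" by blast
qed

lemma grid_divide:
  assumes "a \<in> grid k" "r \<in> {1..n}"
  shows "(1 / of_nat r) *s a \<in> grid (k * fact n)"
  unfolding grid_def
proof (intro CollectI allI)
  fix i
  obtain m :: nat where m: "a $ i = of_nat m / of_nat k" using assms unfolding grid_def by blast
  have "r dvd fact n" using assms by (intro dvd_fact) auto
  then obtain q where q: "fact n = r * q" by (elim dvdE)
  have "q \<noteq> 0" using q by (metis fact_nonzero mult_zero_right)
  then have "((1 / of_nat r) *s a) $ i = of_nat (m * q) / of_nat (k * fact n)"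
    unfolding q by (simp add: m)
  then show "\<exists>m::nat. ((1 / of_nat r) *s a) $ i = of_nat m / of_nat (k * fact n)" by blast
qed

lemma rcoeff_power_lead:
  fixes f :: "'a::comm_ring_1 rps"
  assumes "\<And>x. x < a \<Longrightarrow> rcoeff f x = 0"
  shows "rcoeff (f ^ r) (real r * a) = rcoeff f a ^ r \<and> (\<forall>x < real r * a. rcoeff (f ^ r) x = 0)"
proof (induction r)
  case 0
  then show ?case by auto
next
  case (Suc r)
  have e: "real (Suc r) * a = a + real r * a" by (simp add: algebra_simps)
  show ?case unfolding e power_Suc
    using rcoeff_mult_lead[of a f "real r * a" "f ^ r"] assms Suc by simp
qed

text \<open>
  The Abhyankar-Jung theorem. For a generic weight \<open>W\<close> let \<open>y i\<close> be the roots after the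
  substitution, and let \<open>x\<close> be an exponent of some of them. There is a product of \<open>s\<close> operators
  \<open>rder \<phi> - \<mu>\<close> that annihilates all smaller exponents of all roots but not \<open>x\<close>; the transformed
  roots \<open>z i\<close> then have order at least \<open>x\<close>, and for some \<open>r \<le> n\<close> the sum of the \<open>(z i)\<^sup>r\<close> has order
  exactly \<open>r x\<close>. Multiplied by \<open>D\<^bsup>s r\<^esup>\<close> this power sum is the image of a series \<open>\<beta>\<close> in the original
  variables, and the same \<open>\<beta>\<close> serves for every weight. Since the transformed roots have
  nonnegative order for every weight, all exponents of \<open>\<beta>\<close> are componentwise at least \<open>s r a\<close>, the
  exponent of \<open>D\<^bsup>s r\<^esup>\<close>. The lowest exponent \<open>e\<close> of \<open>\<beta>\<close> for \<open>W\<close> satisfies \<open>r x = W \<bullet> (e - s r a)\<close>, so \<open>x\<close> is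
  the weight of the nonnegative exponent \<open>(e - s r a) / r\<close>. Therefore the \<open>y i\<close> come from
  fractional power series.
\<close>

theorem abhyankar_jung:
  fixes f :: "('a::{alg_closed_field, field_char_0}, 's::finite) pps poly"
  assumes f: "lead_coeff f = 1" "degree f \<ge> 1"
    and disc: "resultant f (pderiv f) = X_pow a * u" and a: "0 \<le> a" and u: "const_coeff u \<noteq> 0"
  shows "\<exists>Y. f = (\<Prod>i<degree f. [:- Y i, 1:])"
proof -
  define n where "n = degree f"
  define D where "D = resultant f (pderiv f)"
  obtain A B where D: "[:D:] = A * f + B * pderiv f"
    using resultant_in_ideal[of f "pderiv f"] f unfolding D_def by auto
  obtain k where k: "k > 0" "poly_supported k f" "poly_supported k B" "supported k D"
  proof -
    have "finite (insert D (coeff f ` {..degree f} \<union> coeff B ` {..degree B}))" by simp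
    from common_support_finite[OF this] obtain k where
      k: "k > 0" "\<forall>h\<in>insert D (coeff f ` {..degree f} \<union> coeff B ` {..degree B}). supported k h" by blast
    then have "supported k (coeff f i)" "supported k (coeff B i)" for i
      using coeff_eq_0[of f i] coeff_eq_0[of B i] supported_0
      by (cases "i \<le> degree f"; cases "i \<le> degree B"; force)+
    then show ?thesis using that k unfolding poly_supported_def by auto
  qed
  have aD: "pps_coeff D a \<noteq> 0"
    unfolding D_def disc using u by (simp add: pps_coeff_X_pow_mult[OF a])
  have ak: "a \<in> grid k" using k(4) aD unfolding supported_def by blast
  have ordD: "rcoeff (emb W D) (W \<bullet> rv a) \<noteq> 0" "x < W \<bullet> rv a \<Longrightarrow> rcoeff (emb W D) x = 0"
    if W: "generic W" for W x
  proof -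
    show "rcoeff (emb W D) (W \<bullet> rv a) \<noteq> 0" using aD by (simp add: rcoeff_emb[OF W])
    have "rord (emb W D) = W \<bullet> rv a" unfolding D_def disc by (rule rord_emb_monomial_unit[OF W u a])
    then show "x < W \<bullet> rv a \<Longrightarrow> rcoeff (emb W D) x = 0"
      using rord_props(2)[of "emb W D" x] by (cases "emb W D = 0") auto
  qed
  \<comment> \<open>The trace formula makes the power sums of the transformed roots independent of the weight.\<close>
  have trace: "\<exists>\<beta>. supported k \<beta> \<and> (\<forall>W ps y. generic W \<longrightarrow> list_all2 (ops_compat W) ls ps \<longrightarrow>
      map_poly (emb W) f = (\<Prod>i<n. [:- y i, 1:]) \<longrightarrow>
      emb W \<beta> = emb W D ^ (length ls * r) * (\<Sum>i<n. apply_ops ps (y i) ^ r))" for ls r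
  proof -
    define H where "H = ops_numerator f B D ls ^ r"
    have H: "poly_supported k H" unfolding H_def
      using poly_supported_power[OF k(1) poly_supported_ops_numerator[OF k]] .
    then have Hf: "poly_supported k (H * pderiv f)"
      using poly_supported_simps(2)[OF k(1)] poly_supported_pderiv[OF k(1,2)] by blast
    obtain Q R where QR: "H * pderiv f = Q * f + R" "degree R < degree f" "\<And>i. supported k (coeff R i)"
      using monic_division[OF f, of "{h. supported k h}" "H * pderiv f"] k(2) Hf
      unfolding poly_supported_def by (auto simp: supported_0 supported_diff supported_mult[OF k(1)])
    have "emb W (coeff R (n - 1)) = emb W D ^ (length ls * r) * (\<Sum>i<n. apply_ops ps (y i) ^ r)"
      if W: "generic W" and ps: "list_all2 (ops_compat W) ls ps"
        and y: "map_poly (emb W) f = (\<Prod>i<n. [:- y i, 1:])" for W ps y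
    proof -
      interpret e: inj_comm_ring_hom "emb W :: ('a, 's) pps \<Rightarrow> 'a rps" by (rule emb_hom[OF W])
      interpret ep: map_poly_inj_comm_ring_hom "emb W :: ('a, 's) pps \<Rightarrow> 'a rps" ..
      have dp: "map_poly (emb W) (pderiv f) = pderiv (map_poly (emb W) f)"
        by (rule poly_eqI) (simp add: coeff_map_poly coeff_pderiv e.hom_mult e.hom_of_nat flip: of_nat_Suc)
      have "map_poly (emb W) H * pderiv (map_poly (emb W) f) =
          map_poly (emb W) Q * map_poly (emb W) f + map_poly (emb W) R"
        using arg_cong[OF QR(1), of "map_poly (emb W)"] by (simp add: ep.hom_mult ep.hom_add dp)
      moreover have "degree (map_poly (emb W) R) < card {..<n}" using QR(2) by (simp add: n_def)
      moreover have "{..<n} \<noteq> {}" using f by (simp add: n_def lessThan_empty_iff)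
      ultimately have "coeff (map_poly (emb W) R) (card {..<n} - 1) = (\<Sum>i<n. poly (map_poly (emb W) H) (y i))"
        using y by (intro sum_over_roots_coeff_remainder[of "{..<n}"]) auto
      then have "emb W (coeff R (n - 1)) = (\<Sum>i<n. poly (map_poly (emb W) H) (y i))"
        by (simp add: coeff_map_poly)
      also have "\<dots> = (\<Sum>i<n. emb W D ^ (length ls * r) * apply_ops ps (y i) ^ r)"
      proof (rule sum.cong[OF refl])
        fix i assume "i \<in> {..<n}"
        then have "poly (map_poly (emb W) f) (y i) = 0" unfolding y by (auto simp: poly_prod)
        note ev = ops_numerator_eval[OF W D this ps, symmetric]
        show "poly (map_poly (emb W) H) (y i) = emb W D ^ (length ls * r) * apply_ops ps (y i) ^ r"
          unfolding H_def ep.hom_power poly_power ev power_mult_distrib power_mult by (rule mult.commute)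
      qed
      finally show ?thesis by (simp add: sum_distrib_left)
    qed
    then show ?thesis using QR(3) by blast
  qed
  have split: "\<exists>y. map_poly (emb W) f = (\<Prod>i<n. [:- y i, 1:])" if W: "generic W" for W
  proof -
    interpret e: inj_comm_ring_hom "emb W :: ('a, 's) pps \<Rightarrow> 'a rps" by (rule emb_hom[OF W])
    have "lead_coeff (map_poly (emb W) f) = 1" using f by (simp add: coeff_map_poly)
    from splits_indexed[OF monic_rps_poly_splits[OF this]] show ?thesis by (simp add: n_def)
  qed
  obtain W :: "real ^ 's" where W: "generic W" using generic_exists by blast
  interpret e: inj_comm_ring_hom "emb W :: ('a, 's) pps \<Rightarrow> 'a rps" by (rule emb_hom[OF W])
  interpret ep: map_poly_inj_comm_ring_hom "emb W :: ('a, 's) pps \<Rightarrow> 'a rps" ..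
  obtain y where y: "map_poly (emb W) f = (\<Prod>i<n. [:- y i, 1:])" using split[OF W] by blast
  have expo: "\<exists>e. x = W \<bullet> rv e \<and> e \<in> grid (k * fact n)" if j: "j < n" and x: "rcoeff (y j) x \<noteq> 0" for j x
  proof -
    define Z where "Z = (\<Union>i<n. {z. rcoeff (y i) z \<noteq> 0 \<and> z \<le> x}) - {x}"
    have "finite Z" unfolding Z_def by (auto intro: finite_rcoeff_le)
    then obtain zs where zs: "set zs = Z" using finite_list by blast
    have "\<exists>\<phi> :: real \<Rightarrow> 'a. (\<forall>a b. \<phi> (a + b) = \<phi> a + \<phi> b) \<and> (z \<noteq> x \<longrightarrow> \<phi> (x - z) \<noteq> 0)" for z
      using additive_separating[of "x - z"] by (cases "z = x") (auto intro: exI[of _ "\<lambda>_. 0"])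
    then obtain \<phi> :: "real \<Rightarrow> real \<Rightarrow> 'a" where
      \<phi>: "\<And>z a b. \<phi> z (a + b) = \<phi> z a + \<phi> z b" "\<And>z. z \<noteq> x \<Longrightarrow> \<phi> z (x - z) \<noteq> 0" by metis
    have \<phi>x: "\<phi> z x - \<phi> z z \<noteq> 0" if "z \<noteq> x" for z
      using \<phi>(1)[of z "x - z" z] \<phi>(2)[OF that] by simp
    \<comment> \<open>The factor for \<open>z\<close> kills the exponent \<open>z\<close> and, by the choice of \<open>\<phi> z\<close>, not \<open>x\<close>.\<close>
    define ps where "ps = map (\<lambda>z. (\<phi> z, \<phi> z z)) zs"
    define ls where "ls = map (\<lambda>z. (\<lambda>e. \<phi> z (W \<bullet> rv e), \<phi> z z)) zs"
    define s where "s = length ls"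
    have compat: "list_all2 (ops_compat W) ls ps"
      unfolding ps_def ls_def by (auto simp: list_all2_map1 list_all2_map2 ops_compat_def \<phi> intro: list_all2_refl)
    define \<kappa> where "\<kappa> = (\<Prod>z\<leftarrow>zs. \<phi> z x - \<phi> z z)"
    have \<kappa>: "\<kappa> \<noteq> 0" unfolding \<kappa>_def using zs \<phi>x by (auto simp: prod_list_zero_iff Z_def)
    have opx: "rcoeff (apply_ops ps (y i)) x = \<kappa> * rcoeff (y i) x" for i
      unfolding rcoeff_apply_ops ps_def \<kappa>_def by (simp add: o_def)
    have op0: "rcoeff (apply_ops ps (y i)) z = 0" if "i < n" "z < x" for i z
    proof (cases "rcoeff (y i) z = 0")
      case False
      then have "z \<in> set zs" using that unfolding zs Z_def by auto
      then have "(\<Prod>z'\<leftarrow>zs. \<phi> z' z - \<phi> z' z') = 0" by (auto simp: prod_list_zero_iff)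
      then show ?thesis unfolding rcoeff_apply_ops ps_def by (simp add: o_def)
    qed (simp add: rcoeff_apply_ops)
    define c where "c i = rcoeff (apply_ops ps (y i)) x" for i
    have "c j \<noteq> 0" unfolding c_def opx using \<kappa> x by simp
    with power_sum_nonzero[of "{..<n}" j c] j obtain r where
      r: "r \<in> {1..n}" "(\<Sum>i<n. c i ^ r) \<noteq> 0" by auto
    obtain \<beta> where \<beta>: "supported k \<beta>" "\<And>W ps y. generic W \<Longrightarrow> list_all2 (ops_compat W) ls ps \<Longrightarrow>
      map_poly (emb W) f = (\<Prod>i<n. [:- y i, 1:]) \<Longrightarrow>
      emb W \<beta> = emb W D ^ (s * r) * (\<Sum>i<n. apply_ops ps (y i) ^ r)"
      using trace[of ls r] unfolding s_def by blast
    define b where "b = of_nat (s * r) *s a"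
    have Dsr: "rcoeff (emb W D ^ (s * r)) (W \<bullet> rv b) \<noteq> 0" "z < W \<bullet> rv b \<Longrightarrow> rcoeff (emb W D ^ (s * r)) z = 0"
      if W: "generic W" for W z
      using rcoeff_power_lead[of "W \<bullet> rv a" "emb W D" "s * r"] ordD[OF W]
      by (simp_all add: b_def flip: of_nat_mult)
    \<comment> \<open>The bound is checked with an arbitrary weight \<open>W'\<close>, its own roots, and the extensions to series in
      \<open>T\<close> of the same operators on the coefficients.\<close>
    have ge: "b \<le> e" if e: "pps_coeff \<beta> e \<noteq> 0" for e
    proof (rule le_if_generic_le, rule ccontr)
      fix W' :: "real ^ 's" assume W': "generic W'" and less: "\<not> W' \<bullet> rv b \<le> W' \<bullet> rv e"
      obtain y' where y': "map_poly (emb W') f = (\<Prod>i<n. [:- y' i, 1:])" using split[OF W'] by blast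
      have "\<exists>\<psi>. ops_compat W' lm (\<psi>, snd lm)" if "lm \<in> set ls" for lm
        using that additive_extension[OF W', of "fst lm"] unfolding ls_def ops_compat_def
        by (auto simp: \<phi> inner_add_right)
      then obtain \<psi> where "\<And>lm. lm \<in> set ls \<Longrightarrow> ops_compat W' lm (\<psi> lm, snd lm)" by metis
      then have "list_all2 (ops_compat W') ls (map (\<lambda>lm. (\<psi> lm, snd lm)) ls)"
        by (simp add: list_all2_map2 list_all2_same)
      from \<beta>(2)[OF W' this y'] have "rcoeff (emb W' \<beta>) (W' \<bullet> rv e) = 0"
        using rcoeff_mult_lead(2)[of "W' \<bullet> rv b" "emb W' D ^ (s * r)" 0] Dsr(2)[OF W'] less
        by (simp add: rcoeff_neg)
      then show False using e by (simp add: rcoeff_emb[OF W'])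
    qed
    have lead: "rcoeff (\<Sum>i<n. apply_ops ps (y i) ^ r) (real r * x) = (\<Sum>i<n. c i ^ r)"
      "z < real r * x \<Longrightarrow> rcoeff (\<Sum>i<n. apply_ops ps (y i) ^ r) z = 0" for z
      using rcoeff_power_lead[of x "apply_ops ps (y _)" r] op0 unfolding rcoeff_sum c_def
      by (auto intro!: sum.neutral sum.cong)
    have "rcoeff (emb W \<beta>) (W \<bullet> rv b + real r * x) \<noteq> 0"
      unfolding \<beta>(2)[OF W compat y]
      using rcoeff_mult_lead(1)[of "W \<bullet> rv b" "emb W D ^ (s * r)" "real r * x" "\<Sum>i<n. apply_ops ps (y i) ^ r"]
        Dsr[OF W] lead r(2) by simp
    then obtain e where e: "W \<bullet> rv b + real r * x = W \<bullet> rv e" "pps_coeff \<beta> e \<noteq> 0"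
      by (rule emb_nonzeroE[OF W])
    have "e \<in> grid k" using \<beta>(1) e(2) unfolding supported_def by blast
    then have "e - b \<in> grid k" using grid_diff[of b k e] ge[OF e(2)] grid_scale[OF ak] unfolding b_def by blast
    then have "(1 / of_nat r) *s (e - b) \<in> grid (k * fact n)" using r(1) by (rule grid_divide)
    moreover have "x = W \<bullet> rv ((1 / of_nat r) *s (e - b))"
      using e(1) r(1) by (simp add: inner_diff_right of_rat_divide field_simps)
    ultimately show ?thesis by blast
  qed
  have "\<exists>Y. emb W Y = y i" if i: "i < n" for i
  proof -
    define c where "c e = rcoeff (y i) (W \<bullet> rv e)" for e
    have "e \<in> grid (k * fact n)" if "c e \<noteq> 0" for e
      using expo[OF i, of "W \<bullet> rv e"] that generic_eq[OF W] unfolding c_def by metis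
    then have "pps_coeff (Abs_pps c) = c"
      using k(1) by (intro Abs_pps_inverse CollectI exI[of _ "k * fact n"]) auto
    then have "emb W (Abs_pps c) = y i"
      using expo[OF i] by (intro emb_eqI[OF W]) (auto simp: c_def)
    then show ?thesis by blast
  qed
  then obtain Y where Y: "\<And>i. i < n \<Longrightarrow> emb W (Y i) = y i" by metis
  have "map_poly (emb W) (\<Prod>i<n. [:- Y i, 1:]) = (\<Prod>i<n. [:- y i, 1:])"
    unfolding ep.hom_prod using Y by (intro prod.cong) (auto simp: e.map_poly_pCons_hom e.hom_uminus)
  then have "f = (\<Prod>i<n. [:- Y i, 1:])" using y ep.injectivity by metis
  then show ?thesis unfolding n_def by blast
qed

section \<open>Contacts and bars\<close>

text \<open>
  A monomial times a unit is a series whose support has a least element in the componentwise order.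
\<close>

lemma has_contact_iff:
  fixes y z :: "('a::idom, 'd::finite) pps"
  shows "has_contact y z l \<longleftrightarrow>
    pps_coeff (y - z) l \<noteq> 0 \<and> (\<forall>e. pps_coeff (y - z) e \<noteq> 0 \<longrightarrow> l \<le> e)"
proof
  assume "has_contact y z l"
  then obtain u where l: "0 \<le> l" "const_coeff u \<noteq> 0" "y - z = X_pow l * u"
    unfolding has_contact_def by blast
  have "l \<le> e" if "pps_coeff (X_pow l * u) e \<noteq> 0" for e
    using that pps_coeff_nonneg[of u "e - l"] l(1)
    by (auto simp: pps_coeff_X_pow_mult cart_le_iff)
  then show "pps_coeff (y - z) l \<noteq> 0 \<and> (\<forall>e. pps_coeff (y - z) e \<noteq> 0 \<longrightarrow> l \<le> e)"
    unfolding l(3) using l(1,2) by (auto simp: pps_coeff_X_pow_mult)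
next
  assume l: "pps_coeff (y - z) l \<noteq> 0 \<and> (\<forall>e. pps_coeff (y - z) e \<noteq> 0 \<longrightarrow> l \<le> e)"
  then have "0 \<le> l" using pps_coeff_nonneg by blast
  with l show "has_contact y z l" unfolding has_contact_def using X_pow_dvdI[of "y - z" l] by auto
qed

locale contact_set =
  fixes S :: "('a::idom, 'd::finite) pps set"
  assumes fin: "finite S" and nonempty: "S \<noteq> {}"
    and contact_ex: "y \<in> S \<Longrightarrow> z \<in> S \<Longrightarrow> y \<noteq> z \<Longrightarrow> \<exists>l. has_contact y z l"
begin

text \<open>
  The value of \<open>contact y z\<close> for distinct members of \<open>S\<close>.
\<close>

definition lam :: "('a, 'd) pps \<Rightarrow> ('a, 'd) pps \<Rightarrow> rat ^ 'd" where
  "lam y z = (THE l. has_contact y z l)"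

lemma has_contact_lam:
  assumes "y \<in> S" "z \<in> S" "y \<noteq> z"
  shows "has_contact y z (lam y z)"
proof -
  obtain l where l: "has_contact y z l" using contact_ex[OF assms] by blast
  have "l' = l" if "has_contact y z l'" for l'
    using l that unfolding has_contact_iff by (meson antisym)
  then show ?thesis unfolding lam_def by (rule theI[of "has_contact y z", OF l])
qed

lemma contact_lam: "y \<noteq> z \<Longrightarrow> contact y z = Fin (lam y z)"
  by (simp add: contact_def lam_def)

lemma lam_supp: "y \<in> S \<Longrightarrow> z \<in> S \<Longrightarrow> y \<noteq> z \<Longrightarrow> pps_coeff (y - z) (lam y z) \<noteq> 0"
  and lam_le: "y \<in> S \<Longrightarrow> z \<in> S \<Longrightarrow> y \<noteq> z \<Longrightarrow> pps_coeff (y - z) e \<noteq> 0 \<Longrightarrow> lam y z \<le> e"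
  using has_contact_lam unfolding has_contact_iff by blast+

lemma lam_commute: "y \<in> S \<Longrightarrow> z \<in> S \<Longrightarrow> lam y z = lam z y"
proof (cases "y = z")
  case False
  assume yz: "y \<in> S" "z \<in> S"
  have "pps_coeff (y - z) e \<noteq> 0 \<longleftrightarrow> pps_coeff (z - y) e \<noteq> 0" for e by auto
  then show ?thesis using lam_supp lam_le yz False by (metis antisym)
qed simp

lemma lam_ultrametric:
  assumes S: "x \<in> S" "y \<in> S" "z \<in> S" and ne: "x \<noteq> y" "y \<noteq> z" "x \<noteq> z"
    and l: "l \<le> lam x y" "l \<le> lam y z"
  shows "l \<le> lam x z"
proof -
  have "pps_coeff (x - y) (lam x z) + pps_coeff (y - z) (lam x z) \<noteq> 0"
    using lam_supp[OF S(1,3) ne(3)] by simp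
  then have "pps_coeff (x - y) (lam x z) \<noteq> 0 \<or> pps_coeff (y - z) (lam x z) \<noteq> 0" by auto
  then show ?thesis using lam_le S ne l by (meson order_trans)
qed

text \<open>
  If the contacts of \<open>x\<close>, \<open>y\<close> and of \<open>y\<close>, \<open>z\<close> were incomparable, both would be exponents of
  \<open>x - z = (x - y) + (y - z)\<close>, where no cancellation can occur at them. But this difference has a
  least exponent; it would lie below both, and also above one of them, being an exponent of a summand.
\<close>

lemma lam_comparable:
  assumes S: "x \<in> S" "y \<in> S" "z \<in> S" and ne: "x \<noteq> y" "y \<noteq> z"
  shows "lam x y \<le> lam y z \<or> lam y z \<le> lam x y"
proof (cases "x = z")
  case True
  then show ?thesis using lam_commute[OF S(1,2)] by simp
next
  case xz: False
  have sum: "pps_coeff (x - z) e = pps_coeff (x - y) e + pps_coeff (y - z) e" for e by simp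
  show ?thesis
  proof (rule ccontr)
    assume not: "\<not> ?thesis"
    have "pps_coeff (y - z) (lam x y) = 0" using lam_le[OF S(2,3) ne(2)] not by blast
    then have "pps_coeff (x - z) (lam x y) \<noteq> 0" unfolding sum using lam_supp[OF S(1,2) ne(1)] by simp
    then have 1: "lam x z \<le> lam x y" using lam_le[OF S(1,3) xz] by blast
    have "pps_coeff (x - y) (lam y z) = 0" using lam_le[OF S(1,2) ne(1)] not by blast
    then have "pps_coeff (x - z) (lam y z) \<noteq> 0" unfolding sum using lam_supp[OF S(2,3) ne(2)] by simp
    then have 2: "lam x z \<le> lam y z" using lam_le[OF S(1,3) xz] by blast
    have "pps_coeff (x - y) (lam x z) \<noteq> 0 \<or> pps_coeff (y - z) (lam x z) \<noteq> 0"
      using lam_supp[OF S(1,3) xz] unfolding sum by auto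
    then have "lam x y \<le> lam x z \<or> lam y z \<le> lam x z"
      using lam_le S ne by blast
    then show False using 1 2 not by (metis order_trans)
  qed
qed

lemma height_singleton: "height {y :: ('a, 'd) pps} = Pinf"
  unfolding height_def by (rule Least_equality) (auto simp: contact_def)

text \<open>
  A pair \<open>y0\<close>, \<open>z0\<close> whose contact has least weight realizes the minimum in the componentwise order:
  contacts of pairs that share \<open>y0\<close> are comparable, and the ultrametric inequality passes through \<open>y0\<close>
  to all other pairs.
\<close>

lemma height_props:
  assumes B: "B \<subseteq> S" and two: "x \<in> B" "x' \<in> B" "x \<noteq> x'"
  shows "\<exists>y0\<in>B. \<exists>z0\<in>B. y0 \<noteq> z0 \<and> height B = Fin (lam y0 z0) \<and>
    (\<forall>y\<in>B. \<forall>z\<in>B. y \<noteq> z \<longrightarrow> lam y0 z0 \<le> lam y z)"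
proof -
  obtain W :: "real ^ 'd" where W: "generic W" using generic_exists by blast
  define P where "P = {(y, z). y \<in> B \<and> z \<in> B \<and> y \<noteq> z}"
  have "P \<subseteq> S \<times> S" using B unfolding P_def by auto
  then have "finite P" using fin finite_subset by blast
  moreover have "P \<noteq> {}" using two unfolding P_def by auto
  ultimately obtain p where p: "p \<in> P" "\<And>p'. p' \<in> P \<Longrightarrow>
      W \<bullet> rv (lam (fst p) (snd p)) \<le> W \<bullet> rv (lam (fst p') (snd p'))"
    using ex_min_if_finite[of "(\<lambda>p. W \<bullet> rv (lam (fst p) (snd p))) ` P"]
    by (metis (no_types, lifting) finite_imageI image_iff image_is_empty not_le)
  obtain y0 z0 where yz: "p = (y0, z0)" by (cases p)
  have y0: "y0 \<in> B" "z0 \<in> B" "y0 \<noteq> z0" using p(1) unfolding yz P_def by auto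
  have min: "W \<bullet> rv (lam y0 z0) \<le> W \<bullet> rv (lam y z)" if "y \<in> B" "z \<in> B" "y \<noteq> z" for y z
    using p(2)[of "(y, z)"] that unfolding yz P_def by simp
  have le0: "lam y0 z0 \<le> lam y0 y" if y: "y \<in> B" "y \<noteq> y0" for y
  proof -
    have "lam z0 y0 \<le> lam y0 y \<or> lam y0 y \<le> lam z0 y0"
      using lam_comparable[of z0 y0 y] y0 y B by auto
    then have "lam y0 z0 \<le> lam y0 y \<or> lam y0 y < lam y0 z0"
      unfolding lam_commute[OF subsetD[OF B y0(1)] subsetD[OF B y0(2)]] by (auto simp: less_le)
    then show ?thesis using inner_rv_strict_mono[OF W] min[of y0 y] y y0 by fastforce
  qed
  have le: "lam y0 z0 \<le> lam y z" if yz: "y \<in> B" "z \<in> B" "y \<noteq> z" for y z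
  proof (cases "y = y0 \<or> z = y0")
    case True
    then show ?thesis using le0[of z] le0[of y] yz lam_commute[OF subsetD[OF B yz(1)] subsetD[OF B yz(2)]] by auto
  next
    case False
    then show ?thesis using lam_ultrametric[of y y0 z "lam y0 z0"] le0[of z] le0[of y] yz B y0
        lam_commute[OF subsetD[OF B yz(1)] subsetD[OF B y0(1)]] by auto
  qed
  have "height B = Fin (lam y0 z0)" unfolding height_def
  proof (rule Least_equality)
    show "\<exists>y\<in>B. \<exists>z\<in>B. Fin (lam y0 z0) = contact y z"
      using y0 contact_lam[of y0 z0] by metis
    fix c assume "\<exists>y\<in>B. \<exists>z\<in>B. c = contact y z"
    then obtain y z where c: "y \<in> B" "z \<in> B" "c = contact y z" by blast
    then show "Fin (lam y0 z0) \<le> c"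
      using le[of y z] contact_lam[of y z] by (cases "y = z") (auto simp: contact_def)
  qed
  then show ?thesis using y0 le by blast
qed

lemma height_Fin_iff:
  assumes B: "B \<subseteq> S" "B \<noteq> {}"
  shows "height B \<noteq> Pinf \<longleftrightarrow> card B \<ge> 2"
proof -
  have "finite B" using B fin finite_subset by blast
  show ?thesis
  proof (cases "\<exists>x\<in>B. \<exists>x'\<in>B. x \<noteq> x'")
    case True
    then obtain x x' where x: "x \<in> B" "x' \<in> B" "x \<noteq> x'" by blast
    have "card {x, x'} \<le> card B" using x \<open>finite B\<close> by (intro card_mono) auto
    then show ?thesis using height_props[OF B(1) x] x by auto
  next
    case False
    then obtain x where "B = {x}" using B by blast
    then show ?thesis using height_singleton by simp
  qed
qed

lemma height_cases:
  assumes B: "B \<subseteq> S" "B \<noteq> {}"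
  obtains (Fin) h where "height B = Fin h" | (Pinf) "height B = Pinf"
proof (cases "height B = Pinf")
  case False
  have "\<exists>x\<in>B. \<exists>x'\<in>B. x \<noteq> x'"
  proof (rule ccontr)
    assume "\<not> ?thesis"
    then obtain x where "B = {x}" using B by blast
    then show False using False height_singleton by simp
  qed
  then show thesis using height_props[OF B(1)] Fin by blast
qed (use Pinf in blast)

lemma height_Fin_props:
  assumes B: "B \<subseteq> S" "B \<noteq> {}" and h: "height B = Fin h"
  shows "\<exists>y0\<in>B. \<exists>z0\<in>B. y0 \<noteq> z0 \<and> h = lam y0 z0"
    and "y \<in> B \<Longrightarrow> z \<in> B \<Longrightarrow> y \<noteq> z \<Longrightarrow> h \<le> lam y z"
proof -
  have "\<exists>x\<in>B. \<exists>x'\<in>B. x \<noteq> x'"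
  proof (rule ccontr)
    assume "\<not> ?thesis"
    then obtain x where "B = {x}" using B by blast
    then show False using h height_singleton by simp
  qed
  then obtain x x' where "x \<in> B" "x' \<in> B" "x \<noteq> x'" by blast
  from height_props[OF B(1) this] h
  show "\<exists>y0\<in>B. \<exists>z0\<in>B. y0 \<noteq> z0 \<and> h = lam y0 z0"
    "y \<in> B \<Longrightarrow> z \<in> B \<Longrightarrow> y \<noteq> z \<Longrightarrow> h \<le> lam y z" by auto
qed

text \<open>
  The postbar of \<open>B\<close> that contains \<open>y\<close>, where \<open>h\<close> is the height of \<open>B\<close>. Contacts in \<open>B\<close> are at least \<open>h\<close>, so
  being greater than \<open>h\<close> only means being different from \<open>h\<close>.
\<close>

definition sprout :: "('a, 'd) pps set \<Rightarrow> rat ^ 'd \<Rightarrow> ('a, 'd) pps \<Rightarrow> ('a, 'd) pps set" where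
  "sprout B h y = {z \<in> B. z = y \<or> h < lam y z}"

lemma sprout_equiv:
  assumes B: "B \<subseteq> S" "B \<noteq> {}" and h: "height B = Fin h"
  shows "equiv B {(y, z). y \<in> B \<and> z \<in> B \<and> contact y z > height B}" (is "equiv B ?R")
    and "y \<in> B \<Longrightarrow> {(y, z). y \<in> B \<and> z \<in> B \<and> contact y z > height B} `` {y} = sprout B h y"
proof -
  have R: "?R = {(y, z). y \<in> B \<and> z \<in> B \<and> (y = z \<or> h < lam y z)}"
    using contact_lam unfolding h by (auto simp: contact_def)
  show "y \<in> B \<Longrightarrow> ?R `` {y} = sprout B h y" unfolding R sprout_def by auto
  show "equiv B ?R" unfolding R
  proof (rule equivI)
    show "{(y, z). y \<in> B \<and> z \<in> B \<and> (y = z \<or> h < lam y z)} \<subseteq> B \<times> B" by auto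
    show "refl_on B {(y, z). y \<in> B \<and> z \<in> B \<and> (y = z \<or> h < lam y z)}" by (auto simp: refl_on_def)
    show "sym {(y, z). y \<in> B \<and> z \<in> B \<and> (y = z \<or> h < lam y z)}"
    proof (rule symI)
      fix x y assume xy: "(x, y) \<in> {(y, z). y \<in> B \<and> z \<in> B \<and> (y = z \<or> h < lam y z)}"
      then have "lam x y = lam y x" using B by (intro lam_commute) auto
      then show "(y, x) \<in> {(y, z). y \<in> B \<and> z \<in> B \<and> (y = z \<or> h < lam y z)}"
        using xy by auto
    qed
    show "trans {(y, z). y \<in> B \<and> z \<in> B \<and> (y = z \<or> h < lam y z)}"
    proof (rule transI)
      fix x y z
      assume "(x, y) \<in> {(y, z). y \<in> B \<and> z \<in> B \<and> (y = z \<or> h < lam y z)}"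
        and "(y, z) \<in> {(y, z). y \<in> B \<and> z \<in> B \<and> (y = z \<or> h < lam y z)}"
      then have xyz: "x \<in> B" "y \<in> B" "z \<in> B" "x = y \<or> h < lam x y" "y = z \<or> h < lam y z" by auto
      then have S: "x \<in> S" "y \<in> S" "z \<in> S" using B by auto
      have "h < lam x z" if ne: "x \<noteq> y" "y \<noteq> z" "x \<noteq> z"
      proof (cases "lam x y \<le> lam y z")
        case True
        then have "lam x y \<le> lam x z" by (intro lam_ultrametric[OF S ne]) auto
        then show ?thesis using xyz(4) ne by (auto intro: less_le_trans)
      next
        case False
        then have "lam y z \<le> lam x y" using lam_comparable[OF S ne(1,2)] by blast
        then have "lam y z \<le> lam x z" by (intro lam_ultrametric[OF S ne]) auto
        then show ?thesis using xyz(5) ne by (auto intro: less_le_trans)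
      qed
      then show "(x, z) \<in> {(y, z). y \<in> B \<and> z \<in> B \<and> (y = z \<or> h < lam y z)}"
        using xyz by blast
    qed
  qed
qed

lemma postbars_eq:
  assumes B: "B \<subseteq> S" "B \<noteq> {}" and h: "height B = Fin h"
  shows "postbars B = sprout B h ` B"
proof -
  have "postbars B = B // {(y, z). y \<in> B \<and> z \<in> B \<and> contact y z > height B}"
    unfolding postbars_def h by simp
  then show ?thesis unfolding quotient_def using sprout_equiv(2)[OF B h] by auto
qed

lemma postbars_partition:
  assumes B: "B \<subseteq> S" "B \<noteq> {}" and h: "height B = Fin h"
  shows "\<Union>(postbars B) = B" "B' \<in> postbars B \<Longrightarrow> B'' \<in> postbars B \<Longrightarrow> B' \<noteq> B'' \<Longrightarrow> B' \<inter> B'' = {}"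
    "finite (postbars B)" "B' \<in> postbars B \<Longrightarrow> B' \<noteq> {}"
    "B' \<in> postbars B \<Longrightarrow> y \<in> B' \<Longrightarrow> B' = sprout B h y"
proof -
  have eq: "postbars B = B // {(y, z). y \<in> B \<and> z \<in> B \<and> contact y z > height B}"
    unfolding postbars_def h by simp
  note e = sprout_equiv(1)[OF B h]
  show "\<Union>(postbars B) = B" unfolding eq using Union_quotient[OF e] .
  show "B' \<in> postbars B \<Longrightarrow> B'' \<in> postbars B \<Longrightarrow> B' \<noteq> B'' \<Longrightarrow> B' \<inter> B'' = {}"
    unfolding eq using quotient_disj[OF e] by blast
  show "finite (postbars B)" unfolding postbars_eq[OF B h] using B fin finite_subset by blast
  show "B' \<in> postbars B \<Longrightarrow> B' \<noteq> {}" unfolding postbars_eq[OF B h] by (auto simp: sprout_def)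
  assume B': "B' \<in> postbars B" "y \<in> B'"
  then obtain x where x: "x \<in> B" "B' = {(y, z). y \<in> B \<and> z \<in> B \<and> contact y z > height B} `` {x}"
    unfolding eq quotient_def by blast
  with B'(2) have "(x, y) \<in> {(y, z). y \<in> B \<and> z \<in> B \<and> contact y z > height B}" by blast
  from equiv_class_eq[OF e this] have B'y: "B' = {(y, z). y \<in> B \<and> z \<in> B \<and> contact y z > height B} `` {y}"
    unfolding x(2) .
  have "y \<in> B" using B'(2) x by blast
  from B'y[unfolded sprout_equiv(2)[OF B h this]] show "B' = sprout B h y" .
qed

lemma postbar_props:
  assumes B: "B \<subseteq> S" "B \<noteq> {}" and h: "height B = Fin h" and B': "B' \<in> postbars B"
  shows "B' \<subset> B" "y \<in> B' \<Longrightarrow> z \<in> B' \<Longrightarrow> y \<noteq> z \<Longrightarrow> h < lam y z"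
    "y \<in> B' \<Longrightarrow> z \<in> B - B' \<Longrightarrow> lam y z = h" "height B' = Fin h' \<Longrightarrow> h < h'"
proof -
  have sub: "B' \<subseteq> B" using postbars_partition(1)[OF B h] B' by blast
  show lt: "h < lam y z" if "y \<in> B'" "z \<in> B'" "y \<noteq> z" for y z
    using postbars_partition(5)[OF B h B' that(1)] that by (auto simp: sprout_def)
  obtain y0 z0 where "y0 \<in> B" "z0 \<in> B" "y0 \<noteq> z0" "h = lam y0 z0" using height_Fin_props[OF B h] by blast
  then have "B' \<noteq> B" using lt[of y0 z0] by auto
  then show "B' \<subset> B" using sub by blast
  show "lam y z = h" if "y \<in> B'" "z \<in> B - B'"
    using postbars_partition(5)[OF B h B' that(1)] that height_Fin_props(2)[OF B h, of y z] sub
    by (auto simp: sprout_def less_le)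
  assume h': "height B' = Fin h'"
  have "B' \<subseteq> S" "B' \<noteq> {}" using sub B postbars_partition(4)[OF B h B'] by auto
  then show "h < h'" using height_Fin_props(1)[OF _ _ h'] lt by auto
qed

end

locale contact_tree = contact_set S
  for S :: "('a::idom, 'd::finite) pps set" +
  fixes f :: "('a, 'd) pps poly"
  assumes Zer_f: "Zer f = S"
begin

abbreviation "T \<equiv> tree_model f"

lemma bar_sub:
  assumes "B \<in> T"
  shows "B \<subseteq> S \<and> B \<noteq> {}"
  using assms
proof (induction rule: tree_model.induct)
  case root
  then show ?case using nonempty by (simp add: Zer_f)
next
  case (post B B')
  have "height B \<noteq> Pinf" using post.hyps(2) unfolding postbars_def by auto
  then obtain h where h: "height B = Fin h" using height_cases post.IH by blast
  then show ?case using postbar_props(1)[OF _ _ h post.hyps(2)] postbars_partition(4)[OF _ _ h post.hyps(2)] post.IH by blast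
qed

lemma finite_T: "finite T"
  by (rule finite_subset[of _ "Pow S"]) (use bar_sub fin in auto)

text \<open>
  Bars are balls: a root outside of \<open>B\<close> has smaller contact with the members of \<open>B\<close> than these have
  among each other.
\<close>

lemma bar_closed:
  assumes "B \<in> T" "b \<in> B" "s \<in> S - B" "height B = Fin h"
  shows "lam b s < h"
  using assms
proof (induction arbitrary: b s h rule: tree_model.induct)
  case root
  then show ?case by (simp add: Zer_f)
next
  case (post B B')
  have B: "B \<subseteq> S" "B \<noteq> {}" using bar_sub[OF post.hyps(1)] by auto
  have "height B \<noteq> Pinf" using post.hyps(2) unfolding postbars_def by auto
  then obtain h0 where h0: "height B = Fin h0" using height_cases[OF B] by metis
  note p = postbar_props[OF B h0 post.hyps(2)]
  have "h0 < h" using p(4) post.prems by blast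
  moreover have "lam b s \<le> h0"
  proof (cases "s \<in> B")
    case True
    then show ?thesis using p(3)[of b s] post.prems by auto
  next
    case False
    then show ?thesis using post.IH[of b s h0] h0 post.prems p(1) by (auto simp: less_le)
  qed
  ultimately show ?case by simp
qed

text \<open>
  A closed form of \<open>q(B)\<close>, for a bar \<open>B\<close> of height \<open>h\<close> and any member \<open>b\<close>: the exponent of \<open>f(y)\<close> when \<open>y\<close>
  has contact \<open>h\<close> with each member of \<open>B\<close>.
\<close>

definition qvec :: "('a, 'd) pps set \<Rightarrow> rat ^ 'd \<Rightarrow> ('a, 'd) pps \<Rightarrow> rat ^ 'd" where
  "qvec B h b = of_nat (card B) *s h + (\<Sum>s\<in>S - B. lam b s)"

lemma qvec_postbar:
  assumes B: "B \<subseteq> S" "B \<noteq> {}" and h: "height B = Fin h" and B': "B' \<in> postbars B" and b: "b \<in> B'"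
  shows "qvec B' h' b = qvec B h b + of_nat (card B') *s (h' - h)"
proof -
  note p = postbar_props[OF B h B']
  have fB: "finite B" using B fin finite_subset by blast
  have "S - B' = (S - B) \<union> (B - B')" using p(1) B by auto
  then have "(\<Sum>s\<in>S - B'. lam b s) = (\<Sum>s\<in>S - B. lam b s) + (\<Sum>s\<in>B - B'. lam b s)"
    using fin fB by (simp only:) (rule sum.union_disjoint, auto)
  also have "(\<Sum>s\<in>B - B'. lam b s) = (\<Sum>s\<in>B - B'. h)" using p(3)[OF b] by (intro sum.cong) auto
  also have "\<dots> = of_nat (card (B - B')) *s h"
    by (simp add: cart_eq_iff of_nat_index)
  also have "of_nat (card (B - B')) = (of_nat (card B) - of_nat (card B') :: rat)"
    using p(1) fB by (subst card_Diff_subset) (auto intro: finite_subset simp: of_nat_diff card_mono)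
  finally show ?thesis unfolding qvec_def
    by (simp add: cart_eq_iff algebra_simps)
qed

text \<open>
  The rule for the lowest bar applies to \<open>S\<close> alone: a smaller bar omits a root, which has smaller
  contact with its members than its height, so that its height is not at most that of \<open>S\<close>.
\<close>

lemma q_rel_qvec:
  assumes "q_rel T B qq"
  shows "(height B = Pinf \<and> qq = Pinf) \<or> (B \<in> T \<and> (\<exists>h. height B = Fin h \<and> (\<forall>b\<in>B. qq = Fin (qvec B h b))))"
  using assms
proof (induction rule: q_rel.induct)
  case (lowest B h)
  have B: "B \<subseteq> S" "B \<noteq> {}" using bar_sub[OF lowest(1)] by auto
  have "B = S"
  proof (rule ccontr)
    assume "B \<noteq> S"
    then obtain s where s: "s \<in> S - B" using B by blast
    obtain b where b: "b \<in> B" using B by blast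
    have ST: "S \<in> T" using tree_model.root[of f] unfolding Zer_f .
    have lt: "lam b s < h" using bar_closed[OF lowest(1) b s lowest(3)] .
    obtain y0 z0 where yz: "height S = Fin (lam y0 z0)" "\<forall>y\<in>S. \<forall>z\<in>S. y \<noteq> z \<longrightarrow> lam y0 z0 \<le> lam y z"
      using height_props[of S b s] s b B by blast
    have "h \<le> lam y0 z0" using bspec[OF lowest(2) ST] lowest(3) yz(1) by simp
    moreover have "lam y0 z0 \<le> lam b s" using yz s b B by auto
    ultimately show False using lt by simp
  qed
  then show ?case using lowest by (simp add: qvec_def)
next
  case (post B q h B' h')
  have B: "B \<in> T" "\<And>b. b \<in> B \<Longrightarrow> q = qvec B h b" using post by auto
  have B': "B \<subseteq> S" "B \<noteq> {}" using bar_sub[OF B(1)] by auto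
  have "Fin (q + of_nat (card B') *s (h' - h)) = Fin (qvec B' h' b)" if b: "b \<in> B'" for b
    using qvec_postbar[OF B' post.hyps(2,4) b, of h'] B(2)[of b] b postbar_props(1)[OF B' post.hyps(2,4)]
    by auto
  then show ?case using post by blast
next
  case (infinite B)
  then show ?case by blast
qed

lemma q_rel_exists:
  assumes "B \<in> T" "height B = Fin h"
  shows "\<exists>q. q_rel T B (Fin q)"
  using assms
proof (induction arbitrary: h rule: tree_model.induct)
  case root
  have "\<forall>B'\<in>T. height (Zer f) \<le> height B'"
  proof
    fix B' assume B': "B' \<in> T"
    show "height (Zer f) \<le> height B'"
    proof (rule height_cases[of B'])
      show "B' \<subseteq> S" "B' \<noteq> {}" using bar_sub[OF B'] by auto
      fix h' assume h': "height B' = Fin h'"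
      have sub: "B' \<subseteq> S" "B' \<noteq> {}" using bar_sub[OF B'] by auto
      obtain y0 z0 where yz: "y0 \<in> B'" "z0 \<in> B'" "y0 \<noteq> z0" "h' = lam y0 z0"
        using height_Fin_props(1)[OF sub h'] by blast
      have "h \<le> lam y0 z0"
        using height_Fin_props(2)[of S h y0 z0] root nonempty yz sub unfolding Zer_f by auto
      then show ?thesis unfolding root h' yz(4) by simp
    qed simp
  qed
  then show ?case using q_rel.lowest[OF tree_model.root _ root] by blast
next
  case (post B B')
  have "height B \<noteq> Pinf" using post.hyps(2) unfolding postbars_def by auto
  then obtain h0 where h0: "height B = Fin h0"
    using height_cases[of B] bar_sub[OF post.hyps(1)] by metis
  from post.IH[OF this] obtain q where "q_rel T B (Fin q)" by blast
  from q_rel.post[OF this h0 tree_model.post[OF post.hyps] post.hyps(2) post.prems] show ?case by blast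
qed

lemma q_val_eq:
  assumes B: "B \<in> T" and h: "height B = Fin h" and b: "b \<in> B"
  shows "q_val T B = Fin (qvec B h b)"
proof -
  obtain q where q: "q_rel T B (Fin q)" using q_rel_exists[OF B h] by blast
  have "qq = Fin (qvec B h b)" if "q_rel T B qq" for qq
    using q_rel_qvec[OF that] h b by auto
  then show ?thesis unfolding q_val_def using q by (metis the_equality)
qed

end

section \<open>Critical points and critical values\<close>

text \<open>
  In the coordinate \<open>Z\<close> with \<open>Y = c + T\<^sup>\<rho> Z\<close> of a ball, a linear factor with root in the ball is a power
  of \<open>T\<close> times a factor with linear reduction, and any other factor is a power of \<open>T\<close> times one whose
  reduction is a nonzero constant. So the number of roots in the ball is the degree of the reduction.
\<close>

lemma scaled_linear_product:
  fixes y :: "'i \<Rightarrow> 'a::idom rps"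
  assumes "finite I" and \<rho>: "\<rho> \<ge> 0"
  shows "\<exists>M\<ge>0. \<exists>g. pcompose (\<Prod>i\<in>I. [:- y i, 1:]) [:c, tpow \<rho>:] = Polynomial.smult (tpow M) g \<and>
    red_poly g \<noteq> 0 \<and> degree (red_poly g) = card {i\<in>I. tpow \<rho> dvd y i - c}"
  using assms(1)
proof (induction I rule: finite_induct)
  case empty
  show ?case by (intro exI[of _ 0] conjI exI[of _ 1]) (auto simp: pcompose_1)
next
  case (insert k I)
  then obtain M g where IH: "M \<ge> 0" "pcompose (\<Prod>i\<in>I. [:- y i, 1:]) [:c, tpow \<rho>:] = Polynomial.smult (tpow M) g"
    "red_poly g \<noteq> 0" "degree (red_poly g) = card {i\<in>I. tpow \<rho> dvd y i - c}" by blast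
  have lin: "pcompose [:- y k, 1:] [:c, tpow \<rho>:] = [:c - y k, tpow \<rho>:]" by (simp add: pcompose_pCons)
  have "\<exists>N\<ge>0. \<exists>l. [:c - y k, tpow \<rho>:] = Polynomial.smult (tpow N) l \<and> red_poly l \<noteq> 0 \<and>
      degree (red_poly l) = (if tpow \<rho> dvd y k - c then 1 else 0)"
  proof (cases "tpow \<rho> dvd y k - c")
    case True
    then have "tpow \<rho> dvd c - y k" by (metis dvd_minus_iff minus_diff_eq)
    then obtain a where "c - y k = tpow \<rho> * a" by (elim dvdE)
    then have "[:c - y k, tpow \<rho>:] = Polynomial.smult (tpow \<rho>) [:a, 1:]" by simp
    moreover have "red_poly [:a, 1:] = [:rcoeff a 0, 1:]" by (simp add: res.map_poly_pCons_hom)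
    ultimately show ?thesis using True \<rho> by (intro exI[of _ \<rho>] conjI exI[of _ "[:a, 1:]"]) auto
  next
    case False
    then have nz: "c - y k \<noteq> 0" by auto
    define N where "N = rord (c - y k)"
    have N0: "N \<ge> 0" unfolding N_def using rord_nonneg[OF nz] .
    have "\<not> \<rho> \<le> N" using False nz tpow_dvd_iff_rord[OF \<rho>, of "y k - c"]
      by (auto simp: N_def rord_minus_commute[of c])
    then have N: "N < \<rho>" by simp
    have "tpow N dvd c - y k" using N0 nz by (simp add: tpow_dvd_iff_rord N_def)
    then obtain a where a: "c - y k = tpow N * a" by (elim dvdE)
    have "rcoeff (c - y k) N \<noteq> 0" unfolding N_def by (rule rord_props(1)[OF nz])
    then have "rcoeff (tpow N * a) N \<noteq> 0" unfolding a .
    then have a0: "rcoeff a 0 \<noteq> 0" using N0 by (simp add: rcoeff_rmonom_mult)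
    have "[:c - y k, tpow \<rho>:] = Polynomial.smult (tpow N) [:a, tpow (\<rho> - N):]"
      using a N N0 by (simp add: rmonom_mult)
    moreover have "red_poly [:a, tpow (\<rho> - N):] = [:rcoeff a 0:]"
      using N by (simp add: res.map_poly_pCons_hom)
    ultimately show ?thesis using False a0 N0
      by (intro exI[of _ N] conjI exI[of _ "[:a, tpow (\<rho> - N):]"]) auto
  qed
  then obtain N l where l: "N \<ge> 0" "[:c - y k, tpow \<rho>:] = Polynomial.smult (tpow N) l" "red_poly l \<noteq> 0"
      "degree (red_poly l) = (if tpow \<rho> dvd y k - c then 1 else 0)" by blast
  have "pcompose (\<Prod>i\<in>insert k I. [:- y i, 1:]) [:c, tpow \<rho>:] =
      Polynomial.smult (tpow (N + M)) (l * g)"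
    unfolding prod.insert[OF insert.hyps] pcompose_mult lin IH l(2)
    using l(1) IH(1) by (simp add: rmonom_mult algebra_simps)
  moreover have "red_poly (l * g) = red_poly l * red_poly g" by (rule red_poly.hom_mult)
  moreover have "card {i\<in>insert k I. tpow \<rho> dvd y i - c} =
      (if tpow \<rho> dvd y k - c then 1 else 0) + card {i\<in>I. tpow \<rho> dvd y i - c}"
  proof -
    have "{i\<in>insert k I. tpow \<rho> dvd y i - c} =
      (if tpow \<rho> dvd y k - c then insert k {i\<in>I. tpow \<rho> dvd y i - c} else {i\<in>I. tpow \<rho> dvd y i - c})" by auto
    then show ?thesis using insert.hyps by simp
  qed
  ultimately show ?case using l IH
    by (intro exI[of _ "N + M"] conjI exI[of _ "l * g"]) (auto simp: degree_mult_eq)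
qed

lemma smult_tpow_unique:
  fixes g k :: "'a::idom rps poly"
  assumes "Polynomial.smult (tpow M) g = Polynomial.smult (tpow N) k" "M \<ge> 0" "N \<ge> 0"
    and "red_poly g \<noteq> 0" "red_poly k \<noteq> 0"
  shows "g = k"
proof -
  have *: "\<not> M < N" if eq: "Polynomial.smult (tpow M) g = Polynomial.smult (tpow N) k"
    and "M \<ge> 0" "red_poly g \<noteq> 0" for M N and g k :: "'a rps poly"
  proof
    assume "M < N"
    then have "tpow N = tpow M * (tpow (N - M) :: 'a rps)" using \<open>M \<ge> 0\<close> by (simp add: rmonom_mult)
    then have "Polynomial.smult (tpow M) g = Polynomial.smult (tpow M) (Polynomial.smult (tpow (N - M)) k)"
      using eq by simp
    then have "Polynomial.smult (tpow M) (g - Polynomial.smult (tpow (N - M)) k) = 0"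
      by (simp add: smult_diff_right)
    then have "g = Polynomial.smult (tpow (N - M)) k" using \<open>M \<ge> 0\<close> by simp
    then have "red_poly g = 0" using \<open>M < N\<close>
      by (intro poly_eqI) (simp add: coeff_map_poly rcoeff_0_mult)
    then show False using that by simp
  qed
  have "M = N" using *[OF assms(1,2,4)] *[OF assms(1)[symmetric] assms(3,5)] by simp
  then have "Polynomial.smult (tpow M) (g - k) = 0" using assms(1) by (simp add: smult_diff_right)
  then show ?thesis using assms(2) by simp
qed

text \<open>
  An analogue of Rolle's theorem: in the coordinate of the ball, the reduction of the derivative
  is the derivative of the reduction, whose degree drops by exactly one in characteristic \<open>0\<close>.
\<close>

theorem critical_points_in_ball:
  fixes y :: "'i \<Rightarrow> 'a::{idom, ring_char_0} rps" and \<zeta> :: "'j \<Rightarrow> 'a rps"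
  assumes I: "finite I" and J: "finite J" and b: "b \<noteq> 0"
    and df: "pderiv (\<Prod>i\<in>I. [:- y i, 1:]) = Polynomial.smult (rmonom b 0) (\<Prod>j\<in>J. [:- \<zeta> j, 1:])"
    and \<rho>: "\<rho> \<ge> 0" and ne: "i0 \<in> I" "tpow \<rho> dvd y i0 - c"
  shows "card {j\<in>J. tpow \<rho> dvd \<zeta> j - c} = card {i\<in>I. tpow \<rho> dvd y i - c} - 1"
proof -
  define q where "q = [:c, tpow \<rho> :: 'a rps:]"
  obtain M g where g: "M \<ge> 0" "pcompose (\<Prod>i\<in>I. [:- y i, 1:]) q = Polynomial.smult (tpow M) g"
    "red_poly g \<noteq> 0" "degree (red_poly g) = card {i\<in>I. tpow \<rho> dvd y i - c}"
    using scaled_linear_product[OF I \<rho>, of y c] unfolding q_def by blast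
  obtain N k where k: "N \<ge> 0" "pcompose (\<Prod>j\<in>J. [:- \<zeta> j, 1:]) q = Polynomial.smult (tpow N) k"
    "red_poly k \<noteq> 0" "degree (red_poly k) = card {j\<in>J. tpow \<rho> dvd \<zeta> j - c}"
    using scaled_linear_product[OF J \<rho>, of \<zeta> c] unfolding q_def by blast
  have "Polynomial.smult (tpow M) (pderiv g) = pderiv (pcompose (\<Prod>i\<in>I. [:- y i, 1:]) q)"
    unfolding g(2) by (simp add: pderiv_smult)
  also have "\<dots> = pcompose (pderiv (\<Prod>i\<in>I. [:- y i, 1:])) q * pderiv q" by (rule pderiv_pcompose)
  also have "\<dots> = Polynomial.smult (tpow (N + \<rho>)) (Polynomial.smult (rmonom b 0) k)"
    unfolding df pcompose_smult k(2) using k(1) \<rho>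
    by (simp add: q_def pderiv_pCons rmonom_mult algebra_simps)
  finally have eq: "Polynomial.smult (tpow M) (pderiv g) =
      Polynomial.smult (tpow (N + \<rho>)) (Polynomial.smult (rmonom b 0) k)" .
  have rk: "red_poly (Polynomial.smult (rmonom b 0) k) = Polynomial.smult b (red_poly k)"
    by (rule poly_eqI) (simp add: coeff_map_poly rcoeff_0_mult)
  have rg: "red_poly (pderiv g) = pderiv (red_poly g)"
    by (rule poly_eqI) (simp add: coeff_map_poly coeff_pderiv rcoeff_0_mult res.hom_of_nat flip: of_nat_Suc)
  have fin: "finite {i\<in>I. tpow \<rho> dvd y i - c}" using I by simp
  have pos: "card {i\<in>I. tpow \<rho> dvd y i - c} > 0" using ne fin by (auto simp: card_gt_0_iff)
  have "pderiv (red_poly g) \<noteq> 0" using pos g(4) by (simp add: pderiv_eq_0_iff)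
  then have "pderiv g = Polynomial.smult (rmonom b 0) k"
    using smult_tpow_unique[OF eq] g(1) k(1,3) \<rho> b rg rk by simp
  then have "pderiv (red_poly g) = Polynomial.smult b (red_poly k)" using rg rk by metis
  then have "degree (red_poly g) - 1 = degree (red_poly k)"
    using b by (metis degree_pderiv degree_smult_eq)
  then show ?thesis using g(4) k(4) by simp
qed

definition vanishes_upto :: "real \<Rightarrow> 'a::zero rps \<Rightarrow> bool" where
  "vanishes_upto \<rho> x \<longleftrightarrow> (\<forall>t\<le>\<rho>. rcoeff x t = 0)"

lemma vanishes_upto_iff: "vanishes_upto \<rho> x \<longleftrightarrow> x = 0 \<or> \<rho> < rord x"
  unfolding vanishes_upto_def using rord_props[of x] by force

lemma vanishes_upto_add:
  "vanishes_upto \<rho> x \<Longrightarrow> vanishes_upto \<rho> y \<Longrightarrow> vanishes_upto \<rho> (x + y)"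
  "vanishes_upto \<rho> x \<Longrightarrow> vanishes_upto \<rho> y \<Longrightarrow> vanishes_upto \<rho> (x - y)"
  for x y :: "'a::ab_group_add rps"
  by (auto simp: vanishes_upto_def)

lemma vanishes_upto_dvd: "\<rho> \<ge> 0 \<Longrightarrow> vanishes_upto \<rho> x \<Longrightarrow> tpow \<rho> dvd x" for x :: "'a::comm_ring_1 rps"
  by (auto simp: vanishes_upto_def tpow_dvd_iff)

text \<open>
  For finitely many points an open ball is the same as a slightly smaller closed one.
\<close>

lemma vanishes_upto_as_dvd:
  fixes X :: "'a::comm_ring_1 rps set"
  assumes "finite X" "\<rho> \<ge> 0"
  shows "\<exists>\<rho>'>\<rho>. \<forall>x\<in>X. tpow \<rho>' dvd x \<longleftrightarrow> vanishes_upto \<rho> x"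
proof -
  define R where "R = insert (\<rho> + 1) (rord ` {x\<in>X. x \<noteq> 0 \<and> \<rho> < rord x})"
  have R: "finite R" "R \<noteq> {}" unfolding R_def using assms by auto
  have "\<rho> < Min R" using R unfolding R_def by (subst Min_gr_iff) auto
  moreover have "tpow (Min R) dvd x \<longleftrightarrow> vanishes_upto \<rho> x" if x: "x \<in> X" for x
  proof (cases "x = 0")
    case False
    have "Min R \<le> rord x" if "\<rho> < rord x" using R x False that unfolding R_def by (intro Min_le) auto
    then show ?thesis using False assms \<open>\<rho> < Min R\<close>
      by (auto simp: tpow_dvd_iff_rord vanishes_upto_iff)
  qed (simp add: vanishes_upto_iff)
  ultimately show ?thesis by blast
qed

theorem critical_points_in_open_ball:
  fixes y :: "'i \<Rightarrow> 'a::{idom, ring_char_0} rps" and \<zeta> :: "'j \<Rightarrow> 'a rps"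
  assumes I: "finite I" and J: "finite J" and b: "b \<noteq> 0"
    and df: "pderiv (\<Prod>i\<in>I. [:- y i, 1:]) = Polynomial.smult (rmonom b 0) (\<Prod>j\<in>J. [:- \<zeta> j, 1:])"
    and \<rho>: "\<rho> \<ge> 0" and ne: "i0 \<in> I" "vanishes_upto \<rho> (y i0 - c)"
  shows "card {j\<in>J. vanishes_upto \<rho> (\<zeta> j - c)} = card {i\<in>I. vanishes_upto \<rho> (y i - c)} - 1"
proof -
  have "finite ((\<lambda>i. y i - c) ` I \<union> (\<lambda>j. \<zeta> j - c) ` J)" using I J by simp
  from vanishes_upto_as_dvd[OF this \<rho>] obtain \<rho>' where \<rho>'0: "\<rho>' > \<rho>"
    "\<forall>x\<in>(\<lambda>i. y i - c) ` I \<union> (\<lambda>j. \<zeta> j - c) ` J. tpow \<rho>' dvd x \<longleftrightarrow> vanishes_upto \<rho> x" by (elim exE conjE)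
  then have \<rho>': "\<rho>' > \<rho>"
    "\<And>i. i \<in> I \<Longrightarrow> tpow \<rho>' dvd y i - c \<longleftrightarrow> vanishes_upto \<rho> (y i - c)"
    "\<And>j. j \<in> J \<Longrightarrow> tpow \<rho>' dvd \<zeta> j - c \<longleftrightarrow> vanishes_upto \<rho> (\<zeta> j - c)"
    by (simp_all only: ball_Un ball_simps)
  have "{j\<in>J. tpow \<rho>' dvd \<zeta> j - c} = {j\<in>J. vanishes_upto \<rho> (\<zeta> j - c)}"
    "{i\<in>I. tpow \<rho>' dvd y i - c} = {i\<in>I. vanishes_upto \<rho> (y i - c)}" using \<rho>' by auto
  then show ?thesis
    using critical_points_in_ball[OF I J b df _ ne(1), of \<rho>' c] \<rho>' ne \<rho> by simp
qed

context contact_tree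
begin

definition fbars :: "('a, 'd) pps set set" where
  "fbars = {B \<in> T. height B \<noteq> Pinf}"

lemma fbarsE:
  assumes "B \<in> fbars"
  obtains h where "B \<in> T" "height B = Fin h" "B \<subseteq> S" "B \<noteq> {}"
  using assms height_cases[of B] bar_sub[of B] unfolding fbars_def by blast

end

text \<open>
  A generic weight \<open>w\<close> is fixed, and \<open>\<zeta> j\<close>, for \<open>j\<close> in \<open>J\<close>, are the critical points of \<open>f\<close> with
  multiplicities, after the substitution given by \<open>w\<close>.
\<close>

locale weighted_tree = contact_tree S f
  for S :: "('a::{idom, ring_char_0}, 'd::finite) pps set" and f :: "('a, 'd) pps poly" +
  fixes w :: "real ^ 'd" and J :: "'j set" and \<zeta> :: "'j \<Rightarrow> 'a rps" and b :: 'a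
  assumes w: "generic w" and J: "finite J" "card J = card S - 1" and b: "b \<noteq> 0"
    and df: "pderiv (\<Prod>s\<in>S. [:- emb w s, 1:]) = Polynomial.smult (rmonom b 0) (\<Prod>j\<in>J. [:- \<zeta> j, 1:])"
begin

lemma emb_diff: "emb w s - emb w s' = emb w (s - s')" for s s' :: "('a, 'd) pps"
proof -
  interpret e: inj_comm_ring_hom "emb w :: ('a, 'd) pps \<Rightarrow> 'a rps" by (rule emb_hom[OF w])
  show ?thesis by (simp add: e.hom_minus)
qed

lemma emb_diff_nz: "s \<noteq> s' \<Longrightarrow> emb w s - emb w s' \<noteq> 0" for s s' :: "('a, 'd) pps"
  unfolding emb_diff by (simp add: emb_eq_0_iff[OF w])

lemma rord_emb_diff:
  assumes "s \<in> S" "s' \<in> S" "s \<noteq> s'"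
  shows "rord (emb w s - emb w s') = w \<bullet> rv (lam s s')"
proof -
  obtain u where "0 \<le> lam s s'" "const_coeff u \<noteq> 0" "s - s' = X_pow (lam s s') * u"
    using has_contact_lam[OF assms] unfolding has_contact_def by blast
  then show ?thesis unfolding emb_diff by (simp add: rord_emb_monomial_unit[OF w])
qed

lemma height_nonneg:
  assumes "B \<in> T" "height B = Fin h"
  shows "0 \<le> h"
proof -
  have "B \<subseteq> S" "B \<noteq> {}" using bar_sub[OF assms(1)] by auto
  from height_Fin_props(1)[OF this assms(2)] obtain y0 z0 where "y0 \<in> S" "z0 \<in> S" "y0 \<noteq> z0" "h = lam y0 z0"
    using bar_sub[OF assms(1)] by blast
  then show ?thesis using has_contact_lam[of y0 z0] by (simp add: has_contact_def)
qed

lemma bar_as_ball: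
  assumes B: "B \<in> T" "height B = Fin h" and s: "s \<in> S" "c \<in> B"
  shows "tpow (w \<bullet> rv h) dvd emb w s - emb w c \<longleftrightarrow> s \<in> B"
proof (cases "s = c")
  case False
  have BS: "B \<subseteq> S" "B \<noteq> {}" using bar_sub[OF B(1)] by auto
  have eq: "tpow (w \<bullet> rv h) dvd emb w s - emb w c \<longleftrightarrow> w \<bullet> rv h \<le> w \<bullet> rv (lam s c)"
    using rord_emb_diff[of s c] s BS False inner_rv_nonneg[OF w height_nonneg[OF B]] emb_diff_nz[OF False]
    by (subst tpow_dvd_iff_rord) auto
  show ?thesis
  proof (cases "s \<in> B")
    case True
    then show ?thesis unfolding eq using height_Fin_props(2)[OF BS B(2) True s(2) False] inner_rv_mono[OF w] by blast
  next
    case sB: False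
    then have "lam c s < h" using bar_closed[OF B(1) s(2) _ B(2), of s] s by blast
    then have "lam s c < h" using lam_commute[of s c] s BS by auto
    from inner_rv_strict_mono[OF w this] show ?thesis unfolding eq using sB by simp
  qed
qed (use s in simp)

lemma postbar_as_open_ball:
  assumes B: "B \<in> T" "height B = Fin h" and B': "B' \<in> postbars B" and s: "s \<in> S" "c \<in> B'"
  shows "vanishes_upto (w \<bullet> rv h) (emb w s - emb w c) \<longleftrightarrow> s \<in> B'"
proof (cases "s = c")
  case False
  have BS: "B \<subseteq> S" "B \<noteq> {}" using bar_sub[OF B(1)] by auto
  note p = postbar_props[OF BS B(2) B']
  have cB: "c \<in> B" using s p(1) by blast
  have eq: "vanishes_upto (w \<bullet> rv h) (emb w s - emb w c) \<longleftrightarrow> w \<bullet> rv h < w \<bullet> rv (lam s c)"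
    using rord_emb_diff[of s c] s BS cB False emb_diff_nz[OF False] by (auto simp: vanishes_upto_iff)
  have com: "lam s c = lam c s" using lam_commute[of s c] s BS cB by auto
  consider "s \<in> B'" | "s \<in> B - B'" | "s \<in> S - B" using s by blast
  then show ?thesis
  proof cases
    case 1
    then show ?thesis unfolding eq using p(2)[OF 1 s(2) False] inner_rv_strict_mono[OF w] by blast
  next
    case 2
    then show ?thesis unfolding eq com using p(3)[OF s(2) 2] by simp
  next
    case 3
    have "lam c s < h" using bar_closed[OF B(1) cB 3 B(2)] .
    from inner_rv_strict_mono[OF w this] show ?thesis unfolding eq com using 3 p(1) by auto
  qed
qed (use s in \<open>simp add: vanishes_upto_iff\<close>)

text \<open>
  The critical points in the closed ball spanned by \<open>B\<close> that lie in none of the open balls spanned by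
  its postbars (see \<open>shell_eq\<close> below).
\<close>

definition shell :: "('a, 'd) pps set \<Rightarrow> 'j set" where
  "shell B = {j\<in>J. \<exists>h. height B = Fin h \<and> (\<forall>s\<in>B. \<zeta> j \<noteq> emb w s \<and> rord (\<zeta> j - emb w s) = w \<bullet> rv h)}"

lemma card_ball:
  assumes B: "B \<in> T" "height B = Fin h" and c: "c \<in> B"
  shows "card {j\<in>J. tpow (w \<bullet> rv h) dvd \<zeta> j - emb w c} = card B - 1"
proof -
  have BS: "B \<subseteq> S" using bar_sub[OF B(1)] by auto
  have "card {j\<in>J. tpow (w \<bullet> rv h) dvd \<zeta> j - emb w c} = card {s\<in>S. tpow (w \<bullet> rv h) dvd emb w s - emb w c} - 1"
    by (rule critical_points_in_ball[OF fin J(1) b df inner_rv_nonneg[OF w height_nonneg[OF B]], of c])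
       (use c BS in auto)
  also have "{s\<in>S. tpow (w \<bullet> rv h) dvd emb w s - emb w c} = B"
    using bar_as_ball[OF B _ c] BS by auto
  finally show ?thesis .
qed

lemma card_open_ball:
  assumes B: "B \<in> T" "height B = Fin h" and B': "B' \<in> postbars B" and c: "c \<in> B'"
  shows "card {j\<in>J. vanishes_upto (w \<bullet> rv h) (\<zeta> j - emb w c)} = card B' - 1"
proof -
  have BS: "B \<subseteq> S" "B \<noteq> {}" using bar_sub[OF B(1)] by auto
  have B'S: "B' \<subseteq> S" using postbar_props(1)[OF BS B(2) B'] BS by auto
  have "card {j\<in>J. vanishes_upto (w \<bullet> rv h) (\<zeta> j - emb w c)} =
      card {s\<in>S. vanishes_upto (w \<bullet> rv h) (emb w s - emb w c)} - 1"
    by (rule critical_points_in_open_ball[OF fin J(1) b df inner_rv_nonneg[OF w height_nonneg[OF B]], of c])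
       (use c B'S in \<open>auto simp: vanishes_upto_iff\<close>)
  also have "{s\<in>S. vanishes_upto (w \<bullet> rv h) (emb w s - emb w c)} = B'"
    using postbar_as_open_ball[OF B B' _ c] B'S by auto
  finally show ?thesis .
qed

lemma shell_eq:
  assumes B: "B \<in> T" "height B = Fin h" and c: "c \<in> B"
    and pick: "\<And>B'. B' \<in> postbars B \<Longrightarrow> pick B' \<in> B'"
  shows "shell B = {j\<in>J. tpow (w \<bullet> rv h) dvd \<zeta> j - emb w c} -
    (\<Union>B'\<in>postbars B. {j\<in>J. vanishes_upto (w \<bullet> rv h) (\<zeta> j - emb w (pick B'))})"
proof -
  define H where "H = w \<bullet> rv h"
  have H0: "H \<ge> 0" unfolding H_def by (rule inner_rv_nonneg[OF w height_nonneg[OF B]])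
  have BS: "B \<subseteq> S" "B \<noteq> {}" using bar_sub[OF B(1)] by auto
  have sh: "j \<in> shell B \<longleftrightarrow> j \<in> J \<and> (\<forall>s\<in>B. \<zeta> j \<noteq> emb w s \<and> rord (\<zeta> j - emb w s) = H)" for j
    unfolding shell_def B(2) H_def by auto
  have dvd: "tpow H dvd \<zeta> j - emb w s" if "tpow H dvd \<zeta> j - emb w s'" "s \<in> B" "s' \<in> B" for j s s'
  proof -
    have "tpow H dvd emb w s' - emb w s" using bar_as_ball[OF B _ that(2), of s'] that(3) BS unfolding H_def by blast
    from dvd_add[OF that(1) this] show ?thesis by simp
  qed
  have "j \<in> shell B \<longleftrightarrow> j \<in> J \<and> tpow H dvd \<zeta> j - emb w c \<and>
      (\<forall>B'\<in>postbars B. \<not> vanishes_upto H (\<zeta> j - emb w (pick B')))" for j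
  proof
    assume j: "j \<in> shell B"
    have "tpow H dvd \<zeta> j - emb w c" using j c H0 unfolding sh by (subst tpow_dvd_iff_rord) auto
    moreover have "\<not> vanishes_upto H (\<zeta> j - emb w (pick B'))" if "B' \<in> postbars B" for B'
    proof -
      have "pick B' \<in> B" using pick[OF that] postbar_props(1)[OF BS B(2) that] by auto
      then show ?thesis using j unfolding sh by (auto simp: vanishes_upto_iff)
    qed
    ultimately show "j \<in> J \<and> tpow H dvd \<zeta> j - emb w c \<and>
      (\<forall>B'\<in>postbars B. \<not> vanishes_upto H (\<zeta> j - emb w (pick B')))" using j unfolding sh by blast
  next
    assume j: "j \<in> J \<and> tpow H dvd \<zeta> j - emb w c \<and>
      (\<forall>B'\<in>postbars B. \<not> vanishes_upto H (\<zeta> j - emb w (pick B')))"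
    have "\<zeta> j \<noteq> emb w s \<and> rord (\<zeta> j - emb w s) = H" if s: "s \<in> B" for s
    proof -
      obtain B' where B': "B' \<in> postbars B" "s \<in> B'" using postbars_partition(1)[OF BS B(2)] s by blast
      have d: "tpow H dvd \<zeta> j - emb w s" using dvd[of j c s] j s c by blast
      have "vanishes_upto H (emb w s - emb w (pick B'))"
        using postbar_as_open_ball[OF B B'(1) _ pick[OF B'(1)], of s] B'(2) s BS unfolding H_def by blast
      then have nv: "\<not> vanishes_upto H (\<zeta> j - emb w s)"
        using vanishes_upto_add(1)[of H "\<zeta> j - emb w s" "emb w s - emb w (pick B')"] j B'(1) by auto
      then have ne: "\<zeta> j - emb w s \<noteq> 0" by (auto simp: vanishes_upto_iff)
      then show ?thesis using nv d H0 by (auto simp: vanishes_upto_iff tpow_dvd_iff_rord)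
    qed
    then show "j \<in> shell B" unfolding sh using j by blast
  qed
  then show ?thesis unfolding H_def by blast
qed

text \<open>
  The closed ball of \<open>B\<close> contains \<open>card B - 1\<close> critical points, and the disjoint open balls of the
  postbars \<open>B'\<close> contain \<open>card B' - 1\<close> each. The cardinalities \<open>card B'\<close> add up to \<open>card B\<close>.
\<close>

lemma card_shell:
  assumes B: "B \<in> T" "height B = Fin h"
  shows "card (shell B) = t_num B - 1"
proof -
  define H where "H = w \<bullet> rv h"
  have H0: "H \<ge> 0" unfolding H_def by (rule inner_rv_nonneg[OF w height_nonneg[OF B]])
  have BS: "B \<subseteq> S" "B \<noteq> {}" using bar_sub[OF B(1)] by auto
  have fB: "finite B" using BS fin finite_subset by blast
  obtain c where c: "c \<in> B" using BS by blast
  define pick where "pick B' = (SOME s. s \<in> B')" for B' :: "('a, 'd) pps set"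
  have pick: "pick B' \<in> B'" if "B' \<in> postbars B" for B'
    unfolding pick_def using postbars_partition(4)[OF BS B(2) that] by (simp add: some_in_eq)
  define N where "N = {j\<in>J. tpow H dvd \<zeta> j - emb w c}"
  define OB where "OB B' = {j\<in>J. vanishes_upto H (\<zeta> j - emb w (pick B'))}" for B'
  have cN: "card N = card B - 1" unfolding N_def H_def by (rule card_ball[OF B c])
  have cO: "card (OB B') = card B' - 1" if "B' \<in> postbars B" for B'
    unfolding OB_def H_def by (rule card_open_ball[OF B that pick[OF that]])
  have ON: "OB B' \<subseteq> N" if B': "B' \<in> postbars B" for B'
  proof
    fix j assume j: "j \<in> OB B'"
    have "pick B' \<in> B" using pick[OF B'] postbar_props(1)[OF BS B(2) B'] by auto
    then have "tpow H dvd emb w (pick B') - emb w c" using bar_as_ball[OF B _ c] BS unfolding H_def by blast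
    moreover have "tpow H dvd \<zeta> j - emb w (pick B')" using j H0 by (auto simp: OB_def vanishes_upto_dvd)
    ultimately have "tpow H dvd (\<zeta> j - emb w (pick B')) + (emb w (pick B') - emb w c)" by (rule dvd_add[rotated])
    then show "j \<in> N" using j by (simp add: N_def OB_def)
  qed
  have disj: "OB B' \<inter> OB B'' = {}" if BB: "B' \<in> postbars B" "B'' \<in> postbars B" "B' \<noteq> B''" for B' B''
  proof (rule ccontr)
    assume "OB B' \<inter> OB B'' \<noteq> {}"
    then obtain j where "vanishes_upto H (\<zeta> j - emb w (pick B'))" "vanishes_upto H (\<zeta> j - emb w (pick B''))"
      unfolding OB_def by blast
    from vanishes_upto_add(2)[OF this] have "vanishes_upto H (emb w (pick B'') - emb w (pick B'))" by simp
    moreover have "pick B'' \<in> S" using pick[OF BB(2)] postbar_props(1)[OF BS B(2) BB(2)] BS by auto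
    ultimately have "pick B'' \<in> B'"
      using postbar_as_open_ball[OF B BB(1) _ pick[OF BB(1)]] unfolding H_def by blast
    then show False using pick[OF BB(2)] postbars_partition(2)[OF BS B(2) BB] by blast
  qed
  note fp = postbars_partition(3)[OF BS B(2)]
  have card1: "1 \<le> card B'" if "B' \<in> postbars B" for B'
    using postbars_partition(4)[OF BS B(2) that] finite_subset[OF _ fB] postbar_props(1)[OF BS B(2) that]
    by (metis Suc_leI card_gt_0_iff One_nat_def psubset_imp_subset)
  have finB': "finite B'" if "B' \<in> postbars B" for B'
    using postbar_props(1)[OF BS B(2) that] fB by (meson finite_subset psubset_imp_subset)
  have "(\<Sum>B'\<in>postbars B. card B') = card (\<Union>(postbars B))"
    by (rule card_Union_disjoint[symmetric])
       (use postbars_partition(2)[OF BS B(2)] finB' in \<open>auto simp: pairwise_def disjnt_def\<close>)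
  also have "\<dots> = card B" unfolding postbars_partition(1)[OF BS B(2)] ..
  finally have sum: "(\<Sum>B'\<in>postbars B. card B') = card B" .
  have "card (\<Union>B'\<in>postbars B. OB B') = (\<Sum>B'\<in>postbars B. card B' - 1)"
    using fp disj cO J(1) by (subst card_UN_disjoint) (auto simp: OB_def)
  also have "\<dots> = card B - t_num B"
    unfolding t_num_def using card1 by (subst sum_subtractf_nat) (auto simp: sum)
  finally have cU: "card (\<Union>B'\<in>postbars B. OB B') = card B - t_num B" .
  have "t_num B \<le> card B"
    unfolding t_num_def sum[symmetric] using card1 by (metis card_eq_sum sum_mono)
  moreover have "1 \<le> t_num B" unfolding t_num_def
    using postbars_partition(1)[OF BS B(2)] BS(2) fp by (metis Suc_leI Union_empty card_gt_0_iff One_nat_def)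
  moreover have "shell B = N - (\<Union>B'\<in>postbars B. OB B')"
    unfolding N_def OB_def H_def by (rule shell_eq[OF B c pick])
  then have "card (shell B) = card N - card (\<Union>B'\<in>postbars B. OB B')"
    using ON J(1) fp by (simp only:) (rule card_Diff_subset, auto simp: OB_def)
  ultimately show ?thesis using cN cU by linarith
qed

lemma shell_order:
  assumes B: "B \<in> T" "height B = Fin h" and c: "c \<in> B" and j: "j \<in> shell B" and s: "s \<in> S"
  shows "\<zeta> j \<noteq> emb w s \<and> rord (\<zeta> j - emb w s) = (if s \<in> B then w \<bullet> rv h else w \<bullet> rv (lam c s)) \<and>
    (s \<notin> B \<longrightarrow> rord (\<zeta> j - emb w s) < w \<bullet> rv h)"
proof (cases "s \<in> B")
  case True
  then show ?thesis using j unfolding shell_def B(2) by auto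
next
  case False
  have BS: "B \<subseteq> S" "B \<noteq> {}" using bar_sub[OF B(1)] by auto
  have cs: "c \<noteq> s" "c \<in> S" using c False BS by auto
  have jc: "\<zeta> j - emb w c \<noteq> 0" "rord (\<zeta> j - emb w c) = w \<bullet> rv h" using j c unfolding shell_def B(2) by auto
  have "lam c s < h" using bar_closed[OF B(1) c _ B(2), of s] s False by blast
  then have lt: "w \<bullet> rv (lam c s) < w \<bullet> rv h" by (rule inner_rv_strict_mono[OF w])
  have "rord ((emb w c - emb w s) + (\<zeta> j - emb w c)) = rord (emb w c - emb w s)"
    by (rule rord_add_less) (use emb_diff_nz[OF cs(1)] jc lt rord_emb_diff[OF cs(2) s cs(1)] in auto)
  then have "rord (\<zeta> j - emb w s) = w \<bullet> rv (lam c s)" using rord_emb_diff[OF cs(2) s cs(1)] by simp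
  moreover have "\<zeta> j \<noteq> emb w s"
  proof
    assume eq: "\<zeta> j = emb w s"
    have "rord (emb w s - emb w c) = w \<bullet> rv h" using jc eq by simp
    then show False using rord_emb_diff[of c s] cs s lt rord_minus_commute[of "emb w c" "emb w s"] by simp
  qed
  ultimately show ?thesis using False lt by simp
qed

text \<open>
  A bar is recovered from any point of its shell as the set of the roots closest to this point.
\<close>

lemma shell_disjoint:
  assumes "B \<in> fbars" "C \<in> fbars" "j \<in> shell B" "j \<in> shell C"
  shows "B = C"
proof -
  have *: "B = {s\<in>S. \<forall>s'\<in>S. rord (\<zeta> j - emb w s') \<le> rord (\<zeta> j - emb w s)}"
    if B: "B \<in> fbars" "j \<in> shell B" for B
  proof -
    obtain h where h: "B \<in> T" "height B = Fin h" "B \<subseteq> S" "B \<noteq> {}" using fbarsE[OF B(1)] .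
    obtain c where c: "c \<in> B" using h by blast
    note o = shell_order[OF h(1,2) c B(2)]
    show ?thesis
    proof (intro equalityI subsetI)
      fix s assume s: "s \<in> B"
      then show "s \<in> {s\<in>S. \<forall>s'\<in>S. rord (\<zeta> j - emb w s') \<le> rord (\<zeta> j - emb w s)}"
        using o h(3) by (auto split: if_splits) (metis less_le order_refl subsetD)
    next
      fix s assume s: "s \<in> {s\<in>S. \<forall>s'\<in>S. rord (\<zeta> j - emb w s') \<le> rord (\<zeta> j - emb w s)}"
      then have "rord (\<zeta> j - emb w c) \<le> rord (\<zeta> j - emb w s)" using c h(3) by blast
      moreover have "rord (\<zeta> j - emb w c) = w \<bullet> rv h" using o[of c] c h(3) by auto
      ultimately show "s \<in> B" using o[of s] s by force
    qed
  qed
  show ?thesis using *[OF assms(1,3)] *[OF assms(2,4)] by simp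
qed

text \<open>
  Let \<open>B\<close> be a smallest bar of finite height whose closed ball contains the critical point. The open
  ball of a postbar \<open>B'\<close> contains as many critical points, \<open>card B' - 1\<close>, as the closed ball spanned by \<open>B'\<close>
  (none if \<open>B'\<close> is a single root), so a critical point in the former would contradict minimality.
\<close>

lemma shell_cover:
  assumes j: "j \<in> J"
  shows "\<exists>B\<in>fbars. j \<in> shell B"
proof -
  define P where "P B \<longleftrightarrow> B \<in> fbars \<and> (\<forall>h. height B = Fin h \<longrightarrow> (\<forall>c\<in>B. tpow (w \<bullet> rv h) dvd \<zeta> j - emb w c))" for B
  have "P S"
  proof -
    have ST: "S \<in> T" using tree_model.root[of f] unfolding Zer_f .
    have "J \<noteq> {}" using j by blast
    then have "card S \<ge> 2" using J by (metis One_nat_def card_gt_0_iff diff_is_0_eq less_numeral_extra(3) not_less_eq_eq numeral_2_eq_2)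
    then have fb: "S \<in> fbars" unfolding fbars_def using ST height_Fin_iff[OF _ nonempty] by simp
    have "tpow (w \<bullet> rv h) dvd \<zeta> j - emb w c" if h: "height S = Fin h" "c \<in> S" for h c
    proof -
      have "card {j\<in>J. tpow (w \<bullet> rv h) dvd \<zeta> j - emb w c} = card J"
        using card_ball[OF ST h] J by simp
      then have "{j\<in>J. tpow (w \<bullet> rv h) dvd \<zeta> j - emb w c} = J"
        using J(1) by (intro card_subset_eq) auto
      then show ?thesis using j by blast
    qed
    then show ?thesis unfolding P_def using fb by blast
  qed
  then obtain B where B: "P B" "\<And>C. P C \<Longrightarrow> card B \<le> card C"
    using ex_has_least_nat[of P S card] by blast
  then obtain h where h: "B \<in> T" "height B = Fin h" "B \<subseteq> S" "B \<noteq> {}" using fbarsE unfolding P_def by blast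
  obtain c where c: "c \<in> B" using h by blast
  define H where "H = w \<bullet> rv h"
  have fB: "finite B" using h fin finite_subset by blast
  define pick where "pick B' = (SOME s. s \<in> B')" for B' :: "('a, 'd) pps set"
  have pick: "pick B' \<in> B'" if "B' \<in> postbars B" for B'
    unfolding pick_def using postbars_partition(4)[OF h(3,4,2) that] by (simp add: some_in_eq)
  have "\<not> vanishes_upto H (\<zeta> j - emb w (pick B'))" if B': "B' \<in> postbars B" for B'
  proof
    assume v: "vanishes_upto H (\<zeta> j - emb w (pick B'))"
    have B'T: "B' \<in> T" using tree_model.post[OF h(1) B'] .
    have B'S: "B' \<subseteq> S" "B' \<noteq> {}" using bar_sub[OF B'T] by auto
    have "j \<in> {j\<in>J. vanishes_upto H (\<zeta> j - emb w (pick B'))}" using v j by simp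
    moreover note cO = card_open_ball[OF h(1,2) B' pick[OF B'], folded H_def]
    moreover have "finite {j\<in>J. vanishes_upto H (\<zeta> j - emb w (pick B'))}" using J(1) by simp
    ultimately have "card B' - 1 \<noteq> 0" by (metis card_0_eq empty_iff)
    then have "B' \<in> fbars" unfolding fbars_def using B'T height_Fin_iff[OF B'S] by simp
    moreover have "tpow (w \<bullet> rv h') dvd \<zeta> j - emb w c'" if h': "height B' = Fin h'" "c' \<in> B'" for h' c'
    proof -
      have lt: "H < w \<bullet> rv h'" unfolding H_def
        using postbar_props(4)[OF h(3,4,2) B' h'(1)] by (rule inner_rv_strict_mono[OF w])
      have H0: "0 \<le> w \<bullet> rv h'" by (rule inner_rv_nonneg[OF w height_nonneg[OF B'T h'(1)]])
      have "{j\<in>J. tpow (w \<bullet> rv h') dvd \<zeta> j - emb w (pick B')} \<subseteq> {j\<in>J. vanishes_upto H (\<zeta> j - emb w (pick B'))}"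
        using lt H0 by (auto simp: vanishes_upto_def tpow_dvd_iff)
      then have "{j\<in>J. tpow (w \<bullet> rv h') dvd \<zeta> j - emb w (pick B')} = {j\<in>J. vanishes_upto H (\<zeta> j - emb w (pick B'))}"
        using card_ball[OF B'T h'(1) pick[OF B']] cO J(1) by (intro card_subset_eq) auto
      then have "tpow (w \<bullet> rv h') dvd \<zeta> j - emb w (pick B')" using v j by blast
      moreover have "tpow (w \<bullet> rv h') dvd emb w (pick B') - emb w c'"
        using bar_as_ball[OF B'T h'(1) _ h'(2), of "pick B'"] pick[OF B'] B'S by blast
      ultimately have "tpow (w \<bullet> rv h') dvd (\<zeta> j - emb w (pick B')) + (emb w (pick B') - emb w c')" by (rule dvd_add)
      then show ?thesis by simp
    qed
    ultimately have "P B'" unfolding P_def by blast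
    then have "card B \<le> card B'" by (rule B(2))
    moreover have "card B' < card B" using postbar_props(1)[OF h(3,4,2) B'] fB by (rule psubset_card_mono[rotated])
    ultimately show False by simp
  qed
  moreover have "tpow H dvd \<zeta> j - emb w c" using B(1) h(2) c unfolding P_def H_def by blast
  ultimately have "j \<in> {j\<in>J. tpow H dvd \<zeta> j - emb w c} -
      (\<Union>B'\<in>postbars B. {j\<in>J. vanishes_upto H (\<zeta> j - emb w (pick B'))})" using j by blast
  then have "j \<in> shell B"
    by (simp only: shell_eq[OF h(1,2) c, of pick, OF pick] H_def)
  then show ?thesis using B(1) unfolding P_def by blast
qed

text \<open>
  At a point of the shell of \<open>B\<close> the value of \<open>f\<close> has order \<open>w \<bullet> q(B)\<close>. As this differs from \<open>v\<close>, nothing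
  cancels in \<open>f(\<zeta> j) - T\<^sup>v\<close>.
\<close>

theorem sum_over_critical_values:
  assumes v: "v > 0" and q: "\<And>B. B \<in> fbars \<Longrightarrow> q_val T B = Fin (qB B)"
    and ne: "\<And>B. B \<in> fbars \<Longrightarrow> w \<bullet> rv (qB B) \<noteq> v"
    and j: "\<And>j. g j = poly (\<Prod>s\<in>S. [:- emb w s, 1:]) (\<zeta> j) - tpow v"
  shows "(\<Sum>j\<in>J. rord (g j)) = (\<Sum>B\<in>fbars. real (t_num B - 1) * min (w \<bullet> rv (qB B)) v)"
    and "j \<in> J \<Longrightarrow> g j \<noteq> 0"
proof -
  have g: "rord (g j) = min (w \<bullet> rv (qB B)) v \<and> g j \<noteq> 0" if B: "B \<in> fbars" and jB: "j \<in> shell B" for B j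
  proof -
    obtain h where h: "B \<in> T" "height B = Fin h" "B \<subseteq> S" "B \<noteq> {}" using fbarsE[OF B] .
    obtain c where c: "c \<in> B" using h by blast
    note o = shell_order[OF h(1,2) c jB]
    have qv: "qB B = qvec B h c" using q[OF B] q_val_eq[OF h(1,2) c] by simp
    define F where "F = poly (\<Prod>s\<in>S. [:- emb w s, 1:]) (\<zeta> j)"
    have F: "F = (\<Prod>s\<in>S. \<zeta> j - emb w s)" unfolding F_def by (simp add: poly_prod)
    have F0: "F \<noteq> 0" unfolding F using o fin by auto
    have "rord F = (\<Sum>s\<in>S. rord (\<zeta> j - emb w s))" unfolding F using o fin by (intro rord_prod) auto
    also have "\<dots> = (\<Sum>s\<in>S. if s \<in> B then w \<bullet> rv h else w \<bullet> rv (lam c s))" using o by (intro sum.cong) auto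
    also have "\<dots> = (\<Sum>s\<in>B. w \<bullet> rv h) + (\<Sum>s\<in>S - B. w \<bullet> rv (lam c s))"
      using h(3) fin by (simp add: sum.If_cases Int_absorb1 Diff_eq)
    also have "\<dots> = w \<bullet> rv (qB B)"
      unfolding qv qvec_def by (simp add: inner_add_right inner_sum_right rv_sum)
    finally have oF: "rord F = w \<bullet> rv (qB B)" .
    have gj: "g j = F + - tpow v" unfolding j F_def by simp
    have tv: "(- tpow v :: 'a rps) \<noteq> 0" "rord (- tpow v :: 'a rps) = v" using v by simp_all
    have "rord (g j) = min (w \<bullet> rv (qB B)) v"
    proof (cases "w \<bullet> rv (qB B) < v")
      case True
      then show ?thesis unfolding gj using rord_add_less[OF F0 tv(1)] oF tv(2) by simp
    next
      case False
      then have lt: "v < w \<bullet> rv (qB B)" using ne[OF B] by simp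
      have "rord (- tpow v + F) = v" using rord_add_less[OF tv(1) F0] oF tv(2) lt by simp
      then show ?thesis unfolding gj using lt by (simp add: add.commute)
    qed
    moreover have "g j \<noteq> 0"
    proof
      assume "g j = 0"
      then have "F = tpow v" unfolding gj by simp
      then have "rord F = v" using v by simp
      then show False using oF ne[OF B] by simp
    qed
    ultimately show ?thesis by blast
  qed
  show "j \<in> J \<Longrightarrow> g j \<noteq> 0" using g shell_cover by blast
  have J_eq: "J = (\<Union>B\<in>fbars. shell B)"
  proof (intro equalityI subsetI)
    show "j \<in> (\<Union>B\<in>fbars. shell B)" if "j \<in> J" for j using shell_cover[OF that] by blast
  qed (auto simp: shell_def)
  have ffb: "finite fbars" unfolding fbars_def using finite_T by simp
  have "(\<Sum>j\<in>J. rord (g j)) = (\<Sum>B\<in>fbars. \<Sum>j\<in>shell B. rord (g j))"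
  proof -
    have "(\<Sum>j\<in>(\<Union>B\<in>fbars. shell B). rord (g j)) = (\<Sum>B\<in>fbars. \<Sum>j\<in>shell B. rord (g j))"
      by (rule sum.UNION_disjoint[OF ffb]) (use J(1) shell_disjoint in \<open>auto simp: shell_def\<close>)
    then show ?thesis using J_eq by simp
  qed
  also have "\<dots> = (\<Sum>B\<in>fbars. \<Sum>j\<in>shell B. min (w \<bullet> rv (qB B)) v)" using g by (intro sum.cong) auto
  also have "\<dots> = (\<Sum>B\<in>fbars. real (t_num B - 1) * min (w \<bullet> rv (qB B)) v)"
  proof (rule sum.cong[OF refl])
    fix B assume B: "B \<in> fbars"
    obtain h where h: "B \<in> T" "height B = Fin h" using fbarsE[OF B] by blast
    show "(\<Sum>j\<in>shell B. min (w \<bullet> rv (qB B)) v) = real (t_num B - 1) * min (w \<bullet> rv (qB B)) v"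
      using card_shell[OF h] by simp
  qed
  finally show "(\<Sum>j\<in>J. rord (g j)) = (\<Sum>B\<in>fbars. real (t_num B - 1) * min (w \<bullet> rv (qB B)) v)" .
qed

end

section \<open>Polytopes and the exponents of the discriminant\<close>

lemma convex_orthant: "convex orthant"
  unfolding orthant_def convex_def
  by (auto simp: cart_le_iff)

lemma closed_orthant: "closed (orthant :: (real ^ 's::finite) set)"
proof -
  have eq: "orthant = (\<Inter>i. {x :: real ^ 's. 0 \<le> x $ i})"
    unfolding orthant_def by (auto simp: cart_le_iff)
  show ?thesis unfolding eq by (intro closed_INT ballI closed_Collect_le continuous_intros)
qed

lemma zero_in_orthant: "0 \<in> orthant"
  and add_in_orthant: "x \<in> orthant \<Longrightarrow> y \<in> orthant \<Longrightarrow> x + y \<in> orthant"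
  by (auto simp: orthant_def cart_le_iff)

lemma inner_orthant: "generic W \<Longrightarrow> x \<in> orthant \<Longrightarrow> 0 \<le> W \<bullet> x"
  unfolding inner_vec_def orthant_def generic_def
  by (auto intro!: sum_nonneg mult_nonneg_nonneg simp: cart_le_iff less_imp_le)

text \<open>
  The polyhedron is convex and closed, so a point outside is strictly separated from it by a
  weight. The weight is nonnegative because the polyhedron is stable under adding vectors of the
  orthant, and it remains separating for the finitely many points of \<open>A\<close> after a small change that makes
  it generic.
\<close>

lemma mem_polyhedronI:
  fixes A :: "(rat ^ 's::finite) set"
  assumes A: "finite A" and x: "\<And>W. generic W \<Longrightarrow> \<exists>a\<in>A. W \<bullet> rv a \<le> W \<bullet> x"
  shows "x \<in> convex hull (rv ` A) + orthant"
proof (rule ccontr)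
  define C where "C = convex hull (rv ` A) + (orthant :: (real ^ 's) set)"
  assume "x \<notin> convex hull (rv ` A) + orthant"
  then have xC: "x \<notin> C" unfolding C_def .
  obtain a0 where a0: "a0 \<in> A" using generic_exists x by blast
  have "convex C" unfolding C_def by (intro convex_set_plus convex_convex_hull convex_orthant)
  moreover have "closed C"
  proof -
    have "compact (convex hull (rv ` A))" using A by (intro compact_convex_hull finite_imp_compact) simp
    from compact_closed_sums[OF this closed_orthant] show ?thesis
      unfolding C_def set_plus_def by (rule back_subst[of closed]) blast
  qed
  ultimately obtain W0 b where W0: "W0 \<bullet> x < b" "\<And>y. y \<in> C \<Longrightarrow> b < W0 \<bullet> y"
    using separating_hyperplane_closed_point[OF _ _ xC] by blast
  have inC: "rv a + y \<in> C" if "a \<in> A" "y \<in> orthant" for a y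
    unfolding C_def using that by (intro set_plus_intro hull_inc) auto
  have "0 \<le> W0"
    unfolding cart_le_iff
  proof (intro allI, rule ccontr)
    fix i assume "\<not> 0 $ i \<le> W0 $ i"
    then have neg: "W0 $ i < 0" by simp
    \<comment> \<open>Far enough along the \<open>i\<close>-th axis the value of \<open>W0\<close> would drop below the separating bound \<open>b\<close>.\<close>
    define t where "t = \<bar>W0 \<bullet> rv a0 - b\<bar> / - (W0 $ i)"
    have t0: "t \<ge> 0" unfolding t_def using neg by (intro divide_nonneg_nonneg) auto
    then have "t *\<^sub>R axis i 1 \<in> orthant"
      by (auto simp: orthant_def cart_le_iff axis_def)
    from W0(2)[OF inC[OF a0 this]] have "b < W0 \<bullet> rv a0 + t * (W0 $ i)"
      by (simp add: inner_add_right inner_axis)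
    moreover have "t * (W0 $ i) = - \<bar>W0 \<bullet> rv a0 - b\<bar>" unfolding t_def using neg by simp
    ultimately show False by linarith
  qed
  moreover define U where "U = (\<Inter>a\<in>A. {W. W \<bullet> x < W \<bullet> rv a})"
  have "open U" unfolding U_def using A by (intro open_INT ballI open_Collect_less continuous_intros)
  moreover have "W0 \<in> U"
    unfolding U_def using W0 inC[OF _ zero_in_orthant] by force
  ultimately obtain W where "W \<in> U" "generic W" using generic_dense by blast
  then show False using x[of W] unfolding U_def by force
qed

lemma newton_polytope_eq:
  fixes h :: "('a::zero, 's::finite) pps"
  assumes A: "finite A" "\<And>a. a \<in> A \<Longrightarrow> pps_coeff h a \<noteq> 0"
    and le: "\<And>W e. generic W \<Longrightarrow> pps_coeff h e \<noteq> 0 \<Longrightarrow> \<exists>a\<in>A. W \<bullet> rv a \<le> W \<bullet> rv e"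
  shows "newton_polytope h = convex hull (rv ` A) + orthant"
proof
  have np: "newton_polytope h = convex hull (\<Union>e\<in>{e. pps_coeff h e \<noteq> 0}. rv e +o orthant)"
    unfolding newton_polytope_def rv_def ..
  show "newton_polytope h \<subseteq> convex hull (rv ` A) + orthant"
    unfolding np
  proof (rule hull_minimal)
    show "convex (convex hull (rv ` A) + orthant)"
      by (intro convex_set_plus convex_convex_hull convex_orthant)
    show "(\<Union>e\<in>{e. pps_coeff h e \<noteq> 0}. rv e +o orthant) \<subseteq> convex hull (rv ` A) + orthant"
    proof (clarsimp simp: elt_set_plus_def)
      fix e :: "rat ^ 's" and o' :: "real ^ 's" assume e: "pps_coeff h e \<noteq> 0" and o: "o' \<in> orthant"
      show "rv e + o' \<in> convex hull (rv ` A) + orthant"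
      proof (rule mem_polyhedronI[OF A(1)])
        fix W :: "real ^ 's" assume W: "generic W"
        then obtain a where "a \<in> A" "W \<bullet> rv a \<le> W \<bullet> rv e" using le e by blast
        then show "\<exists>a\<in>A. W \<bullet> rv a \<le> W \<bullet> (rv e + o')"
          using inner_orthant[OF W o] by (intro bexI[of _ a]) (auto simp: inner_add_right)
      qed
    qed
  qed
  have "convex hull (rv ` A) + orthant = convex hull (rv ` A + orthant)"
    using convex_hull_set_plus[of "rv ` A" orthant] convex_hull_eq[of orthant] convex_orthant by metis
  also have "\<dots> \<subseteq> newton_polytope h" unfolding np
    by (rule hull_mono) (use A(2) in \<open>force simp: set_plus_def elt_set_plus_def\<close>)
  finally show "convex hull (rv ` A) + orthant \<subseteq> newton_polytope h" .
qed

text \<open>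
  The exponent of the same monomial after adjoining the variable \<open>V\<close>.
\<close>

definition extend_exp :: "rat ^ 'd \<Rightarrow> rat ^ ('d::finite option)" where
  "extend_exp q = (\<chi> i. case i of None \<Rightarrow> 0 | Some j \<Rightarrow> q $ j)"

lemma elementary_polytope_eq:
  "elementary_polytope (of_nat k *s q) k =
     convex hull {rv (of_nat k *s extend_exp q), rv (of_nat k *s axis None 1)} + orthant"
proof -
  have 1: "append_coord (of_nat k *s q) 0 = rv (of_nat k *s extend_exp q)"
    by (auto simp: append_coord_def extend_exp_def rv_def cart_eq_iff of_rat_mult split: option.splits)
  have 2: "append_coord 0 (of_nat k) = rv (of_nat k *s axis None 1)"
    by (auto simp: append_coord_def rv_def cart_eq_iff axis_def split: option.splits)
  show ?thesis
    unfolding elementary_polytope_def 1 2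
    using convex_hull_set_plus[of "{rv (of_nat k *s extend_exp q), rv (of_nat k *s axis None 1)}" orthant]
      convex_hull_eq[of orthant] convex_orthant by metis
qed

text \<open>
  The point of least weight of a sum of elementary polytopes: each summand contributes that endpoint
  of its edge which has smaller weight.
\<close>

definition vertex :: "'b set \<Rightarrow> ('b \<Rightarrow> nat) \<Rightarrow> ('b \<Rightarrow> rat ^ 'd::finite) \<Rightarrow> real ^ ('d option) \<Rightarrow> rat ^ ('d option)" where
  "vertex F m q W = (\<Sum>B\<in>F. of_nat (m B) *s (if W \<bullet> rv (extend_exp (q B)) < W \<bullet> rv (axis None 1) then extend_exp (q B) else axis None 1))"

lemma inner_vertex:
  "W \<bullet> rv (vertex F m q W) = (\<Sum>B\<in>F. real (m B) * min (W \<bullet> rv (extend_exp (q B))) (W \<bullet> rv (axis None 1)))"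
  unfolding vertex_def rv_sum inner_sum_right by (rule sum.cong) auto

lemma finite_vertices:
  assumes "finite F"
  shows "finite (vertex F m q ` {W. generic W})"
proof (rule finite_subset)
  show "vertex F m q ` {W. generic W} \<subseteq>
      (\<lambda>G. \<Sum>B\<in>F. of_nat (m B) *s (if B \<in> G then extend_exp (q B) else axis None 1)) ` Pow F"
  proof clarify
    fix W :: "real ^ ('b option)"
    show "vertex F m q W \<in> (\<lambda>G. \<Sum>B\<in>F. of_nat (m B) *s (if B \<in> G then extend_exp (q B) else axis None 1)) ` Pow F"
      by (rule image_eqI[of _ _ "{B\<in>F. W \<bullet> rv (extend_exp (q B)) < W \<bullet> rv (axis None 1)}"])
         (auto simp: vertex_def intro!: sum.cong)
  qed
qed (use assms in simp)

lemma sum_elementary_polytopes: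
  fixes q :: "'b \<Rightarrow> rat ^ 'd::finite"
  assumes F: "finite F" "F \<noteq> {}"
  shows "(\<Sum>B\<in>F. elementary_polytope (of_nat (m B) *s q B) (m B)) =
    convex hull (rv ` vertex F m q ` {W. generic W}) + orthant" (is "?L = ?R")
proof
  define u where "u B = rv (of_nat (m B) *s extend_exp (q B))" for B
  define z where "z B = rv (of_nat (m B) *s (axis None 1 :: rat ^ 'd option))" for B
  define E where "E B = elementary_polytope (of_nat (m B) *s q B) (m B)" for B
  have E: "E B = convex hull {u B, z B} + orthant" for B
    unfolding E_def u_def z_def by (rule elementary_polytope_eq)
  show "?L \<subseteq> ?R"
  proof
    fix x assume "x \<in> ?L"
    then obtain s where s: "x = sum s F" "\<And>B. B \<in> F \<Longrightarrow> s B \<in> E B"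
      unfolding set_sum_alt[OF F(1)] E_def by blast
    show "x \<in> ?R"
    proof (rule mem_polyhedronI[OF finite_vertices[OF F(1)]])
      fix W :: "real ^ 'd option" assume W: "generic W"
      have "real (m B) * min (W \<bullet> rv (extend_exp (q B))) (W \<bullet> rv (axis None 1)) \<le> W \<bullet> s B" if B: "B \<in> F" for B
      proof -
        define c where "c = real (m B) * min (W \<bullet> rv (extend_exp (q B))) (W \<bullet> rv (axis None 1))"
        obtain y o' where yo: "y \<in> convex hull {u B, z B}" "o' \<in> orthant" "s B = y + o'"
          using s(2)[OF B] unfolding E set_plus_def by blast
        have "convex hull {u B, z B} \<subseteq> {y. c \<le> W \<bullet> y}"
        proof (rule hull_minimal)
          show "convex {y. c \<le> W \<bullet> y}"
            using convex_halfspace_ge[of c W] by (simp add: inner_commute)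
          show "{u B, z B} \<subseteq> {y. c \<le> W \<bullet> y}"
            unfolding u_def z_def c_def by (auto intro!: mult_left_mono)
        qed
        then show ?thesis using yo inner_orthant[OF W yo(2)] unfolding c_def by (auto simp: inner_add_right)
      qed
      then have "W \<bullet> rv (vertex F m q W) \<le> W \<bullet> x"
        unfolding inner_vertex s(1) inner_sum_right by (rule sum_mono)
      then show "\<exists>a\<in>vertex F m q ` {W. generic W}. W \<bullet> rv a \<le> W \<bullet> x" using W by blast
    qed
  qed
  have L: "?L = {sum s F |s. \<forall>B\<in>F. s B \<in> E B}" unfolding E_def by (rule set_sum_alt[OF F(1)])
  have cE: "convex (E B)" for B
    unfolding E by (intro convex_set_plus convex_convex_hull convex_orthant)
  have "convex ?L" using cE unfolding E_def by (intro convex_set_sum) auto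
  moreover have "rv ` vertex F m q ` {W. generic W} \<subseteq> ?L"
  proof clarify
    fix W :: "real ^ 'd option"
    define s where "s B = (if W \<bullet> rv (extend_exp (q B)) < W \<bullet> rv (axis None 1) then u B else z B)" for B
    have "rv (vertex F m q W) = sum s F" unfolding vertex_def rv_sum s_def u_def z_def
      by (rule sum.cong) auto
    moreover have "s B \<in> E B" for B
    proof -
      have "s B \<in> convex hull {u B, z B}" unfolding s_def by (simp add: hull_inc)
      from set_plus_intro[OF this zero_in_orthant] show ?thesis unfolding E by simp
    qed
    ultimately show "rv (vertex F m q W) \<in> ?L" unfolding L by blast
  qed
  ultimately have hull: "convex hull (rv ` vertex F m q ` {W. generic W}) \<subseteq> ?L" by (rule hull_minimal[rotated])
  show "?R \<subseteq> ?L"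
  proof
    fix x assume "x \<in> ?R"
    then obtain y o' where yo: "y \<in> ?L" "o' \<in> orthant" "x = y + o'" using hull unfolding set_plus_def by blast
    then obtain s where s: "y = sum s F" "\<And>B. B \<in> F \<Longrightarrow> s B \<in> E B" unfolding L by blast
    obtain B0 where B0: "B0 \<in> F" using F by blast
    \<comment> \<open>A vector of the orthant is absorbed by any one of the summands.\<close>
    define s' where "s' = s(B0 := s B0 + o')"
    have "x = sum s' F" unfolding yo(3) s(1) s'_def using F(1) B0
      by (simp add: sum.remove[of F B0] algebra_simps)
    moreover have "s' B \<in> E B" if "B \<in> F" for B
    proof (cases "B = B0")
      case True
      obtain y1 o1 where "y1 \<in> convex hull {u B0, z B0}" "o1 \<in> orthant" "s B0 = y1 + o1"
        using s(2)[OF B0] unfolding E set_plus_def by blast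
      then have "s B0 + o' = y1 + (o1 + o')" "y1 + (o1 + o') \<in> E B0"
        unfolding E using set_plus_intro[OF _ add_in_orthant[OF _ yo(2)]] by (auto simp: add.assoc)
      then have "s B0 + o' \<in> E B0" by (simp only:)
      then show ?thesis using True by (simp add: s'_def)
    qed (use s that in \<open>simp add: s'_def\<close>)
    ultimately show "x \<in> ?L" unfolding L by blast
  qed
qed

lemma poly_pderiv_prod_linear:
  fixes y :: "'i \<Rightarrow> 'b::idom"
  assumes "finite I" "k \<in> I"
  shows "poly (pderiv (\<Prod>i\<in>I. [:- y i, 1:])) (y k) = (\<Prod>i\<in>I - {k}. y k - y i)"
proof -
  have "(\<Prod>i\<in>I. [:- y i, 1:]) = [:- y k, 1:] * (\<Prod>i\<in>I - {k}. [:- y i, 1:])"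
    using assms by (simp add: prod.remove)
  then show ?thesis by (simp only: pderiv_mult) (simp add: pderiv_pCons poly_prod)
qed

lemma weight_extend_exp:
  fixes W :: "real ^ ('d::finite option)"
  shows "W \<bullet> rv (extend_exp e) = (\<chi> i. W $ Some i) \<bullet> rv e"
  unfolding inner_vec_def rv_def extend_exp_def by (simp add: UNIV_option_conv sum.reindex)

lemma generic_restrict:
  fixes W :: "real ^ ('d::finite option)"
  assumes "generic W"
  shows "generic (\<chi> i. W $ Some i)"
  unfolding generic_def
proof (intro conjI allI injI)
  show "0 < (\<chi> i. W $ Some i) $ i" for i using generic_pos[OF assms] by simp
  fix a b assume "(\<chi> i. W $ Some i) \<bullet> rv a = (\<chi> i. W $ Some i) \<bullet> rv b"
  then have "extend_exp a = extend_exp b" using generic_eq[OF assms] by (simp add: weight_extend_exp[symmetric])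
  then have "extend_exp a $ Some i = extend_exp b $ Some i" for i by simp
  then show "a = b" by (simp add: extend_exp_def cart_eq_iff)
qed

text \<open>
  A series without \<open>V\<close> can be substituted with the restricted weight: generic weights give each
  exponent that involves \<open>V\<close> a value different from those of the other exponents.
\<close>

lemma emb_embed_pps:
  fixes W :: "real ^ ('d::finite option)"
  assumes W: "generic W"
  shows "emb W (embed_pps h) = emb (\<chi> i. W $ Some i) h"
proof (rule emb_eqI[OF W])
  note w = generic_restrict[OF W]
  show "rcoeff (emb (\<chi> i. W $ Some i) h) (W \<bullet> rv e) = pps_coeff (embed_pps h) e" for e
  proof (cases "e $ None = 0")
    case True
    have "e = extend_exp (\<chi> i. e $ Some i)"
      using True by (auto simp: extend_exp_def cart_eq_iff split: option.splits)
    then have "W \<bullet> rv e = (\<chi> i. W $ Some i) \<bullet> rv (\<chi> i. e $ Some i)" by (metis weight_extend_exp)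
    then show ?thesis using True by (simp add: rcoeff_emb(1)[OF w] embed_pps.rep_eq)
  next
    case False
    have "W \<bullet> rv e \<notin> range (\<lambda>a. (\<chi> i. W $ Some i) \<bullet> rv a)"
    proof
      assume "W \<bullet> rv e \<in> range (\<lambda>a. (\<chi> i. W $ Some i) \<bullet> rv a)"
      then obtain a where "W \<bullet> rv e = W \<bullet> rv (extend_exp a)" by (auto simp: weight_extend_exp)
      then have "e = extend_exp a" using generic_eq[OF W] by blast
      then show False using False by (simp add: extend_exp_def)
    qed
    then show ?thesis using False by (simp add: rcoeff_emb(2)[OF w] embed_pps.rep_eq)
  qed
  show "rcoeff (emb (\<chi> i. W $ Some i) h) x = 0" if "x \<notin> range (\<lambda>e. W \<bullet> rv e)" for x
    by (rule rcoeff_emb(2)[OF w]) (use that in \<open>auto simp: weight_extend_exp[symmetric]\<close>)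
qed

lemma rord_unit_mult:
  fixes c x :: "'a::idom rps"
  assumes "c \<noteq> 0" "rord c = 0" "x \<noteq> 0"
  shows "rord (c * x) = rord x"
  using assms by (simp add: rord_mult)

lemma rord_sign:
  assumes "e \<in> {1, - 1 :: 'a::idom rps}"
  shows "e \<noteq> 0" "rord e = 0"
  using assms rord_rmonom[of "1::'a" 0] by auto

text \<open>
  After the substitution of a generic weight, \<open>D_series f\<close> is up to sign and a nonzero constant
  the product of the \<open>f(\<zeta> j) - T\<^sup>v\<close> over the critical points of \<open>f\<close>, where \<open>v\<close> is the weight of \<open>V\<close>. Its order is
  the sum of \<open>(t(B) - 1) min(w \<bullet> q(B), v)\<close>, which is the weight of \<open>vertex\<close>. As \<open>W\<close> is generic, the exponent
  of this weight is the vertex itself.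
\<close>

theorem D_series_leading_exponent:
  fixes f :: "('a::{alg_closed_field, field_char_0}, 'd::finite) pps poly"
  assumes tree: "contact_tree S f" and f: "f = (\<Prod>s\<in>S. [:- s, 1:])" and W: "generic W"
  shows "pps_coeff (D_series f) (vertex {B \<in> tree_model f. height B \<noteq> Pinf} (\<lambda>B. t_num B - 1)
      (\<lambda>B. case q_val (tree_model f) B of Fin q \<Rightarrow> q) W) \<noteq> 0"
    and "pps_coeff (D_series f) e \<noteq> 0 \<Longrightarrow> W \<bullet> rv (vertex {B \<in> tree_model f. height B \<noteq> Pinf} (\<lambda>B. t_num B - 1)
      (\<lambda>B. case q_val (tree_model f) B of Fin q \<Rightarrow> q) W) \<le> W \<bullet> rv e"
proof -
  interpret contact_tree S f by (rule tree)
  define qB where "qB B = (case q_val T B of Fin q \<Rightarrow> q)" for B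
  have qB: "q_val T B = Fin (qB B)" if B: "B \<in> fbars" for B
  proof -
    obtain h where h: "B \<in> T" "height B = Fin h" "B \<noteq> {}" using fbarsE[OF B] by metis
    then obtain c where "c \<in> B" by blast
    from q_val_eq[OF h(1,2) this] show ?thesis unfolding qB_def by simp
  qed
  define w where "w = (\<chi> i. W $ Some i)"
  define v where "v = W $ None"
  have w: "generic w" unfolding w_def by (rule generic_restrict[OF W])
  have v: "v > 0" unfolding v_def by (rule generic_pos[OF W])
  have Wv: "W \<bullet> rv (axis None 1) = v"
    unfolding v_def inner_vec_def rv_def axis_def by (simp add: UNIV_option_conv sum.reindex)
  have Wext: "W \<bullet> rv (extend_exp e) = w \<bullet> rv e" for e unfolding w_def by (rule weight_extend_exp)
  interpret ew: inj_comm_ring_hom "emb w :: ('a, 'd) pps \<Rightarrow> 'a rps" by (rule emb_hom[OF w])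
  interpret ewp: map_poly_inj_comm_ring_hom "emb w :: ('a, 'd) pps \<Rightarrow> 'a rps" ..
  interpret eW: inj_comm_ring_hom "emb W :: ('a, 'd option) pps \<Rightarrow> 'a rps" by (rule emb_hom[OF W])
  define F where "F = map_poly (emb w) f"
  have F: "F = (\<Prod>s\<in>S. [:- emb w s, 1:])"
    unfolding F_def f ewp.hom_prod by (intro prod.cong) (auto simp: ew.map_poly_pCons_hom ew.hom_uminus)
  define n where "n = card S"
  have n: "n > 0" unfolding n_def using fin nonempty by (simp add: card_gt_0_iff)
  have Fn: "lead_coeff F = 1" "degree F = n"
    unfolding F n_def using lead_coeff_prod_linear[where y = "emb w" and I = S] fin by auto
  define c where "c = (rmonom (of_nat n) 0 :: 'a rps)"
  have c: "c \<noteq> 0" "rord c = 0" unfolding c_def using n by simp_all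
  \<comment> \<open>The monic multiple of the derivative; its roots are the critical points.\<close>
  define P where "P = Polynomial.smult (rmonom (1 / of_nat n) 0) (pderiv F)"
  have dF: "pderiv F = Polynomial.smult c P"
    unfolding P_def c_def using n by (simp add: rmonom_mult)
  have coP: "coeff P i = rmonom (1 / of_nat n) 0 * rmonom (of_nat (Suc i)) 0 * coeff F (Suc i)" for i
    unfolding P_def by (simp add: coeff_pderiv rconst.hom_of_nat algebra_simps flip: of_nat_Suc)
  have P1: "coeff P (n - 1) = 1"
    unfolding coP using n Fn by (simp add: rmonom_mult)
  have degP: "degree P = n - 1"
  proof (rule antisym)
    show "degree P \<le> n - 1" by (rule degree_le) (use Fn n in \<open>auto simp: coP coeff_eq_0\<close>)
    show "n - 1 \<le> degree P" by (rule le_degree) (use P1 in simp)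
  qed
  obtain \<zeta> where \<zeta>: "P = (\<Prod>j<n - 1. [:- \<zeta> j, 1:])"
    using splits_indexed[OF monic_rps_poly_splits[of P]] P1 degP by auto
  interpret weighted_tree S f w "{..<n - 1}" \<zeta> "of_nat n"
  proof
    show "pderiv (\<Prod>s\<in>S. [:- emb w s, 1:]) = Polynomial.smult (rmonom (of_nat n) 0) (\<Prod>j<n - 1. [:- \<zeta> j, 1:])"
      using dF unfolding F \<zeta> c_def .
  qed (use w n in \<open>auto simp: n_def\<close>)
  define g where "g j = poly F (\<zeta> j) - tpow v" for j
  \<comment> \<open>The weight of \<open>V\<close> is rationally independent of the weights of the other variables.\<close>
  have ne: "w \<bullet> rv (qB B) \<noteq> v" for B
  proof
    assume "w \<bullet> rv (qB B) = v"
    then have "extend_exp (qB B) = axis None 1" using generic_eq[OF W, of "extend_exp (qB B)" "axis None 1"] Wext Wv by simp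
    then have "extend_exp (qB B) $ None = axis None 1 $ None" by simp
    then show False by (simp add: extend_exp_def axis_def)
  qed
  have g: "(\<Sum>j<n - 1. rord (g j)) = (\<Sum>B\<in>fbars. real (t_num B - 1) * min (w \<bullet> rv (qB B)) v)"
    "\<And>j. j \<in> {..<n - 1} \<Longrightarrow> g j \<noteq> 0"
    using sum_over_critical_values[of v qB g] v qB ne unfolding g_def F by auto
  define p where "p = map_poly embed_pps f - [:V_var:]"
  have e0: "embed_pps 0 = (0 :: ('a, 'd option) pps)"
    by (rule pps_eqI) (simp add: embed_pps.rep_eq)
  have axis0: "0 \<le> (axis None 1 :: rat ^ 'd option)"
    by (simp add: cart_le_iff axis_def)
  have pW: "map_poly (emb W) p = F - [:tpow v:]"
  proof (rule poly_eqI)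
    fix i
    have "emb W (coeff p i) = emb w (coeff f i) - emb W (coeff [:V_var:] i)"
      unfolding p_def by (simp add: eW.hom_minus coeff_map_poly e0 emb_embed_pps[OF W] w_def)
    also have "emb W (coeff [:V_var :: ('a, 'd option) pps:] i) = coeff [:tpow v:] i"
      using emb_X_pow[OF W axis0] by (cases i) (auto simp: V_var_def Wv)
    finally show "coeff (map_poly (emb W) p) i = coeff (F - [:tpow v:]) i"
      by (simp add: coeff_map_poly F_def)
  qed
  have dpW: "map_poly (emb W) (pderiv p) = pderiv F"
  proof -
    have "map_poly (emb W) (pderiv p) = pderiv (map_poly (emb W) p)"
      by (rule poly_eqI) (simp add: coeff_map_poly coeff_pderiv eW.hom_mult eW.hom_of_nat flip: of_nat_Suc)
    then show ?thesis unfolding pW by (simp add: pderiv_diff pderiv_pCons)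
  qed
  obtain \<sigma> where \<sigma>: "\<sigma> \<in> {1, - 1}" "resultant (F - [:tpow v:]) (Polynomial.smult c P) =
      \<sigma> * c ^ degree (F - [:tpow v:]) * (\<Prod>j<n - 1. poly (F - [:tpow v:]) (\<zeta> j))"
    unfolding \<zeta> using resultant_prod_linear[OF _ c(1), of "{..<n - 1}"] by blast
  define k where "k = degree p * (degree p - 1) div 2"
  have "emb W (D_series f) = (- 1) ^ k * emb W (resultant p (pderiv p))"
    unfolding D_series_def p_def[symmetric] discriminant_def k_def[symmetric]
    by (simp add: eW.hom_mult eW.hom_power eW.hom_uminus)
  also have "emb W (resultant p (pderiv p)) = resultant (F - [:tpow v:]) (Polynomial.smult c P)"
    using eW.resultant_hom[of p "pderiv p"] unfolding pW dpW dF by simp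
  also have "\<dots> = \<sigma> * c ^ degree (F - [:tpow v:]) * (\<Prod>j<n - 1. g j)"
    unfolding \<sigma>(2) g_def by simp
  finally have D: "emb W (D_series f) = ((- 1) ^ k * \<sigma> * c ^ degree (F - [:tpow v:])) * (\<Prod>j<n - 1. g j)"
    by (simp add: mult.assoc)
  have s1: "(- 1) ^ k * \<sigma> \<in> {1, - 1}" using \<sigma>(1) by (cases "even k") auto
  have cd: "c ^ i \<noteq> 0 \<and> rord (c ^ i) = 0" for i
    using c rord_sign[of 1] by (induction i) (auto simp: rord_mult)
  have unit: "(- 1) ^ k * \<sigma> * c ^ degree (F - [:tpow v:]) \<noteq> 0"
    "rord ((- 1) ^ k * \<sigma> * c ^ degree (F - [:tpow v:])) = 0"
    using rord_sign[OF s1] cd[of "degree (F - [:tpow v:])"] by (simp_all add: rord_mult)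
  have prod: "(\<Prod>j<n - 1. g j) \<noteq> 0" using g(2) by auto
  have "rord (emb W (D_series f)) = (\<Sum>j<n - 1. rord (g j))"
    unfolding D rord_unit_mult[OF unit prod] using g(2) by (intro rord_prod) auto
  also have "\<dots> = W \<bullet> rv (vertex fbars (\<lambda>B. t_num B - 1) qB W)"
    unfolding g(1) inner_vertex Wext Wv ..
  finally have rord: "rord (emb W (D_series f)) = W \<bullet> rv (vertex fbars (\<lambda>B. t_num B - 1) qB W)" .
  have "emb W (D_series f) \<noteq> 0" unfolding D using unit prod by simp
  then have "D_series f \<noteq> 0" by auto
  then obtain e' where e': "rord (emb W (D_series f)) = W \<bullet> rv e'" "pps_coeff (D_series f) e' \<noteq> 0"
    using emb_leadE[OF W] by blast
  then have "e' = vertex fbars (\<lambda>B. t_num B - 1) qB W" using rord generic_eq[OF W] by simp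
  then show "pps_coeff (D_series f) (vertex {B \<in> tree_model f. height B \<noteq> Pinf} (\<lambda>B. t_num B - 1)
      (\<lambda>B. case q_val (tree_model f) B of Fin q \<Rightarrow> q) W) \<noteq> 0"
    using e'(2) unfolding fbars_def qB_def by simp
  show "pps_coeff (D_series f) e \<noteq> 0 \<Longrightarrow> W \<bullet> rv (vertex {B \<in> tree_model f. height B \<noteq> Pinf} (\<lambda>B. t_num B - 1)
      (\<lambda>B. case q_val (tree_model f) B of Fin q \<Rightarrow> q) W) \<le> W \<bullet> rv e"
    using rord_emb_le[OF W, of "D_series f" e] rord unfolding fbars_def qB_def by simp
qed

text \<open>
  For a root \<open>y\<close> the discriminant is a multiple of \<open>f'(y)\<close>, the product of the differences of \<open>y\<close> and the
  other roots. So the roots are distinct, and their differences are monomials times units.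
\<close>

lemma quasi_ordinary_roots:
  fixes f :: "('a::{alg_closed_field, field_char_0}, 'd::finite) pps poly"
  assumes "weierstrass_poly f" and "quasi_ordinary f"
  shows "contact_tree (Zer f) f" "f = (\<Prod>s\<in>Zer f. [:- s, 1:])"
proof -
  define n where "n = degree f"
  have f: "lead_coeff f = 1" "degree f \<ge> 1" using assms(1) by (auto simp: weierstrass_poly_def)
  obtain \<alpha> :: "nat ^ 'd" and u where u: "const_coeff u \<noteq> 0"
    "discriminant f = X_pow (\<chi> i. of_nat (\<alpha> $ i)) * u"
    using assms(2) unfolding quasi_ordinary_def by blast
  define a :: "rat ^ 'd" where "a = (\<chi> i. of_nat (\<alpha> $ i))"
  have a: "0 \<le> a" unfolding a_def by (simp add: cart_le_iff)
  define k where "k = degree f * (degree f - 1) div 2"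
  define u' where "u' = (- 1) ^ k * u"
  define D where "D = resultant f (pderiv f)"
  have "(- 1) ^ k * ((- 1) ^ k * D) = D" by (simp flip: mult.assoc power_add power_mult_distrib)
  then have D: "D = X_pow a * u'"
    using u(2) unfolding discriminant_def k_def[symmetric] D_def[symmetric] a_def[symmetric] u'_def
    by (simp add: mult.left_commute)
  have u': "const_coeff u' \<noteq> 0" using u(1) unfolding u'_def by (cases "even k") auto
  have D0: "D \<noteq> 0"
  proof
    assume "D = 0"
    then have "pps_coeff (X_pow a * u') a = 0" unfolding D by (simp only: pps_coeff_simps)
    then show False using u' by (simp add: pps_coeff_X_pow_mult[OF a])
  qed
  obtain Y where Y: "f = (\<Prod>i<n. [:- Y i, 1:])"
    using abhyankar_jung[OF f D[unfolded D_def] a u'] unfolding n_def by blast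
  obtain A B where AB: "[:D:] = A * f + B * pderiv f"
    using resultant_in_ideal[of f "pderiv f"] f unfolding D_def by auto
  have Dk: "D = poly B (Y k) * (\<Prod>i\<in>{..<n} - {k}. Y k - Y i)" if "k < n" for k
  proof -
    have "poly f (Y k) = 0" unfolding Y using that by (auto simp: poly_prod)
    moreover have "poly (pderiv f) (Y k) = (\<Prod>i\<in>{..<n} - {k}. Y k - Y i)"
      unfolding Y using that by (intro poly_pderiv_prod_linear) auto
    moreover have "poly [:D:] (Y k) = poly (A * f + B * pderiv f) (Y k)" unfolding AB ..
    ultimately show ?thesis by simp
  qed
  have ne: "Y j \<noteq> Y i" and con: "\<exists>l. has_contact (Y j) (Y i) l" if ij: "i < n" "j < n" "i \<noteq> j" for i j
  proof -
    have "(\<Prod>i\<in>{..<n} - {j}. Y j - Y i) = (Y j - Y i) * (\<Prod>i\<in>{..<n} - {j} - {i}. Y j - Y i)"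
      using ij by (intro prod.remove) auto
    then have eq: "(poly B (Y j) * (\<Prod>i\<in>{..<n} - {j} - {i}. Y j - Y i)) * (Y j - Y i) = X_pow a * u'"
      using Dk[OF ij(2)] D by (simp only: ac_simps)
    then show "Y j \<noteq> Y i" using D0 D by auto
    from divisor_of_monomial_unit[OF eq a u'] show "\<exists>l. has_contact (Y j) (Y i) l"
      unfolding has_contact_def by blast
  qed
  have inj: "inj_on Y {..<n}" using ne by (auto simp: inj_on_def)
  have Z: "Zer f = Y ` {..<n}" unfolding Zer_def Y by (auto simp: poly_prod)
  show "f = (\<Prod>s\<in>Zer f. [:- s, 1:])" unfolding Z by (subst prod.reindex[OF inj]) (simp add: Y)
  show "contact_tree (Zer f) f"
  proof
    show "finite (Zer f)" "Zer f \<noteq> {}" unfolding Z using f by (auto simp: n_def lessThan_empty_iff)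
    show "\<exists>l. has_contact y z l" if "y \<in> Zer f" "z \<in> Zer f" "y \<noteq> z" for y z
      using that con unfolding Z by auto
  qed simp
qed

theorem theorem4p1:
  fixes f :: "('a::{alg_closed_field, field_char_0}, 'd::finite) pps poly"
  assumes "weierstrass_poly f" and "quasi_ordinary f"
  shows "newton_polytope (D_series f) = tree_polytope (tree_model f)"
proof -
  note tree = quasi_ordinary_roots(1)[OF assms] and f = quasi_ordinary_roots(2)[OF assms]
  interpret contact_tree "Zer f" f by (rule tree)
  define F where "F = {B \<in> tree_model f. height B \<noteq> Pinf}"
  define m where "m B = t_num B - 1" for B :: "('a, 'd) pps set"
  define q where "q B = (case q_val (tree_model f) B of Fin q \<Rightarrow> q)" for B
  have finF: "finite F" unfolding F_def using finite_T by simp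
  define A where "A = vertex F m q ` {W. generic W}"
  have A: "finite A" unfolding A_def by (rule finite_vertices[OF finF])
  note lead = D_series_leading_exponent[OF tree f, folded F_def m_def q_def]
  have "newton_polytope (D_series f) = convex hull (rv ` A) + orthant"
    by (rule newton_polytope_eq[OF A]) (use lead in \<open>auto simp: A_def\<close>)
  also have "\<dots> = tree_polytope (tree_model f)"
  proof (cases "F = {}")
    case True
    have "A = {0}" unfolding A_def True vertex_def using generic_exists by auto
    then have "convex hull (rv ` A) + orthant = (orthant :: (real ^ 'd option) set)"
      by (simp add: set_plus_def)
    then show ?thesis using True unfolding tree_polytope_def F_def by simp
  next
    case False
    have "(\<Sum>B\<in>F. case q_val (tree_model f) B of Fin q \<Rightarrow> elementary_polytope (of_nat (t_num B - 1) *s q) (t_num B - 1))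
        = (\<Sum>B\<in>F. elementary_polytope (of_nat (m B) *s q B) (m B))"
    proof (rule sum.cong[OF refl])
      fix B assume "B \<in> F"
      then have "B \<in> fbars" unfolding F_def fbars_def .
      then obtain h where h: "B \<in> tree_model f" "height B = Fin h" "B \<noteq> {}" using fbarsE by metis
      then obtain c where "c \<in> B" by blast
      from q_val_eq[OF h(1,2) this]
      show "(case q_val (tree_model f) B of Fin q \<Rightarrow> elementary_polytope (of_nat (t_num B - 1) *s q) (t_num B - 1)) =
          elementary_polytope (of_nat (m B) *s q B) (m B)"
        unfolding q_def m_def by simp
    qed
    then show ?thesis using False sum_elementary_polytopes[OF finF False, of m q]
      unfolding tree_polytope_def F_def[symmetric] Let_def A_def by simp
  qed
  finally show ?thesis .
qed

end
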